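(* Let $f:\mathbb{R}^{d_x}\times\mathbb{R}^{d_y}\to\mathbb{R}$ be twice continuously differentiable with $\rho$-Lipschitz continuous Hessians, having at least one saddle point, and $\mu$-strongly-convex-$\mu$-strongly-concave for some $\mu>0$; write $\kappa=\rho/\mu$. Let $z^*$ be the unique saddle point. Set $M=3\rho m$ and $T=\left(2M\|z_0-z^*\|/\mu\right)^{2/3}$. Count the computational complexity of computing $F(\cdot)$ as $N$ and that of computing $\nabla F(\cdot)$ as $Nd$. Then LEN-restart, with its inner calls of LEN carried out by the Schur-decomposition implementation, with $m=\Theta(d)$ finds an $\epsilon$-root with computational complexity $$\tilde{\mathcal{O}}\big((N+d^2)(d+d^{2/3}\kappa^{2/3})\big).$$
   Context: Notation: $d=d_x+d_y$, $z=(x,y)\in\mathbb{R}^d$, $\|\cdot\|$ is the Euclidean norm (spectral norm for matrices), $m$ is a positive integer; $\tilde{\mathcal O}$ hides logarithmic factors. $f$ has $\rho$-Lipschitz continuous Hessians if $\|\nabla^2 f(x,y)-\nabla^2 f(x',y')\|\le\rho\|(x,y)-(x',y')\|$ for all points. $f$ is $\mu$-strongly-convex-$\mu$-strongly-concave if for all $x,x',y,y'$: $f(x',y)\ge f(x,y)+\langle x'-x,\nabla_x f(x,y)\rangle+\frac{\mu}{2}\|x-x'\|^2$ and $f(x,y')\le f(x,y)+\langle y'-y,\nabla_y f(x,y)\rangle-\frac{\mu}{2}\|y-y'\|^2$. A saddle point is $(x^*,y^* )$ with $f(x^*,y)\le f(x^*,y^* )\le f(x,y^* )$ for all $x,y$.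 An $\epsilon$-root is a point $\hat z$ with $\|\hat z-z^*\|\le\epsilon$. Let $F(z)=\begin{bmatrix}\nabla_x f(x,y)\\ -\nabla_y f(x,y)\end{bmatrix}$ and let $\nabla F(z)$ be its Jacobian. Implementation of LEN$(z_0,T,m,M)$: let $\pi(t)=t-(t\bmod m)$. For $t=0,\dots,T-1$: (i) if $t\bmod m=0$, compute the Schur decomposition $\nabla F(z_t)=QUQ^{-1}$ with $Q\in\mathbb{C}^{d\times d}$ unitary and $U\in\mathbb{C}^{d\times d}$ upper triangular; (ii) compute $\gamma_t$ as the root of $\phi(\gamma)=M\|(\nabla F(z_{\pi(t)})+\gamma I_d)^{-1}F(z_t)\|-\gamma$ by a binary search (linear systems with matrix $\nabla F(z_{\pi(t)})+\gamma I_d$ are solved through $Q(U+\gamma I_d)^{-1}Q^{-1}$); (iii) compute the lazy cubic step $z_{t+1/2}=z_t-Q(U+\gamma_t I_d)^{-1}Q^{-1}F(z_t)$; (iv) compute the extra-gradient step $z_{t+1}=z_t-\gamma_t^{-1}F(z_{t+1/2})$. Return $\bar z_T=\big(\sum_{t=0}^{T-1}\gamma_t^{-1}\big)^{-1}\sum_{t=0}^{T-1}\gamma_t^{-1}z_{t+1/2}$. LEN-restart$(z_0,T,m,M,S)$: set $z^{(0)}=z_0$; for $s=0,\dots,S-1$ set $z^{(s+1)}=\mathrm{LEN}(z^{(s)},T,m,M)$. The computational complexity is the cost of the oracle calls to $F$ and $\nabla F$ plus the cost of the updates, with classical linear algebra: a Schur decomposition costs $\mathcal{O}(d^3)$ and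 an upper-triangular solve by back substitution costs $\mathcal{O}(d^2)$. *)

theory Defs
  imports
    Complex_Main
    "Jordan_Normal_Form.Matrix"
    "Jordan_Normal_Form.Gauss_Jordan_Elimination"
    "Jordan_Normal_Form.Schur_Decomposition"
begin

text \<open>
  The constants of a complexity bound must not depend on the dimension, so the dimension has to be
  a term and not a type: points of $R^d$ are elements of \<^term>\<open>carrier_vec d\<close>.
\<close>

definition vnorm :: "real vec \<Rightarrow> real" where
  "vnorm v = sqrt (v \<bullet> v)"

definition spec_norm :: "real mat \<Rightarrow> real" where
  "spec_norm A = Sup {vnorm (A *\<^sub>v v) | v. v \<in> carrier_vec (dim_col A) \<and> vnorm v \<le> 1}"

definition has_gradient :: "nat \<Rightarrow> (real vec \<Rightarrow> real) \<Rightarrow> real vec \<Rightarrow> real vec \<Rightarrow> bool" where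
  "has_gradient d g z v \<longleftrightarrow> v \<in> carrier_vec d \<and>
     (\<forall>e>0. \<exists>\<delta>>0. \<forall>h\<in>carrier_vec d. vnorm h < \<delta> \<longrightarrow>
        \<bar>g (z + h) - g z - v \<bullet> h\<bar> \<le> e * vnorm h)"

definition gradient :: "nat \<Rightarrow> (real vec \<Rightarrow> real) \<Rightarrow> real vec \<Rightarrow> real vec" where
  "gradient d g z = (THE v. has_gradient d g z v)"

definition has_jacobian ::
    "nat \<Rightarrow> (real vec \<Rightarrow> real vec) \<Rightarrow> real vec \<Rightarrow> real mat \<Rightarrow> bool" where
  "has_jacobian d G z A \<longleftrightarrow> A \<in> carrier_mat d d \<and>
     (\<forall>e>0. \<exists>\<delta>>0. \<forall>h\<in>carrier_vec d. vnorm h < \<delta> \<longrightarrow>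
        vnorm (G (z + h) - G z - A *\<^sub>v h) \<le> e * vnorm h)"

definition jacobian :: "nat \<Rightarrow> (real vec \<Rightarrow> real vec) \<Rightarrow> real vec \<Rightarrow> real mat" where
  "jacobian d G z = (THE A. has_jacobian d G z A)"

definition hessian :: "nat \<Rightarrow> (real vec \<Rightarrow> real) \<Rightarrow> real vec \<Rightarrow> real mat" where
  "hessian d g = jacobian d (gradient d g)"

definition twice_cont_diff :: "nat \<Rightarrow> (real vec \<Rightarrow> real) \<Rightarrow> bool" where
  "twice_cont_diff d g \<longleftrightarrow>
     (\<forall>z\<in>carrier_vec d. \<exists>v. has_gradient d g z v) \<and>
     (\<forall>z\<in>carrier_vec d. \<exists>A. has_jacobian d (gradient d g) z A) \<and>
     (\<forall>z\<in>carrier_vec d. \<forall>e>0. \<exists>\<delta>>0. \<forall>w\<in>carrier_vec d. vnorm (w - z) < \<delta> \<longrightarrow>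
        spec_norm (hessian d g w - hessian d g z) < e)"

definition lipschitz_hessian :: "nat \<Rightarrow> real \<Rightarrow> (real vec \<Rightarrow> real) \<Rightarrow> bool" where
  "lipschitz_hessian d \<rho> g \<longleftrightarrow>
     (\<forall>z\<in>carrier_vec d. \<forall>w\<in>carrier_vec d.
        spec_norm (hessian d g z - hessian d g w) \<le> \<rho> * vnorm (z - w))"


definition joint ::
    "nat \<Rightarrow> nat \<Rightarrow> (real vec \<Rightarrow> real vec \<Rightarrow> real) \<Rightarrow> real vec \<Rightarrow> real" where
  "joint dx dy f z = f (vec_first z dx) (vec_last z dy)"

definition grad_x :: "nat \<Rightarrow> (real vec \<Rightarrow> real vec \<Rightarrow> real) \<Rightarrow> real vec \<Rightarrow> real vec \<Rightarrow> real vec" where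
  "grad_x dx f x y = gradient dx (\<lambda>u. f u y) x"

definition grad_y :: "nat \<Rightarrow> (real vec \<Rightarrow> real vec \<Rightarrow> real) \<Rightarrow> real vec \<Rightarrow> real vec \<Rightarrow> real vec" where
  "grad_y dy f x y = gradient dy (\<lambda>u. f x u) y"

definition sc_sc ::
    "nat \<Rightarrow> nat \<Rightarrow> real \<Rightarrow> (real vec \<Rightarrow> real vec \<Rightarrow> real) \<Rightarrow> bool" where
  "sc_sc dx dy \<mu> f \<longleftrightarrow>
     (\<forall>x\<in>carrier_vec dx. \<forall>x'\<in>carrier_vec dx. \<forall>y\<in>carrier_vec dy. \<forall>y'\<in>carrier_vec dy.
        f x' y \<ge> f x y + (x' - x) \<bullet> grad_x dx f x y + \<mu> / 2 * (vnorm (x - x'))\<^sup>2 \<and>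
        f x y' \<le> f x y + (y' - y) \<bullet> grad_y dy f x y - \<mu> / 2 * (vnorm (y - y'))\<^sup>2)"

definition saddle_point ::
    "nat \<Rightarrow> nat \<Rightarrow> (real vec \<Rightarrow> real vec \<Rightarrow> real) \<Rightarrow> real vec \<Rightarrow> bool" where
  "saddle_point dx dy f z \<longleftrightarrow> z \<in> carrier_vec (dx + dy) \<and>
     (\<forall>x\<in>carrier_vec dx. \<forall>y\<in>carrier_vec dy.
        f (vec_first z dx) y \<le> f (vec_first z dx) (vec_last z dy) \<and>
        f (vec_first z dx) (vec_last z dy) \<le> f x (vec_last z dy))"

definition saddle_op ::
    "nat \<Rightarrow> nat \<Rightarrow> (real vec \<Rightarrow> real vec \<Rightarrow> real) \<Rightarrow> real vec \<Rightarrow> real vec" where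
  "saddle_op dx dy f z =
     (let x = vec_first z dx; y = vec_last z dy in grad_x dx f x y @\<^sub>v - grad_y dy f x y)"


text \<open>The value of \<open>minv A\<close> is only meaningful for invertible \<open>A\<close>.\<close>

definition minv :: "'a::field mat \<Rightarrow> 'a mat" where
  "minv A = the (mat_inverse A)"

definition schur_decomp :: "nat \<Rightarrow> real mat \<Rightarrow> complex mat \<times> complex mat \<Rightarrow> bool" where
  "schur_decomp d A QU \<longleftrightarrow> (case QU of (Q, U) \<Rightarrow>
     Q \<in> carrier_mat d d \<and> U \<in> carrier_mat d d \<and>
     Q * mat_adjoint Q = 1\<^sub>m d \<and> mat_adjoint Q * Q = 1\<^sub>m d \<and>
     upper_triangular U \<and> map_mat complex_of_real A = Q * U * minv Q)"

text \<open>
  The vector $Q (U + \gamma I)^{-1} Q^{-1} v$. It is real when \<open>(Q, U)\<close> decomposes a real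
  matrix, and \<^term>\<open>map_vec Re\<close> only changes its type.
\<close>

definition schur_solve :: "complex mat \<times> complex mat \<Rightarrow> real \<Rightarrow> real vec \<Rightarrow> real vec" where
  "schur_solve QU \<gamma> v = (case QU of (Q, U) \<Rightarrow>
     map_vec Re (Q *\<^sub>v (minv (U + complex_of_real \<gamma> \<cdot>\<^sub>m 1\<^sub>m (dim_row U)) *\<^sub>v
       (minv Q *\<^sub>v map_vec complex_of_real v))))"


text \<open>
  The scalar $\gamma_t$ is a function of the lazy Jacobian $A = \nabla F(z_{\pi(t)})$ and of
  $v = F(z_t)$. \<open>exact_root\<close> is the root of $\phi$ itself. \<open>bisect_root\<close> is what an actual binary
  search computes: it starts from the bracket $[0, M \|A^{-1} v\|]$, on whose end points $\phi$ is
  nonnegative and nonpositive when $F$ is strongly monotone, halves it \<open>K\<close> times evaluating $\phi$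
  through the Schur factors, and returns the upper end point.
\<close>

type_synonym root_rule = "real mat \<Rightarrow> real vec \<Rightarrow> real"

definition exact_root :: "real \<Rightarrow> root_rule" where
  "exact_root M A v =
     (THE \<gamma>. 0 < \<gamma> \<and> M * vnorm (minv (A + \<gamma> \<cdot>\<^sub>m 1\<^sub>m (dim_row A)) *\<^sub>v v) - \<gamma> = 0)"

fun bisect :: "(real \<Rightarrow> real) \<Rightarrow> nat \<Rightarrow> real \<Rightarrow> real \<Rightarrow> real" where
  "bisect \<phi> 0 lo hi = hi"
| "bisect \<phi> (Suc k) lo hi =
     (let mid = (lo + hi) / 2
      in if \<phi> mid > 0 then bisect \<phi> k mid hi else bisect \<phi> k lo mid)"

definition bisect_root ::
    "(real mat \<Rightarrow> complex mat \<times> complex mat) \<Rightarrow> nat \<Rightarrow> real \<Rightarrow> root_rule" where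
  "bisect_root schur K M A v =
     bisect (\<lambda>\<gamma>. M * vnorm (schur_solve (schur A) \<gamma> v) - \<gamma>) K
       0 (M * vnorm (schur_solve (schur A) 0 v))"


text \<open>
  The iterates $z_t$ of LEN, with $\gamma_t$ and $z_{t+1/2}$; \<open>t - t mod m\<close> is $\pi(t)$. The
  argument \<open>schur\<close> is the routine that supplies Schur decompositions.
\<close>

fun len_z :: "nat \<Rightarrow> (real vec \<Rightarrow> real vec) \<Rightarrow> (real mat \<Rightarrow> complex mat \<times> complex mat) \<Rightarrow>
    root_rule \<Rightarrow> nat \<Rightarrow> real vec \<Rightarrow> nat \<Rightarrow> real vec" where
  "len_z d F schur rt m z0 0 = z0"
| "len_z d F schur rt m z0 (Suc t) =
     (let z = len_z d F schur rt m z0 t;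
          A = jacobian d F (len_z d F schur rt m z0 (t - t mod m));
          \<gamma> = rt A (F z);
          z_half = z - schur_solve (schur A) \<gamma> (F z)
      in z - (1 / \<gamma>) \<cdot>\<^sub>v F z_half)"

definition len_jac :: "nat \<Rightarrow> (real vec \<Rightarrow> real vec) \<Rightarrow> (real mat \<Rightarrow> complex mat \<times> complex mat) \<Rightarrow>
    root_rule \<Rightarrow> nat \<Rightarrow> real vec \<Rightarrow> nat \<Rightarrow> real mat" where
  "len_jac d F schur rt m z0 t = jacobian d F (len_z d F schur rt m z0 (t - t mod m))"

definition len_gamma :: "nat \<Rightarrow> (real vec \<Rightarrow> real vec) \<Rightarrow> (real mat \<Rightarrow> complex mat \<times> complex mat) \<Rightarrow>
    root_rule \<Rightarrow> nat \<Rightarrow> real vec \<Rightarrow> nat \<Rightarrow> real" where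
  "len_gamma d F schur rt m z0 t =
     rt (len_jac d F schur rt m z0 t) (F (len_z d F schur rt m z0 t))"

definition len_half :: "nat \<Rightarrow> (real vec \<Rightarrow> real vec) \<Rightarrow> (real mat \<Rightarrow> complex mat \<times> complex mat) \<Rightarrow>
    root_rule \<Rightarrow> nat \<Rightarrow> real vec \<Rightarrow> nat \<Rightarrow> real vec" where
  "len_half d F schur rt m z0 t = len_z d F schur rt m z0 t -
     schur_solve (schur (len_jac d F schur rt m z0 t)) (len_gamma d F schur rt m z0 t)
       (F (len_z d F schur rt m z0 t))"

text \<open>
  If $F(z_t) = 0$ then $z_t$ is the solution, $\phi$ has no positive root and the step is
  undefined; the loop stops there and $z_t$ is returned. With $T = 0$ the (empty) weighted average
  is undefined and $z_0$ is returned.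
\<close>

definition len_stop :: "nat \<Rightarrow> (real vec \<Rightarrow> real vec) \<Rightarrow> (real mat \<Rightarrow> complex mat \<times> complex mat) \<Rightarrow>
    root_rule \<Rightarrow> nat \<Rightarrow> real vec \<Rightarrow> nat \<Rightarrow> nat" where
  "len_stop d F schur rt m z0 T =
     (LEAST t. t = T \<or> F (len_z d F schur rt m z0 t) = 0\<^sub>v d)"

definition LEN :: "nat \<Rightarrow> (real vec \<Rightarrow> real vec) \<Rightarrow> (real mat \<Rightarrow> complex mat \<times> complex mat) \<Rightarrow>
    root_rule \<Rightarrow> nat \<Rightarrow> nat \<Rightarrow> real vec \<Rightarrow> real vec" where
  "LEN d F schur rt m T z0 =
     (let n = len_stop d F schur rt m z0 T
      in if n < T \<or> T = 0 then len_z d F schur rt m z0 n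
         else (1 / (\<Sum>t<T. 1 / len_gamma d F schur rt m z0 t)) \<cdot>\<^sub>v
           vec d (\<lambda>i. \<Sum>t<T. 1 / len_gamma d F schur rt m z0 t *
                              len_half d F schur rt m z0 t $ i))"

primrec LEN_restart :: "nat \<Rightarrow> (real vec \<Rightarrow> real vec) \<Rightarrow> (real mat \<Rightarrow> complex mat \<times> complex mat) \<Rightarrow>
    root_rule \<Rightarrow> nat \<Rightarrow> nat \<Rightarrow> real vec \<Rightarrow> nat \<Rightarrow> real vec" where
  "LEN_restart d F schur rt m T z0 0 = z0"
| "LEN_restart d F schur rt m T z0 (Suc s) =
     LEN d F schur rt m T (LEN_restart d F schur rt m T z0 s)"


text \<open>
  Cost of the run whose $\gamma_t$ come from \<open>bisect_root schur K M\<close>. Evaluating $F$ costs \<open>N\<close> and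
  evaluating $\nabla F$ costs \<open>N d\<close>; with a machine constant \<open>c\<close>, a Schur decomposition costs \<open>c d\<^sup>3\<close>,
  a triangular solve and a product with $Q$ or $Q^{-1}$ cost \<open>c d\<^sup>2\<close> each, and a vector operation
  costs \<open>c d\<close>. An iteration evaluates $F(z_t)$ and $F(z_{t+1/2})$ and solves \<open>K + 2\<close> linear systems
  (upper end of the bracket, \<open>K\<close> bisections, lazy cubic step).
\<close>

definition solve_cost :: "real \<Rightarrow> nat \<Rightarrow> real" where
  "solve_cost c d = 3 * c * real d ^ 2 + c * real d"

definition iter_cost :: "real \<Rightarrow> real \<Rightarrow> nat \<Rightarrow> nat \<Rightarrow> nat \<Rightarrow> nat \<Rightarrow> real" where
  "iter_cost N c d m K t =
     (if t mod m = 0 then N * real d + c * real d ^ 3 else 0) +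
     2 * N + real (K + 2) * solve_cost c d + 2 * c * real d"

text \<open>
  The summand outside the sum pays for the evaluation of $F$ that triggers an early stop or for
  the normalization of the average.
\<close>

definition LEN_cost :: "real \<Rightarrow> real \<Rightarrow> nat \<Rightarrow> (real vec \<Rightarrow> real vec) \<Rightarrow>
    (real mat \<Rightarrow> complex mat \<times> complex mat) \<Rightarrow> nat \<Rightarrow> real \<Rightarrow> nat \<Rightarrow> nat \<Rightarrow> real vec \<Rightarrow> real" where
  "LEN_cost N c d F schur K M m T z0 =
     (\<Sum>t<len_stop d F schur (bisect_root schur K M) m z0 T. iter_cost N c d m K t) +
     N + c * real d"

definition LEN_restart_cost :: "real \<Rightarrow> real \<Rightarrow> nat \<Rightarrow> (real vec \<Rightarrow> real vec) \<Rightarrow>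
    (real mat \<Rightarrow> complex mat \<times> complex mat) \<Rightarrow> nat \<Rightarrow> real \<Rightarrow> nat \<Rightarrow> nat \<Rightarrow> real vec \<Rightarrow> nat \<Rightarrow> real" where
  "LEN_restart_cost N c d F schur K M m T z0 S =
     (\<Sum>s<S. LEN_cost N c d F schur K M m T
               (LEN_restart d F schur (bisect_root schur K M) m T z0 s))"

end

theory Submission
  imports Defs "Jordan_Normal_Form.Determinant" "HOL-Analysis.L2_Norm"
begin

text \<open>
  Write $r_t$, $e_t$, $s_t$ for the norms of $z_{t+1/2} - z_t$, $z_{t+1} - z_{t+1/2}$ and
  $z_t - z_{\pi(t)}$. The Lipschitz Jacobian and $M r_t \le \gamma_t$ give
  $e_t \le r_t / (6m) + s_t / (3m)$, and since each step lies between $\pi(t)$ and $t$ for at most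
  $m$ indices $t$, this implies $\sum e_t^2 \le (9/10) \sum r_t^2$. Hence the extragradient identity
  telescopes to
  $(1/10) \sum r_t^2 + 2 \mu \sum \|z_{t+1/2} - z^*\|^2 / \gamma_t \le \|z_0 - z^*\|^2$.
  As $\gamma_t$ is nearly $M r_t$, the inequality $T^3 \le (\sum 1/\gamma_t)^2 \sum \gamma_t^2$ bounds
  $\sum 1/\gamma_t$ from below, and by Jensen's inequality one run of LEN contracts the squared
  distance to $z^*$ by a constant factor, so that logarithmically many restarts suffice.

  The norm of $\nabla F$ is not controlled by the parameters, but the bracket of the binary search
  is: $\nabla F(z_{\pi(t)})$ is $\mu$-coercive, and applied to $z_t - z^*$ it differs from $F(z_t)$ by
  at most $3 \rho D^2$, so $\|\nabla F(z_{\pi(t)})^{-1} F(z_t)\| \le D + 3 \kappa D^2$. An absolute error of order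
  $\mu$ in $\gamma_t$ is harmless, whence logarithmically many bisections suffice.
\<close>

section \<open>Euclidean norm and derivatives\<close>

text \<open>An inexact \<gamma>_t threatens a circle: the accuracy of the bisection depends on its
  bracket, the bracket on the distance of the iterates to the solution, and that distance on the
  steps taken with \<gamma>_t. The way out is that the energy inequality uses only M r_t \<le>
  \<gamma>_t. The upper end of a bracket satisfies this after any number of halvings, so all
  iterates stay within the initial distance; accuracy enters only afterwards, in the lower bound on
  the sum of 1 / \<gamma>_t.

  On the cost side, a run makes at most T / m + 1 Jacobian evaluations with Schur decompositions,
  each of order (N + d^2) d, and T iterations of order N + K d^2. Since m is of order d, the first T
  / m refreshes cost no more in order than the iterations do, and the one left over gives the
  summand d of the bound. The summand with \<kappa> is the order of T, whose dependence on d comes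
  from the factor m in M.\<close>

lemma vnorm_L2: "vnorm v = L2_set (\<lambda>i. v $ i) {0..<dim_vec v}"
  by (simp add: vnorm_def L2_set_def scalar_prod_def power2_eq_square)

lemma vnorm_nonneg [simp]: "0 \<le> vnorm v"
  by (simp add: vnorm_L2 L2_set_nonneg)

lemma vnorm_sq: "(vnorm v)\<^sup>2 = v \<bullet> v"
  by (simp add: vnorm_def scalar_prod_def sum_nonneg)

lemma vnorm_triangle:
  assumes "v \<in> carrier_vec d" "w \<in> carrier_vec d"
  shows "vnorm (v + w) \<le> vnorm v + vnorm w"
proof -
  have "L2_set (\<lambda>i. (v + w) $ i) {0..<d} = L2_set (\<lambda>i. v $ i + w $ i) {0..<d}"
    using assms by (intro L2_set_cong) auto
  then show ?thesis
    using L2_set_triangle_ineq[of "\<lambda>i. v $ i" "\<lambda>i. w $ i" "{0..<d}"] assms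
    by (simp add: vnorm_L2)
qed

lemma scalar_prod_abs_le:
  assumes "v \<in> carrier_vec d" "w \<in> carrier_vec d"
  shows "\<bar>v \<bullet> w\<bar> \<le> vnorm v * vnorm w"
proof -
  have "\<bar>v \<bullet> w\<bar> \<le> (\<Sum>i\<in>{0..<d}. \<bar>v $ i\<bar> * \<bar>w $ i\<bar>)"
    using assms by (auto simp: scalar_prod_def abs_mult[symmetric] intro: sum_abs)
  also have "\<dots> \<le> vnorm v * vnorm w"
    using L2_set_mult_ineq[of "\<lambda>i. v $ i" "\<lambda>i. w $ i" "{0..<d}"] assms by (simp add: vnorm_L2)
  finally show ?thesis .
qed

lemma vnorm_smult [simp]: "vnorm (a \<cdot>\<^sub>v v) = \<bar>a\<bar> * vnorm v"
proof -
  have "(a \<cdot>\<^sub>v v) \<bullet> (a \<cdot>\<^sub>v v) = a\<^sup>2 * (v \<bullet> v)"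
    by (simp add: power2_eq_square)
  then show ?thesis
    by (simp add: vnorm_def real_sqrt_mult)
qed

lemma vnorm_uminus [simp]: "vnorm (- v) = vnorm v"
  by (simp add: vnorm_def)

lemma vnorm_minus_commute:
  assumes "v \<in> carrier_vec d" "w \<in> carrier_vec d"
  shows "vnorm (v - w) = vnorm (w - v)"
proof -
  have "v - w = - (w - v)"
    using assms by auto
  then show ?thesis
    by simp
qed

lemma vnorm_triangle_minus:
  assumes "u \<in> carrier_vec d" "v \<in> carrier_vec d" "w \<in> carrier_vec d"
  shows "vnorm (u - w) \<le> vnorm (u - v) + vnorm (v - w)"
proof -
  have "u - w = (u - v) + (v - w)"
    using assms by auto
  then show ?thesis
    using vnorm_triangle[of "u - v" d "v - w"] assms by simp
qed

lemma vnorm_eq_0: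
  assumes "v \<in> carrier_vec d" "vnorm v = 0"
  shows "v = 0\<^sub>v d"
proof
  fix i assume "i < dim_vec (0\<^sub>v d :: real vec)"
  then show "v $ i = 0\<^sub>v d $ i"
    using assms L2_set_eq_0_iff[of "{0..<d}" "\<lambda>i. v $ i"] by (simp add: vnorm_L2)
qed (use assms in auto)

lemma vnorm_zero [simp]: "vnorm (0\<^sub>v d) = 0"
  by (simp add: vnorm_def)

lemma vnorm_minus_eq_0:
  assumes "v \<in> carrier_vec d" "w \<in> carrier_vec d" "vnorm (v - w) = 0"
  shows "v = w"
proof
  fix i assume "i < dim_vec w"
  moreover have "v - w = 0\<^sub>v d"
    by (rule vnorm_eq_0) (use assms in auto)
  then have "(v - w) $ i = 0\<^sub>v d $ i"
    by simp
  ultimately show "v $ i = w $ i"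
    using assms by auto
qed (use assms in auto)

lemma vnorm_le_by_inner:
  assumes "v \<in> carrier_vec d" "v \<bullet> v \<le> b * vnorm v" "0 \<le> b"
  shows "vnorm v \<le> b"
proof (cases "vnorm v = 0")
  case False
  then have "0 < vnorm v"
    by (simp add: order_less_le)
  then show ?thesis
    using assms(2) unfolding vnorm_sq[symmetric] by (simp add: power2_eq_square)
qed (use assms in simp)

text \<open>Replaces limits in the derivative arguments: once the scale of the increment has
  cancelled, the little-o condition leaves a bound \<open>e * y\<close> with arbitrary positive
  \<open>e\<close>.\<close>

lemma le_of_all_mult_le:
  fixes x y :: real
  assumes "\<And>e. 0 < e \<Longrightarrow> x \<le> e * y" "0 \<le> y"
  shows "x \<le> 0"
proof (rule ccontr)
  assume "\<not> x \<le> 0"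
  \<comment> \<open>This choice of \<open>e\<close> makes \<open>e * y\<close> smaller than
    \<open>x\<close>; the 1 covers \<open>y = 0\<close>.\<close>
  then have "x \<le> x / (2 * (y + 1)) * y"
    using assms by (intro assms) auto
  then show False
    using \<open>\<not> x \<le> 0\<close> assms(2) by (auto simp: field_simps)
       (smt (verit) mult_pos_pos mult_nonneg_nonneg)
qed

text \<open>Shrinks a direction into the neighbourhood supplied by differentiability. The factor
  \<open>s\<close> later cancels by homogeneity.\<close>

lemma small_multiple:
  assumes "0 < \<delta>"
  obtains s :: real where "0 < s" "s * vnorm h < \<delta>" 
proof
  show "0 < \<delta> / (vnorm h + 1)"
    using assms by (simp add: add_nonneg_pos)
  have "\<delta> * vnorm h < \<delta> * (vnorm h + 1)"
    using assms by simp
  then show "\<delta> / (vnorm h + 1) * vnorm h < \<delta>"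
    by (simp add: add_nonneg_pos pos_divide_less_eq)
qed

section \<open>Uniqueness of Jacobians and gradients\<close>

lemma smult_minus_distrib_vec:
  assumes "v \<in> carrier_vec n" "w \<in> carrier_vec n"
  shows "a \<cdot>\<^sub>v (v - w) = a \<cdot>\<^sub>v v - a \<cdot>\<^sub>v (w :: 'a :: ring vec)"
  using assms by (intro eq_vecI) (auto simp: right_diff_distrib)

lemma mat_eq_by_mult_vec:
  assumes "A \<in> carrier_mat n k" "B \<in> carrier_mat n k"
    "\<And>h. h \<in> carrier_vec k \<Longrightarrow> A *\<^sub>v h = B *\<^sub>v (h :: 'a :: ring_1 vec)"
  shows "A = B"
proof
  fix i j assume ij: "i < dim_row B" "j < dim_col B"
  have "A *\<^sub>v unit_vec k j = B *\<^sub>v unit_vec k j"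
    using assms(3) by simp
  then have "(A *\<^sub>v unit_vec k j) $ i = (B *\<^sub>v unit_vec k j) $ i"
    by simp
  then have "row A i \<bullet> unit_vec k j = row B i \<bullet> unit_vec k j"
    using assms(1,2) ij by simp
  moreover have "row C i \<bullet> unit_vec k j = C $$ (i, j)" if "C \<in> carrier_mat n k" for C :: "'a mat"
    using that ij assms(2) by (subst scalar_prod_right_unit) auto
  ultimately show "A $$ (i, j) = B $$ (i, j)"
    using assms(1,2) ij by simp
qed (use assms in auto)

text \<open>Both matrices approximate the same increment, so their values at \<open>s * h\<close>
  differ by at most \<open>2 * e * s * vnorm h\<close>, and \<open>s\<close> cancels by linearity.
  Uniqueness is what gives the definite description in \<open>jacobian\<close> its value.\<close>

lemma has_jacobian_unique:
  assumes A: "has_jacobian d G z A" and B: "has_jacobian d G z B"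
    and z: "z \<in> carrier_vec d" and G: "\<And>w. w \<in> carrier_vec d \<Longrightarrow> G w \<in> carrier_vec d"
  shows "A = B"
proof (rule mat_eq_by_mult_vec)
  show cA: "A \<in> carrier_mat d d" and cB: "B \<in> carrier_mat d d"
    using A B by (auto simp: has_jacobian_def)
  fix h :: "real vec" assume h: "h \<in> carrier_vec d"
  have "vnorm (A *\<^sub>v h - B *\<^sub>v h) \<le> 0"
  proof (rule le_of_all_mult_le)
    fix e :: real assume "0 < e"
    then obtain \<delta>1 \<delta>2 where \<delta>: "\<delta>1 > 0" "\<delta>2 > 0"
      "\<forall>h\<in>carrier_vec d. vnorm h < \<delta>1 \<longrightarrow> vnorm (G (z + h) - G z - A *\<^sub>v h) \<le> e * vnorm h"
      "\<forall>h\<in>carrier_vec d. vnorm h < \<delta>2 \<longrightarrow> vnorm (G (z + h) - G z - B *\<^sub>v h) \<le> e * vnorm h"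
      using A B unfolding has_jacobian_def by blast
    then obtain s where s: "0 < s" "s * vnorm h < min \<delta>1 \<delta>2"
      using small_multiple[of "min \<delta>1 \<delta>2" h] by auto
    let ?k = "s \<cdot>\<^sub>v h"
    have k: "?k \<in> carrier_vec d" "vnorm ?k < \<delta>1" "vnorm ?k < \<delta>2"
      using h s by auto
    have Ah: "A *\<^sub>v ?k = s \<cdot>\<^sub>v (A *\<^sub>v h)" and Bh: "B *\<^sub>v ?k = s \<cdot>\<^sub>v (B *\<^sub>v h)"
      using h cA cB by (simp_all add: mult_mat_vec)
    have "s * vnorm (A *\<^sub>v h - B *\<^sub>v h) = vnorm (A *\<^sub>v ?k - B *\<^sub>v ?k)"
      using s h cA cB vnorm_smult[of s "A *\<^sub>v h - B *\<^sub>v h"]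
      by (simp add: Ah Bh smult_minus_distrib_vec[of _ d])
    also have "A *\<^sub>v ?k - B *\<^sub>v ?k =
        (G (z + ?k) - G z - B *\<^sub>v ?k) - (G (z + ?k) - G z - A *\<^sub>v ?k)"
      using k(1) cA cB G[of "z + ?k"] G[of z] z by (intro eq_vecI) auto
    also have "vnorm \<dots> \<le> vnorm (G (z + ?k) - G z - B *\<^sub>v ?k) + vnorm (G (z + ?k) - G z - A *\<^sub>v ?k)"
      using vnorm_triangle_minus[of "G (z + ?k) - G z - B *\<^sub>v ?k" d "0\<^sub>v d" "G (z + ?k) - G z - A *\<^sub>v ?k"]
        vnorm_minus_commute[of "0\<^sub>v d" d "G (z + ?k) - G z - A *\<^sub>v ?k"]
        k(1) cA cB G[of "z + ?k"] G[of z] z by simp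
    also have "\<dots> \<le> e * vnorm ?k + e * vnorm ?k"
      using \<delta>(3)[rule_format, OF k(1,2)] \<delta>(4)[rule_format, OF k(1,3)] by (rule add_mono[rotated])
    also have "\<dots> = s * (e * (2 * vnorm h))"
      using s by simp
    finally show "vnorm (A *\<^sub>v h - B *\<^sub>v h) \<le> e * (2 * vnorm h)"
      using s by simp
  qed simp
  then have "vnorm (A *\<^sub>v h - B *\<^sub>v h) = 0"
    by (simp add: antisym)
  then show "A *\<^sub>v h = B *\<^sub>v h"
    using cA cB h by (intro vnorm_minus_eq_0[of _ d]) auto
qed

lemma jacobian_eqI:
  assumes "has_jacobian d G z A" "z \<in> carrier_vec d"
    "\<And>w. w \<in> carrier_vec d \<Longrightarrow> G w \<in> carrier_vec d"
  shows "jacobian d G z = A"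
  unfolding jacobian_def using assms by (intro the_equality) (auto intro: has_jacobian_unique)

text \<open>The test direction is \<open>v - w\<close>, in which two distinct gradients would
  disagree to first order.\<close>

lemma has_gradient_unique:
  assumes v: "has_gradient d g z v" and w: "has_gradient d g z w"
  shows "v = w"
proof -
  have cv: "v \<in> carrier_vec d" and cw: "w \<in> carrier_vec d"
    using v w by (auto simp: has_gradient_def)
  define h where "h = v - w"
  have h: "h \<in> carrier_vec d"
    using cv cw by (simp add: h_def)
  have "h \<bullet> h \<le> 0"
  proof (rule le_of_all_mult_le)
    fix e :: real assume "0 < e"
    then obtain \<delta>1 \<delta>2 where \<delta>: "\<delta>1 > 0" "\<delta>2 > 0"
      "\<forall>h\<in>carrier_vec d. vnorm h < \<delta>1 \<longrightarrow> \<bar>g (z + h) - g z - v \<bullet> h\<bar> \<le> e * vnorm h"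
      "\<forall>h\<in>carrier_vec d. vnorm h < \<delta>2 \<longrightarrow> \<bar>g (z + h) - g z - w \<bullet> h\<bar> \<le> e * vnorm h"
      using v w unfolding has_gradient_def by blast
    then obtain s where s: "0 < s" "s * vnorm h < min \<delta>1 \<delta>2"
      using small_multiple[of "min \<delta>1 \<delta>2" h] by auto
    let ?k = "s \<cdot>\<^sub>v h"
    have k: "?k \<in> carrier_vec d" "vnorm ?k < \<delta>1" "vnorm ?k < \<delta>2"
      using h s by auto
    have "s * (h \<bullet> h) = v \<bullet> ?k - w \<bullet> ?k"
      using h cv cw by (simp add: h_def minus_scalar_prod_distrib[of _ d] right_diff_distrib)
    also have "\<dots> \<le> e * vnorm ?k + e * vnorm ?k"
      using \<delta>(3,4) k by (smt (verit))
    also have "\<dots> = s * (e * (2 * vnorm h))"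
      using s by simp
    finally show "h \<bullet> h \<le> e * (2 * vnorm h)"
      using s by simp
  qed simp
  then have "vnorm h = 0"
    by (metis vnorm_sq power_eq_0_iff zero_le_power2 antisym)
  then show ?thesis
    using vnorm_minus_eq_0[OF cv cw] by (simp add: h_def)
qed

lemma gradient_eqI: "has_gradient d g z v \<Longrightarrow> gradient d g z = v"
  unfolding gradient_def by (intro the_equality) (auto intro: has_gradient_unique)

section \<open>Matrices as bounded operators\<close>

lemma vnorm_mult_mat_vec_bounded:
  fixes A :: "real mat"
  shows "\<exists>c. \<forall>v\<in>carrier_vec (dim_col A). vnorm (A *\<^sub>v v) \<le> c * vnorm v"
proof (intro exI ballI)
  fix v :: "real vec" assume v: "v \<in> carrier_vec (dim_col A)"
  have "vnorm (A *\<^sub>v v) \<le> (\<Sum>i\<in>{0..<dim_row A}. \<bar>(A *\<^sub>v v) $ i\<bar>)"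
    unfolding vnorm_L2 using L2_set_le_sum_abs[of "\<lambda>i. (A *\<^sub>v v) $ i" "{0..<dim_row A}"] by simp
  also have "\<dots> \<le> (\<Sum>i\<in>{0..<dim_row A}. vnorm (row A i) * vnorm v)"
    using v by (intro sum_mono) (auto intro!: scalar_prod_abs_le[of _ "dim_col A"])
  finally show "vnorm (A *\<^sub>v v) \<le> (\<Sum>i\<in>{0..<dim_row A}. vnorm (row A i)) * vnorm v"
    by (simp add: sum_distrib_right)
qed

text \<open>\<open>spec_norm\<close> is a supremum of reals, which says something only about sets
  that are bounded above; the crude bound by row norms supplies this, and scaling \<open>v\<close>
  to norm 1 does the rest.\<close>

lemma spec_norm_bound:
  assumes v: "v \<in> carrier_vec (dim_col A)"
  shows "vnorm (A *\<^sub>v v) \<le> spec_norm A * vnorm v"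
proof (cases "vnorm v = 0")
  case True
  then have "v = 0\<^sub>v (dim_col A)"
    using v by (rule vnorm_eq_0[rotated])
  then have "A *\<^sub>v v = 0\<^sub>v (dim_row A)"
    by (intro eq_vecI) auto
  with True show ?thesis
    by simp
next
  case False
  let ?X = "{vnorm (A *\<^sub>v v) | v. v \<in> carrier_vec (dim_col A) \<and> vnorm v \<le> 1}"
  let ?u = "(1 / vnorm v) \<cdot>\<^sub>v v"
  obtain c where c: "\<forall>v\<in>carrier_vec (dim_col A). vnorm (A *\<^sub>v v) \<le> c * vnorm v"
    using vnorm_mult_mat_vec_bounded by blast
  have "bdd_above ?X"
  proof (rule bdd_aboveI)
    fix x assume "x \<in> ?X"
    then obtain u where u: "u \<in> carrier_vec (dim_col A)" "vnorm u \<le> 1" "x = vnorm (A *\<^sub>v u)"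
      by auto
    then have "x \<le> c * vnorm u"
      using c by simp
    also have "\<dots> \<le> \<bar>c\<bar> * 1"
      using u by (intro mult_mono) auto
    finally show "x \<le> \<bar>c\<bar>"
      by simp
  qed
  moreover have "vnorm (A *\<^sub>v ?u) \<in> ?X"
    using v False by (auto simp: divide_simps intro!: exI[of _ ?u])
  ultimately have "vnorm (A *\<^sub>v ?u) \<le> spec_norm A"
    unfolding spec_norm_def by (rule cSup_upper[rotated])
  moreover have "A *\<^sub>v ?u = (1 / vnorm v) \<cdot>\<^sub>v (A *\<^sub>v v)"
    using v by (intro mult_mat_vec) auto
  ultimately have "(1 / vnorm v) * vnorm (A *\<^sub>v v) \<le> spec_norm A"
    by simp
  then show ?thesis
    using False vnorm_nonneg[of v] by (simp add: field_simps order_less_le)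
qed

section \<open>Resolvents of coercive matrices\<close>

text \<open>Injectivity makes the determinant nonzero, so \<open>mat_inverse\<close> succeeds and
  the \<open>the\<close> inside \<open>minv\<close> has a value.\<close>

lemma minv_props:
  fixes A :: "'a :: field mat"
  assumes A: "A \<in> carrier_mat d d" and inj: "\<forall>v\<in>carrier_vec d. A *\<^sub>v v = 0\<^sub>v d \<longrightarrow> v = 0\<^sub>v d"
  shows "minv A \<in> carrier_mat d d" "A * minv A = 1\<^sub>m d" "minv A * A = 1\<^sub>m d"
proof -
  have "det A \<noteq> 0"
    using det_0_iff_vec_prod_zero_field[OF A] inj by blast
  then have "A \<in> Units (ring_mat TYPE('a) d ())"
    by (rule det_non_zero_imp_unit[OF A])
  then obtain B where "mat_inverse A = Some B"
    using mat_inverse(1)[OF A, of "()"] by (cases "mat_inverse A") auto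
  then show "minv A \<in> carrier_mat d d" "A * minv A = 1\<^sub>m d" "minv A * A = 1\<^sub>m d"
    using mat_inverse(2)[OF A] by (auto simp: minv_def)
qed

text \<open>A left inverse of a square matrix forces injectivity, so \<open>minv A\<close> is a
  genuine two-sided inverse and has to agree with it.\<close>

lemma minv_eqI:
  fixes A B :: "'a :: field mat"
  assumes A: "A \<in> carrier_mat d d" and B: "B \<in> carrier_mat d d" and BA: "B * A = 1\<^sub>m d"
  shows "minv A = B"
proof -
  have inj: "\<forall>v\<in>carrier_vec d. A *\<^sub>v v = 0\<^sub>v d \<longrightarrow> v = 0\<^sub>v d"
  proof (intro ballI impI)
    fix v assume that: "v \<in> carrier_vec d" "A *\<^sub>v v = 0\<^sub>v d"
    have "v = (B * A) *\<^sub>v v"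
      using that BA by simp
    also have "\<dots> = B *\<^sub>v 0\<^sub>v d"
      using that by (subst assoc_mult_mat_vec[OF B A]) auto
    also have "\<dots> = 0\<^sub>v d"
      using B by (intro eq_vecI) auto
    finally show "v = 0\<^sub>v d" .
  qed
  note inv = minv_props[OF A inj]
  have "minv A = (B * A) * minv A"
    using inv(1) BA by simp
  also have "\<dots> = B"
    using inv B by (subst assoc_mult_mat[OF B A inv(1)]) simp
  finally show ?thesis .
qed

text \<open>The Jacobian of a saddle operator is in general not symmetric, so this bound on the
  quadratic form takes the place of a bound on eigenvalues.\<close>

definition coercive :: "nat \<Rightarrow> real \<Rightarrow> real mat \<Rightarrow> bool" where
  "coercive d \<mu> A \<longleftrightarrow> A \<in> carrier_mat d d \<and>
     (\<forall>h\<in>carrier_vec d. \<mu> * (vnorm h)\<^sup>2 \<le> h \<bullet> (A *\<^sub>v h))"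

text \<open>The real counterpart of \<open>schur_solve\<close>. It is the vector inside
  \<open>exact_root\<close>, so \<phi> becomes
  \<open>M * vnorm (resolvent A \<gamma> v) - \<gamma>\<close>.\<close>

definition resolvent :: "real mat \<Rightarrow> real \<Rightarrow> real vec \<Rightarrow> real vec" where
  "resolvent A \<gamma> v = minv (A + \<gamma> \<cdot>\<^sub>m 1\<^sub>m (dim_row A)) *\<^sub>v v"

lemma shift_mult_vec:
  assumes "A \<in> carrier_mat d d" "h \<in> carrier_vec d"
  shows "(A + \<gamma> \<cdot>\<^sub>m 1\<^sub>m d) *\<^sub>v h = A *\<^sub>v h + \<gamma> \<cdot>\<^sub>v (h :: 'a :: comm_ring_1 vec)"
proof
  fix i assume "i < dim_vec (A *\<^sub>v h + \<gamma> \<cdot>\<^sub>v h)"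
  then have i: "i < d"
    using assms by simp
  have "row (A + \<gamma> \<cdot>\<^sub>m 1\<^sub>m d) i = row A i + \<gamma> \<cdot>\<^sub>v unit_vec d i"
    using assms i by (intro eq_vecI) auto
  then show "((A + \<gamma> \<cdot>\<^sub>m 1\<^sub>m d) *\<^sub>v h) $ i = (A *\<^sub>v h + \<gamma> \<cdot>\<^sub>v h) $ i"
    using assms i by (simp add: add_scalar_prod_distrib[of _ d])
qed (use assms in auto)

lemma coercive_shift:
  assumes "coercive d \<mu> A"
  shows "coercive d (\<mu> + \<gamma>) (A + \<gamma> \<cdot>\<^sub>m 1\<^sub>m d)"
proof -
  have A: "A \<in> carrier_mat d d" and mu: "\<And>h. h \<in> carrier_vec d \<Longrightarrow> \<mu> * (vnorm h)\<^sup>2 \<le> h \<bullet> (A *\<^sub>v h)"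
    using assms by (auto simp: coercive_def)
  have "(\<mu> + \<gamma>) * (vnorm h)\<^sup>2 \<le> h \<bullet> ((A + \<gamma> \<cdot>\<^sub>m 1\<^sub>m d) *\<^sub>v h)" if h: "h \<in> carrier_vec d" for h
    using A h mu[OF h]
    by (simp add: shift_mult_vec[OF A h] scalar_prod_add_distrib[of _ d] vnorm_sq algebra_simps)
  then show ?thesis
    using A by (simp add: coercive_def)
qed

lemma coercive_lower:
  assumes "coercive d \<mu> A" "h \<in> carrier_vec d"
  shows "\<mu> * vnorm h \<le> vnorm (A *\<^sub>v h)"
proof (cases "vnorm h = 0")
  case False
  then have "0 < vnorm h"
    by (simp add: order_less_le)
  moreover have "\<mu> * (vnorm h)\<^sup>2 \<le> vnorm h * vnorm (A *\<^sub>v h)"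
    using assms scalar_prod_abs_le[of h d "A *\<^sub>v h"] by (force simp: coercive_def)
  ultimately show ?thesis
    by (simp add: power2_eq_square)
qed simp

lemma coercive_inj:
  assumes "coercive d \<mu> A" "0 < \<mu>"
  shows "\<forall>v\<in>carrier_vec d. A *\<^sub>v v = 0\<^sub>v d \<longrightarrow> v = 0\<^sub>v d"
proof (intro ballI impI)
  fix v :: "real vec" assume v: "v \<in> carrier_vec d" "A *\<^sub>v v = 0\<^sub>v d"
  have "\<mu> * vnorm v \<le> 0"
    using coercive_lower[OF assms(1) v(1)] v(2) by simp
  then have "vnorm v \<le> 0"
    using \<open>0 < \<mu>\<close> by (simp add: mult_le_0_iff)
  then show "v = 0\<^sub>v d"
    using v(1) by (intro vnorm_eq_0) (auto intro: antisym)
qed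

context
  fixes d :: nat and \<mu> :: real and A :: "real mat"
  assumes A: "coercive d \<mu> A" and \<mu>: "0 < \<mu>"
begin

lemma coercive_carrier: "A \<in> carrier_mat d d"
  using A by (simp add: coercive_def)

lemma resolvent_props:
  assumes v: "v \<in> carrier_vec d" and \<gamma>: "0 \<le> \<gamma>"
  shows "resolvent A \<gamma> v \<in> carrier_vec d"
    and "(A + \<gamma> \<cdot>\<^sub>m 1\<^sub>m d) *\<^sub>v resolvent A \<gamma> v = v"
proof -
  let ?B = "A + \<gamma> \<cdot>\<^sub>m 1\<^sub>m d"
  have B: "coercive d (\<mu> + \<gamma>) ?B"
    by (rule coercive_shift[OF A])
  have cB: "?B \<in> carrier_mat d d"
    using coercive_carrier by simp
  have pos: "0 < \<mu> + \<gamma>"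
    using \<mu> \<gamma> by simp
  note inv = minv_props[OF cB coercive_inj[OF B pos]]
  have res: "resolvent A \<gamma> v = minv ?B *\<^sub>v v"
    using coercive_carrier by (simp add: resolvent_def)
  show "resolvent A \<gamma> v \<in> carrier_vec d"
    using inv(1) v by (simp add: res)
  show "?B *\<^sub>v resolvent A \<gamma> v = v"
    using v inv by (simp add: res assoc_mult_mat_vec[OF cB inv(1) v, symmetric])
qed

lemma resolvent_eq:
  assumes v: "v \<in> carrier_vec d" and \<gamma>: "0 \<le> \<gamma>"
  shows "A *\<^sub>v resolvent A \<gamma> v + \<gamma> \<cdot>\<^sub>v resolvent A \<gamma> v = v"
  using resolvent_props[OF assms] by (simp add: shift_mult_vec[OF coercive_carrier])

text \<open>A form of the resolvent identity: both vectors solve a shifted system with the same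
  right-hand side, so only the difference of the shifts remains. All estimates of how the norm
  varies with \<gamma> rest on it.\<close>

lemma resolvent_difference:
  assumes v: "v \<in> carrier_vec d" and \<gamma>: "0 \<le> \<gamma>" and \<gamma>': "0 \<le> \<gamma>'"
  shows "(A + \<gamma> \<cdot>\<^sub>m 1\<^sub>m d) *\<^sub>v (resolvent A \<gamma> v - resolvent A \<gamma>' v) = (\<gamma>' - \<gamma>) \<cdot>\<^sub>v resolvent A \<gamma>' v"
proof -
  let ?w = "resolvent A \<gamma> v" and ?w' = "resolvent A \<gamma>' v"
  note w = resolvent_props(1)[OF v \<gamma>] resolvent_props(1)[OF v \<gamma>']
  have "(A + \<gamma> \<cdot>\<^sub>m 1\<^sub>m d) *\<^sub>v (?w - ?w') = (A + \<gamma> \<cdot>\<^sub>m 1\<^sub>m d) *\<^sub>v ?w - (A + \<gamma> \<cdot>\<^sub>m 1\<^sub>m d) *\<^sub>v ?w'"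
    using coercive_carrier w by (intro mult_minus_distrib_mat_vec[of _ d d]) auto
  also have "\<dots> = (A *\<^sub>v ?w' + \<gamma>' \<cdot>\<^sub>v ?w') - (A *\<^sub>v ?w' + \<gamma> \<cdot>\<^sub>v ?w')"
    unfolding resolvent_props(2)[OF v \<gamma>] resolvent_eq[OF v \<gamma>'] shift_mult_vec[OF coercive_carrier w(2)] ..
  also have "\<dots> = (\<gamma>' - \<gamma>) \<cdot>\<^sub>v ?w'"
    using w coercive_carrier by (intro eq_vecI) (auto simp: algebra_simps)
  finally show ?thesis .
qed

text \<open>Let \<open>u\<close> be the difference of the two resolvents. Coercivity and the
  resolvent identity bound \<open>u\<close>, which gives the last two claims. Pairing the identity
  with \<open>u\<close> shows that \<open>u\<close> has a nonnegative product with the resolvent at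
  \<open>\<gamma>'\<close>, and Cauchy-Schwarz then gives monotonicity. The latter makes the root of
  \<phi> unique; the third claim compares the two ends of a bisection bracket.\<close>

lemma resolvent_mono:
  assumes v: "v \<in> carrier_vec d" and \<gamma>: "0 \<le> \<gamma>" "\<gamma> \<le> \<gamma>'"
  shows "vnorm (resolvent A \<gamma>' v) \<le> vnorm (resolvent A \<gamma> v)"
    and "vnorm (resolvent A \<gamma> v - resolvent A \<gamma>' v) \<le> (\<gamma>' - \<gamma>) / \<mu> * vnorm (resolvent A \<gamma>' v)"
    and "vnorm (resolvent A \<gamma> v) \<le> (1 + (\<gamma>' - \<gamma>) / \<mu>) * vnorm (resolvent A \<gamma>' v)"
proof -
  let ?w = "resolvent A \<gamma> v" and ?w' = "resolvent A \<gamma>' v" and ?B = "A + \<gamma> \<cdot>\<^sub>m 1\<^sub>m d"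
  have \<gamma>': "0 \<le> \<gamma>'"
    using \<gamma> by simp
  note w = resolvent_props(1)[OF v \<gamma>(1)] resolvent_props(1)[OF v \<gamma>']
  define u where "u = ?w - ?w'"
  have u: "u \<in> carrier_vec d"
    using w by (simp add: u_def)
  have Bu: "?B *\<^sub>v u = (\<gamma>' - \<gamma>) \<cdot>\<^sub>v ?w'"
    unfolding u_def by (rule resolvent_difference[OF v \<gamma>(1) \<gamma>'])
  have B: "coercive d (\<mu> + \<gamma>) ?B"
    by (rule coercive_shift[OF A])
  have "\<mu> * vnorm u \<le> (\<mu> + \<gamma>) * vnorm u"
    using \<gamma> by (intro mult_right_mono) auto
  also have "\<dots> \<le> (\<gamma>' - \<gamma>) * vnorm ?w'"
    using coercive_lower[OF B u] \<gamma> by (simp add: Bu)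
  finally show diff: "vnorm (?w - ?w') \<le> (\<gamma>' - \<gamma>) / \<mu> * vnorm ?w'"
    using \<mu> by (simp add: u_def field_simps)
  have "?w = u + ?w'"
    using w by (auto simp: u_def)
  then have "vnorm ?w \<le> vnorm u + vnorm ?w'"
    using vnorm_triangle[OF u w(2)] by simp
  then show "vnorm ?w \<le> (1 + (\<gamma>' - \<gamma>) / \<mu>) * vnorm ?w'"
    using diff by (simp add: u_def algebra_simps)
  show "vnorm ?w' \<le> vnorm ?w"
  proof (cases "\<gamma> = \<gamma>'")
    case False
    then have lt: "0 < \<gamma>' - \<gamma>"
      using \<gamma> by simp
    have "0 \<le> (\<mu> + \<gamma>) * (vnorm u)\<^sup>2"
      using \<mu> \<gamma> by simp
    also have "\<dots> \<le> u \<bullet> (?B *\<^sub>v u)"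
      using B u by (simp add: coercive_def)
    also have "\<dots> = (\<gamma>' - \<gamma>) * (u \<bullet> ?w')"
      using u w by (simp add: Bu)
    finally have "0 \<le> u \<bullet> ?w'"
      using lt by (simp add: zero_le_mult_iff)
    then have "?w' \<bullet> ?w' \<le> ?w \<bullet> ?w'"
      using w by (simp add: u_def minus_scalar_prod_distrib[of _ d])
    also have "\<dots> \<le> vnorm ?w * vnorm ?w'"
      using scalar_prod_abs_le[OF w] by simp
    finally show ?thesis
      using w by (intro vnorm_le_by_inner[of _ d]) auto
  qed simp
qed

lemma resolvent_pos:
  assumes v: "v \<in> carrier_vec d" "v \<noteq> 0\<^sub>v d" and \<gamma>: "0 \<le> \<gamma>"
  shows "0 < vnorm (resolvent A \<gamma> v)"
proof (rule ccontr)
  assume "\<not> ?thesis"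
  then have "vnorm (resolvent A \<gamma> v) = 0"
    by (simp add: antisym)
  then have "resolvent A \<gamma> v = 0\<^sub>v d"
    using resolvent_props(1)[OF v(1) \<gamma>] by (rule vnorm_eq_0[rotated])
  then have "v = (A + \<gamma> \<cdot>\<^sub>m 1\<^sub>m d) *\<^sub>v 0\<^sub>v d"
    using resolvent_props(2)[OF v(1) \<gamma>] by simp
  also have "\<dots> = 0\<^sub>v d"
    using coercive_carrier by (intro eq_vecI) auto
  finally show False
    using v by simp
qed

lemma continuous_on_resolvent_norm:
  assumes v: "v \<in> carrier_vec d"
  shows "continuous_on {0..} (\<lambda>\<gamma>. vnorm (resolvent A \<gamma> v))"
proof -
  let ?r = "\<lambda>\<gamma>. vnorm (resolvent A \<gamma> v)"
  \<comment> \<open>A Lipschitz constant; the 1 keeps it positive when \<open>v\<close> is the zero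
    vector.\<close>
  define c where "c = ?r 0 / \<mu> + 1"
  have c: "0 < c"
    using \<mu> by (simp add: c_def add_nonneg_pos)
  have lip: "\<bar>?r x - ?r y\<bar> \<le> c * (y - x)" if "0 \<le> x" "x \<le> y" for x y
  proof -
    have "?r x \<le> ?r y + (y - x) / \<mu> * ?r y" "?r y \<le> ?r x" "?r y \<le> ?r 0"
      using resolvent_mono[OF v that] resolvent_mono(1)[OF v, of 0 y] that by (auto simp: algebra_simps)
    moreover have "(y - x) / \<mu> * ?r y \<le> (y - x) / \<mu> * ?r 0"
      using that \<mu> \<open>?r y \<le> ?r 0\<close> by (intro mult_left_mono) auto
    moreover have "(y - x) / \<mu> * ?r 0 \<le> c * (y - x)"
      using that by (simp add: c_def algebra_simps)
    ultimately show ?thesis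
      by linarith
  qed
  show ?thesis
    unfolding continuous_on_def tendsto_iff eventually_at
  proof (intro ballI allI impI)
    fix x e :: real assume x: "x \<in> {0..}" and e: "0 < e"
    have "dist (?r y) (?r x) < e" if y: "y \<in> {0..}" "dist y x < e / c" for y
    proof -
      have "\<bar>?r x - ?r y\<bar> \<le> c * \<bar>y - x\<bar>"
      proof (cases "x \<le> y")
        case True
        then show ?thesis
          using lip[of x y] x by simp
      next
        case False
        then show ?thesis
          using lip[of y x] y by (simp add: abs_minus_commute)
      qed
      also have "\<dots> < e"
        using y(2) c by (simp add: dist_real_def pos_less_divide_eq mult.commute)
      finally show ?thesis
        by (simp add: dist_real_def abs_minus_commute)
    qed
    then show "\<exists>d>0. \<forall>y\<in>{0..}. y \<noteq> x \<and> dist y x < d \<longrightarrow> dist (?r y) (?r x) < e"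
      using divide_pos_pos[OF e c] by blast
  qed
qed

text \<open>\<phi> is continuous, positive at 0, and nonpositive at \<open>M * ?r 0\<close> because
  the norm of the resolvent does not increase; so a root exists. Of two roots the larger would have
  the smaller resolvent, hence they coincide.\<close>

lemma exact_root_props:
  assumes v: "v \<in> carrier_vec d" "v \<noteq> 0\<^sub>v d" and M: "0 < M"
  shows "0 < exact_root M A v" 
    and "M * vnorm (resolvent A (exact_root M A v) v) = exact_root M A v"
proof -
  let ?r = "\<lambda>\<gamma>. vnorm (resolvent A \<gamma> v)"
  let ?P = "\<lambda>\<gamma>. 0 < \<gamma> \<and> M * ?r \<gamma> - \<gamma> = 0"
  let ?b = "M * ?r 0"
  have b: "0 < ?b"
    using M resolvent_pos[OF v, of 0] by simp
  have "\<exists>x. 0 \<le> x \<and> x \<le> ?b \<and> ?r x * M - x = 0"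
  proof (rule IVT2')
    show "?r ?b * M - ?b \<le> 0"
      using mult_right_mono[OF resolvent_mono(1)[OF v(1), of 0 ?b], of M] M b by (simp add: mult.commute)
    show "0 \<le> ?r 0 * M - 0" "0 \<le> ?b"
      using b by (auto simp: mult.commute)
    have "continuous_on {0..?b} ?r"
      by (rule continuous_on_subset[OF continuous_on_resolvent_norm[OF v(1)]]) auto
    then show "continuous_on {0..?b} (\<lambda>x. ?r x * M - x)"
      by (intro continuous_intros)
  qed
  then obtain x where x: "0 \<le> x" "M * ?r x = x"
    by (auto simp: mult.commute)
  have "x \<noteq> 0"
    using x b by auto
  then have Px: "?P x"
    using x by simp
  have le: "y = z" if "?P y" "?P z" "y \<le> z" for y z
  proof -
    have "M * ?r z \<le> M * ?r y"
      using M that resolvent_mono(1)[OF v(1), of y z] by (intro mult_left_mono) auto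
    then show ?thesis
      using that by simp
  qed
  then have uniq: "y = z" if "?P y" "?P z" for y z
    using that le[of y z] le[of z y] by linarith
  have "exact_root M A v = (THE \<gamma>. ?P \<gamma>)"
    by (simp add: exact_root_def resolvent_def)
  also have "?P \<dots>"
    using theI[of ?P x] Px uniq by blast
  finally show "0 < exact_root M A v" "M * ?r (exact_root M A v) = exact_root M A v"
    by auto
qed

end

text \<open>\<open>bisect\<close> returns only the upper end of its last bracket. The lower end
  \<open>l\<close> is recovered here because the error analysis compares \<phi> at both ends. Since
  \<phi> is nonpositive at the upper end, the returned value errs on the large side.\<close>

lemma bisect_bracket:
  assumes "0 \<le> lo" "lo < hi" "\<phi> hi \<le> 0" "lo = 0 \<or> 0 < \<phi> lo"
  shows "\<exists>l\<ge>0. l < bisect \<phi> K lo hi \<and> \<phi> (bisect \<phi> K lo hi) \<le> 0 \<and> (l = 0 \<or> 0 < \<phi> l) \<and>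
    bisect \<phi> K lo hi - l = (hi - lo) / 2 ^ K"
  using assms
proof (induction K arbitrary: lo hi)
  case 0
  then show ?case by auto
next
  case (Suc K)
  let ?mid = "(lo + hi) / 2"
  show ?case
  proof (cases "0 < \<phi> ?mid")
    case True
    have "(hi - ?mid) / 2 ^ K = (hi - lo) / 2 ^ Suc K"
      by (simp add: field_simps)
    moreover have "?mid < hi" "0 \<le> ?mid"
      using Suc.prems by auto
    ultimately show ?thesis
      using Suc.IH[of ?mid hi] Suc.prems(3) True unfolding bisect.simps Let_def by (simp only: if_True) blast
  next
    case False
    have "(?mid - lo) / 2 ^ K = (hi - lo) / 2 ^ Suc K"
      by (simp add: field_simps)
    moreover have "lo < ?mid" "\<phi> ?mid \<le> 0"
      using Suc.prems False by auto
    ultimately show ?thesis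
      using Suc.IH[of lo ?mid] Suc.prems(1,4) False unfolding bisect.simps Let_def by (simp only: if_False)
  qed
qed

text \<open>\<open>U + \<gamma> I\<close> is the conjugate of \<open>A + \<gamma> I\<close> by the
  unitary \<open>Q\<close>, so its inverse is the conjugate of a real inverse, and the outer factors
  in \<open>schur_solve\<close> undo the conjugation. Coercivity makes the shifted matrix
  invertible.\<close>

lemma schur_solve_eq_resolvent:
  assumes A: "coercive d \<mu> A" and \<mu>: "0 < \<mu>" and S: "schur_decomp d A QU"
    and v: "v \<in> carrier_vec d" and \<gamma>: "0 \<le> \<gamma>"
  shows "schur_solve QU \<gamma> v = resolvent A \<gamma> v"
proof -
  obtain Q U where QU: "QU = (Q, U)"
    by (cases QU)
  define P where "P = mat_adjoint Q"
  have cA: "A \<in> carrier_mat d d"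
    using A by (simp add: coercive_def)
  have cQ: "Q \<in> carrier_mat d d" and cU: "U \<in> carrier_mat d d"
    and PQ: "P * Q = 1\<^sub>m d" and QP: "Q * P = 1\<^sub>m d" and AC: "map_mat complex_of_real A = Q * U * minv Q"
    using S by (auto simp: schur_decomp_def QU P_def)
  have cP: "P \<in> carrier_mat d d"
    using cQ by (intro carrier_matI) (auto simp: P_def mat_adjoint_def)
  have P: "minv Q = P"
    by (rule minv_eqI[OF cQ cP PQ])
  define I where "I = complex_of_real \<gamma> \<cdot>\<^sub>m 1\<^sub>m d"
  have cI: "I \<in> carrier_mat d d"
    by (simp add: I_def)
  define B where "B = A + \<gamma> \<cdot>\<^sub>m 1\<^sub>m d"
  have cB: "B \<in> carrier_mat d d"
    using cA by (simp add: B_def)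
  have B: "coercive d (\<mu> + \<gamma>) B"
    unfolding B_def by (rule coercive_shift[OF A])
  have pos: "0 < \<mu> + \<gamma>"
    using \<mu> \<gamma> by simp
  note inv = minv_props[OF cB coercive_inj[OF B pos]]
  define BC where "BC = map_mat complex_of_real B"
  define RC where "RC = map_mat complex_of_real (minv B)"
  have cBC: "BC \<in> carrier_mat d d" and cRC: "RC \<in> carrier_mat d d"
    using cB inv(1) by (auto simp: BC_def RC_def)
  have RB: "RC * BC = 1\<^sub>m d"
    unfolding RC_def BC_def of_real_hom.mat_hom_mult[OF inv(1) cB, symmetric] inv(3) by (rule of_real_hom.mat_hom_one)
  have BC_eq: "BC = Q * U * P + I"
    unfolding BC_def B_def P[symmetric] AC[symmetric] I_def using cA by (intro eq_matI) auto
  have QI: "I * Q = Q * I"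
    using cQ by (simp add: I_def mult_smult_assoc_mat[of _ d d _ d] mult_smult_distrib[of _ d d _ d])
  have QV: "BC * Q = Q * (U + I)"
  proof -
    have "BC * Q = Q * U * P * Q + I * Q"
      unfolding BC_eq using cQ cU cP cI by (intro add_mult_distrib_mat) auto
    also have "Q * U * P * Q = Q * U"
      using cQ cU cP PQ by (simp add: assoc_mult_mat[of _ d d _ d _ d])
    also have "Q * U + I * Q = Q * (U + I)"
      unfolding QI using cQ cU cI by (intro mult_add_distrib_mat[symmetric]) auto
    finally show ?thesis .
  qed
  \<comment> \<open>By \<open>minv_eqI\<close> a left inverse is enough, so only this order of the
    product is computed.\<close>
  have "(P * RC * Q) * (U + I) = P * (RC * (BC * Q))"
    unfolding QV using cP cRC cQ cU cI by (simp add: assoc_mult_mat[of _ d d _ d _ d])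
  also have "\<dots> = P * ((RC * BC) * Q)"
    using cP cRC cQ cBC by (simp add: assoc_mult_mat[of _ d d _ d _ d])
  also have "\<dots> = 1\<^sub>m d"
    using cQ PQ by (simp add: RB)
  finally have V: "minv (U + I) = P * RC * Q"
    using cP cRC cQ cU cI by (intro minv_eqI) auto
  let ?v = "map_vec complex_of_real v"
  have cv: "?v \<in> carrier_vec d"
    using v by simp
  have "Q *\<^sub>v ((P * RC * Q) *\<^sub>v (P *\<^sub>v ?v)) = (Q * (P * RC * Q) * P) *\<^sub>v ?v"
    using cP cRC cQ cv by (simp add: assoc_mult_mat_vec[of _ d d _ d])
  also have "Q * (P * RC * Q) * P = (Q * P) * RC * (Q * P)"
    using cP cRC cQ by (simp add: assoc_mult_mat[of _ d d _ d _ d])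
  also have "\<dots> = RC"
    using QP cRC by simp
  also have "RC *\<^sub>v ?v = map_vec complex_of_real (minv B *\<^sub>v v)"
    unfolding RC_def by (rule of_real_hom.mult_mat_vec_hom[OF inv(1) v, symmetric])
  finally have "schur_solve QU \<gamma> v = map_vec Re (map_vec complex_of_real (minv B *\<^sub>v v))"
    using cU by (simp add: schur_solve_def QU P I_def[symmetric] V)
  also have "\<dots> = minv B *\<^sub>v v"
    by (intro eq_vecI) auto
  also have "\<dots> = resolvent A \<gamma> v"
    using cA by (simp add: resolvent_def B_def)
  finally show ?thesis .
qed

text \<open>
  All that the convergence proof needs from a rule for \<open>\<gamma>\<close>: it overestimates the root by a
  relative error \<open>\<tau>\<close> plus \<open>\<tau> \<mu>\<close>, the latter being harmless because an iterate with a small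
  \<open>\<gamma>\<close> dominates the weighted average. The bound \<open>b\<close> limits the initial bracket of the bisection.
\<close>

definition good_rule :: "nat \<Rightarrow> real \<Rightarrow> real \<Rightarrow> real \<Rightarrow> real \<Rightarrow> root_rule \<Rightarrow> bool" where
  "good_rule d \<mu> M \<tau> b rt \<longleftrightarrow>
     (\<forall>A v. coercive d \<mu> A \<longrightarrow> v \<in> carrier_vec d \<longrightarrow> v \<noteq> 0\<^sub>v d \<longrightarrow>
        0 < rt A v \<and> M * vnorm (resolvent A (rt A v) v) \<le> rt A v \<and>
        (M * vnorm (resolvent A 0 v) \<le> b \<longrightarrow>
           rt A v \<le> (1 + \<tau>) * (M * vnorm (resolvent A (rt A v) v)) + \<tau> * \<mu>))"

lemma good_rule_exact:
  assumes "0 < \<mu>" "0 < M" "0 \<le> \<tau>"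
  shows "good_rule d \<mu> M \<tau> b (exact_root M)"
  unfolding good_rule_def
proof (intro allI impI conjI)
  fix A and v :: "real vec" assume A: "coercive d \<mu> A" and v: "v \<in> carrier_vec d" "v \<noteq> 0\<^sub>v d"
  note root = exact_root_props[OF A assms(1) v assms(2)]
  show "0 < exact_root M A v" "M * vnorm (resolvent A (exact_root M A v) v) \<le> exact_root M A v"
    using root by auto
  show "exact_root M A v \<le> (1 + \<tau>) * (M * vnorm (resolvent A (exact_root M A v) v)) + \<tau> * \<mu>"
    unfolding root(2) using root(1) assms by (simp add: algebra_simps)
qed

text \<open>For a starting bracket of length at most \<open>b\<close>, the bracket left after
  \<open>K\<close> halvings has length at most \<open>\<tau> * \<mu>\<close>. Across it the norm of
  the resolvent changes by a factor of at most \<open>1 + \<tau>\<close>, so writing the result as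
  \<open>l + (h - l)\<close> separates the relative from the absolute part of the error.\<close>

lemma good_rule_bisect:
  assumes \<mu>: "0 < \<mu>" and M: "0 < M" and schur: "\<forall>A\<in>carrier_mat d d. schur_decomp d A (schur A)"
    and K: "b \<le> \<tau> * \<mu> * 2 ^ K"
  shows "good_rule d \<mu> M \<tau> b (bisect_root schur K M)"
  unfolding good_rule_def
proof (intro allI impI)
  fix A and v :: "real vec" assume A: "coercive d \<mu> A" and v: "v \<in> carrier_vec d" "v \<noteq> 0\<^sub>v d"
  let ?r = "\<lambda>\<gamma>. vnorm (resolvent A \<gamma> v)"
  let ?s = "\<lambda>\<gamma>. M * vnorm (schur_solve (schur A) \<gamma> v) - \<gamma>"
  define h where "h = bisect_root schur K M A v"
  have solve: "schur_solve (schur A) \<gamma> v = resolvent A \<gamma> v" if "0 \<le> \<gamma>" for \<gamma>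
    using schur A by (intro schur_solve_eq_resolvent[OF A \<mu> _ v(1) that]) (simp add: coercive_def)
  have b0: "0 < M * ?r 0"
    using M resolvent_pos[OF A \<mu> v, of 0] by simp
  have "M * ?r (M * ?r 0) \<le> M * ?r 0"
    using M b0 resolvent_mono(1)[OF A \<mu> v(1), of 0 "M * ?r 0"] by simp
  then have "\<exists>l\<ge>0. l < h \<and> ?s h \<le> 0 \<and> (l = 0 \<or> 0 < ?s l) \<and> h - l = (M * ?r 0 - 0) / 2 ^ K"
    unfolding h_def bisect_root_def solve[OF order_refl] using b0
    by (intro bisect_bracket) (auto simp: solve)
  then obtain l where l: "0 \<le> l" "l < h" "?s h \<le> 0" "l = 0 \<or> 0 < ?s l" "h - l = M * ?r 0 / 2 ^ K"
    by auto
  have "h \<le> (1 + \<tau>) * (M * ?r h) + \<tau> * \<mu>" if "M * ?r 0 \<le> b"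
  proof -
    have "h - l \<le> b / 2 ^ K"
      using that by (simp add: l divide_right_mono)
    also have "\<dots> \<le> \<tau> * \<mu>"
      using K by (simp add: field_simps)
    finally have hl: "h - l \<le> \<tau> * \<mu>" .
    then have "(h - l) / \<mu> \<le> \<tau>"
      using \<mu> by (simp add: field_simps)
    moreover have "?r l \<le> (1 + (h - l) / \<mu>) * ?r h"
      using l by (intro resolvent_mono(3)[OF A \<mu> v(1)]) auto
    moreover have "(1 + (h - l) / \<mu>) * ?r h \<le> (1 + \<tau>) * ?r h"
      using calculation by (intro mult_right_mono) auto
    ultimately have "M * ?r l \<le> M * ((1 + \<tau>) * ?r h)"
      using M by (intro mult_left_mono) auto
    \<comment> \<open>Both alternatives for the lower end give this: it is still 0, or \<phi> is
      positive there.\<close>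
    moreover have "l \<le> M * ?r l"
      using l M by (auto simp: solve)
    ultimately show ?thesis
      using hl by (simp add: mult.left_commute)
  qed
  then show "0 < bisect_root schur K M A v \<and>
      M * ?r (bisect_root schur K M A v) \<le> bisect_root schur K M A v \<and>
      (M * ?r 0 \<le> b \<longrightarrow> bisect_root schur K M A v \<le>
         (1 + \<tau>) * (M * ?r (bisect_root schur K M A v)) + \<tau> * \<mu>)"
    using l by (simp add: h_def[symmetric] solve)
qed

section \<open>The saddle operator\<close>

text \<open>The convergence analysis sees the saddle problem only through these facts. The Lipschitz
  condition is stated for products with vectors, the form in which the Taylor estimates use
  it.\<close>

locale strongly_monotone_root =
  fixes d :: nat and F :: "real vec \<Rightarrow> real vec" and \<rho> \<mu> :: real and zs :: "real vec"
  assumes rho_pos: "0 < \<rho>" and mu_pos: "0 < \<mu>"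
    and zs_carrier: "zs \<in> carrier_vec d"
    and F_carrier: "z \<in> carrier_vec d \<Longrightarrow> F z \<in> carrier_vec d"
    and has_jac: "z \<in> carrier_vec d \<Longrightarrow> has_jacobian d F z (jacobian d F z)"
    and jac_lipschitz: "z \<in> carrier_vec d \<Longrightarrow> w \<in> carrier_vec d \<Longrightarrow> h \<in> carrier_vec d \<Longrightarrow>
      vnorm ((jacobian d F z - jacobian d F w) *\<^sub>v h) \<le> \<rho> * vnorm (z - w) * vnorm h"
    and strong_mono: "z \<in> carrier_vec d \<Longrightarrow> w \<in> carrier_vec d \<Longrightarrow>
      \<mu> * (vnorm (z - w))\<^sup>2 \<le> (z - w) \<bullet> (F z - F w)"
    and F_root: "F zs = 0\<^sub>v d"

text \<open>The saddle operator is the gradient of the joint function with the sign of the y block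
  changed. As an isometry on whole vectors, this change passes from the Hessian to the Jacobian of
  the operator without block matrices.\<close>

definition flip_vec :: "nat \<Rightarrow> real vec \<Rightarrow> real vec" where
  "flip_vec n v = vec (dim_vec v) (\<lambda>i. if i < n then v $ i else - v $ i)"

definition flip_mat :: "nat \<Rightarrow> real mat \<Rightarrow> real mat" where
  "flip_mat n A = mat (dim_row A) (dim_col A) (\<lambda>(i, j). if i < n then A $$ (i, j) else - A $$ (i, j))"

lemma flip_vec_carrier [simp]: "v \<in> carrier_vec d \<Longrightarrow> flip_vec n v \<in> carrier_vec d"
  by (auto simp: flip_vec_def)

lemma flip_mat_carrier [simp]: "A \<in> carrier_mat k d \<Longrightarrow> flip_mat n A \<in> carrier_mat k d"
  by (auto simp: flip_mat_def)

lemma vnorm_flip_vec [simp]: "vnorm (flip_vec n v) = vnorm v"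
  unfolding vnorm_L2 L2_set_def by (auto simp: flip_vec_def intro!: sum.cong)

lemma flip_vec_minus:
  "v \<in> carrier_vec d \<Longrightarrow> w \<in> carrier_vec d \<Longrightarrow> flip_vec n (v - w) = flip_vec n v - flip_vec n w"
  by (intro eq_vecI) (auto simp: flip_vec_def)

lemma flip_mat_minus:
  assumes "A \<in> carrier_mat d d" "B \<in> carrier_mat d d"
  shows "flip_mat n (A - B) = flip_mat n A - flip_mat n B"
  using assms by (intro eq_matI) (auto simp: flip_mat_def)

lemma flip_mat_mult_vec:
  assumes "A \<in> carrier_mat d d" "h \<in> carrier_vec d"
  shows "flip_mat n A *\<^sub>v h = flip_vec n (A *\<^sub>v h)"
proof
  fix i assume "i < dim_vec (flip_vec n (A *\<^sub>v h))"
  then have i: "i < d"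
    using assms by (auto simp: flip_vec_def)
  have "row (flip_mat n A) i = (if i < n then row A i else - row A i)"
    using assms i by (intro eq_vecI) (auto simp: flip_mat_def)
  then show "(flip_mat n A *\<^sub>v h) $ i = flip_vec n (A *\<^sub>v h) $ i"
    using assms i by (auto simp: flip_vec_def flip_mat_def)
qed (use assms in \<open>auto simp: flip_vec_def flip_mat_def\<close>)

section \<open>The x and y blocks of vectors and gradients\<close>

lemma vec_first_append [simp]: "x \<in> carrier_vec n \<Longrightarrow> vec_first (x @\<^sub>v y) n = x"
  by (auto simp: vec_first_def)

lemma vec_last_append [simp]: "y \<in> carrier_vec n \<Longrightarrow> vec_last (x @\<^sub>v y) n = y"
  by (intro eq_vecI) (auto simp: vec_last_def)

lemma append_vec_add_distrib:
  assumes "x \<in> carrier_vec n" "x' \<in> carrier_vec n" "y \<in> carrier_vec k" "y' \<in> carrier_vec k"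
  shows "(x @\<^sub>v y) + (x' @\<^sub>v y') = (x + x') @\<^sub>v (y + (y' :: 'a :: plus vec))"
  using assms by (intro eq_vecI) auto

lemma append_vec_minus_distrib:
  assumes "x \<in> carrier_vec n" "x' \<in> carrier_vec n" "y \<in> carrier_vec k" "y' \<in> carrier_vec k"
  shows "(x @\<^sub>v y) - (x' @\<^sub>v y') = (x - x') @\<^sub>v (y - (y' :: 'a :: minus vec))"
  using assms by (intro eq_vecI) auto

lemma vnorm_append_sq:
  assumes "x \<in> carrier_vec n" "y \<in> carrier_vec k"
  shows "(vnorm (x @\<^sub>v y))\<^sup>2 = (vnorm x)\<^sup>2 + (vnorm y)\<^sup>2"
  using scalar_prod_append[OF assms assms] by (simp add: vnorm_sq)

lemma has_gradient_uminus:
  assumes "has_gradient d g z v"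
  shows "has_gradient d (\<lambda>u. - g u) z (- v)"
proof -
  have v: "v \<in> carrier_vec d"
    using assms by (simp add: has_gradient_def)
  have "\<bar>- g (z + h) - - g z - (- v) \<bullet> h\<bar> = \<bar>g (z + h) - g z - v \<bullet> h\<bar>" if "h \<in> carrier_vec d" for h
    using that v by simp
  then show ?thesis
    using assms by (simp add: has_gradient_def)
qed

text \<open>A small step along \<open>- v\<close> would otherwise decrease \<open>g\<close> to first
  order.\<close>

lemma gradient_at_minimum:
  assumes g: "has_gradient d g z v" and min: "\<And>h. h \<in> carrier_vec d \<Longrightarrow> g z \<le> g (z + h)"
  shows "v = 0\<^sub>v d"
proof -
  have v: "v \<in> carrier_vec d"
    using g by (simp add: has_gradient_def)
  have "v \<bullet> v \<le> 0"
  proof (rule le_of_all_mult_le)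
    fix e :: real assume "0 < e"
    then obtain \<delta> where \<delta>: "\<delta> > 0"
      "\<forall>h\<in>carrier_vec d. vnorm h < \<delta> \<longrightarrow> \<bar>g (z + h) - g z - v \<bullet> h\<bar> \<le> e * vnorm h"
      using g unfolding has_gradient_def by blast
    obtain s where s: "0 < s" "s * vnorm v < \<delta>"
      using small_multiple[OF \<delta>(1)] by auto
    let ?h = "(- s) \<cdot>\<^sub>v v"
    have h: "?h \<in> carrier_vec d"
      using v by simp
    moreover have "vnorm ?h < \<delta>"
      using s by simp
    ultimately have "\<bar>g (z + ?h) - g z - v \<bullet> ?h\<bar> \<le> e * vnorm ?h"
      using \<delta>(2) by blast
    moreover have "v \<bullet> ?h = - (s * (v \<bullet> v))"
      using v by simp
    moreover have "vnorm ?h = s * vnorm v"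
      using s by simp
    ultimately have "\<bar>g (z + ?h) - g z + s * (v \<bullet> v)\<bar> \<le> e * (s * vnorm v)"
      by (simp only: diff_minus_eq_add)
    then have "s * (v \<bullet> v) \<le> e * (s * vnorm v)"
      using min[OF h] by linarith
    then show "v \<bullet> v \<le> e * vnorm v"
      using s by (simp add: mult.left_commute)
  qed simp
  then have "vnorm v = 0"
    by (metis vnorm_sq power_eq_0_iff zero_le_power2 antisym)
  then show ?thesis
    using v by (rule vnorm_eq_0[rotated])
qed

text \<open>Increments \<open>h @\<^sub>v 0\<^sub>v dy\<close> restrict the joint expansion to the x
  block. Appending zeros preserves the norm, so the same \<delta> serves.\<close>

lemma has_gradient_fst:
  assumes g: "has_gradient (dx + dy) (joint dx dy f) (x @\<^sub>v y) v"
    and x: "x \<in> carrier_vec dx" and y: "y \<in> carrier_vec dy"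
  shows "has_gradient dx (\<lambda>u. f u y) x (vec_first v dx)"
  unfolding has_gradient_def
proof (intro conjI allI impI)
  have v: "v \<in> carrier_vec (dx + dy)"
    using g by (simp add: has_gradient_def)
  show "vec_first v dx \<in> carrier_vec dx"
    by simp
  fix e :: real assume "0 < e"
  then obtain \<delta> where \<delta>: "\<delta> > 0"
    "\<forall>h\<in>carrier_vec (dx + dy). vnorm h < \<delta> \<longrightarrow>
      \<bar>joint dx dy f ((x @\<^sub>v y) + h) - joint dx dy f (x @\<^sub>v y) - v \<bullet> h\<bar> \<le> e * vnorm h"
    using g unfolding has_gradient_def by blast
  have "\<bar>f (x + h) y - f x y - vec_first v dx \<bullet> h\<bar> \<le> e * vnorm h"
    if h: "h \<in> carrier_vec dx" "vnorm h < \<delta>" for h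
  proof -
    let ?k = "h @\<^sub>v 0\<^sub>v dy"
    have n: "vnorm ?k = vnorm h"
      using vnorm_append_sq[OF h(1), of "0\<^sub>v dy" dy] by simp
    have "v \<bullet> ?k = (vec_first v dx @\<^sub>v vec_last v dy) \<bullet> ?k"
      using v by simp
    also have "\<dots> = vec_first v dx \<bullet> h"
      using h(1) by (subst scalar_prod_append[of _ dx _ dy]) auto
    finally have p: "v \<bullet> ?k = vec_first v dx \<bullet> h" .
    have k: "?k \<in> carrier_vec (dx + dy)" "vnorm ?k < \<delta>"
      using h n by auto
    have "joint dx dy f ((x @\<^sub>v y) + ?k) = f (x + h) y" "joint dx dy f (x @\<^sub>v y) = f x y"
      using x y h(1) by (simp_all add: joint_def append_vec_add_distrib[of _ dx _ _ dy])
    then show ?thesis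
      using \<delta>(2)[rule_format, OF k] unfolding n p by simp
  qed
  then show "\<exists>\<delta>>0. \<forall>h\<in>carrier_vec dx. vnorm h < \<delta> \<longrightarrow>
      \<bar>f (x + h) y - f x y - vec_first v dx \<bullet> h\<bar> \<le> e * vnorm h"
    using \<delta>(1) by blast
qed

lemma has_gradient_snd:
  assumes g: "has_gradient (dx + dy) (joint dx dy f) (x @\<^sub>v y) v"
    and x: "x \<in> carrier_vec dx" and y: "y \<in> carrier_vec dy"
  shows "has_gradient dy (\<lambda>u. f x u) y (vec_last v dy)"
  unfolding has_gradient_def
proof (intro conjI allI impI)
  have v: "v \<in> carrier_vec (dx + dy)"
    using g by (simp add: has_gradient_def)
  show "vec_last v dy \<in> carrier_vec dy"
    by simp
  fix e :: real assume "0 < e"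
  then obtain \<delta> where \<delta>: "\<delta> > 0"
    "\<forall>h\<in>carrier_vec (dx + dy). vnorm h < \<delta> \<longrightarrow>
      \<bar>joint dx dy f ((x @\<^sub>v y) + h) - joint dx dy f (x @\<^sub>v y) - v \<bullet> h\<bar> \<le> e * vnorm h"
    using g unfolding has_gradient_def by blast
  have "\<bar>f x (y + h) - f x y - vec_last v dy \<bullet> h\<bar> \<le> e * vnorm h"
    if h: "h \<in> carrier_vec dy" "vnorm h < \<delta>" for h
  proof -
    let ?k = "0\<^sub>v dx @\<^sub>v h"
    have n: "vnorm ?k = vnorm h"
      using vnorm_append_sq[OF _ h(1), of "0\<^sub>v dx" dx] by simp
    have "v \<bullet> ?k = (vec_first v dx @\<^sub>v vec_last v dy) \<bullet> ?k"
      using v by simp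
    also have "\<dots> = vec_last v dy \<bullet> h"
      using h(1) by (subst scalar_prod_append[of _ dx _ dy]) auto
    finally have p: "v \<bullet> ?k = vec_last v dy \<bullet> h" .
    have k: "?k \<in> carrier_vec (dx + dy)" "vnorm ?k < \<delta>"
      using h n by auto
    have "joint dx dy f ((x @\<^sub>v y) + ?k) = f x (y + h)" "joint dx dy f (x @\<^sub>v y) = f x y"
      using x y h(1) by (simp_all add: joint_def append_vec_add_distrib[of _ dx _ _ dy])
    then show ?thesis
      using \<delta>(2)[rule_format, OF k] unfolding n p by simp
  qed
  then show "\<exists>\<delta>>0. \<forall>h\<in>carrier_vec dy. vnorm h < \<delta> \<longrightarrow>
      \<bar>f x (y + h) - f x y - vec_last v dy \<bullet> h\<bar> \<le> e * vnorm h"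
    using \<delta>(1) by blast
qed

text \<open>Convexity in x and concavity in y are both expanded at \<open>(x, y)\<close>.
  Subtracting the two cancels \<open>f x y\<close> and joins the partial gradients into
  \<open>saddle_op\<close>. The left side changes sign when the two points are exchanged, so two
  such gaps add up to zero.\<close>

lemma saddle_gap:
  assumes sc: "sc_sc dx dy \<mu> f"
    and x: "x \<in> carrier_vec dx" "x' \<in> carrier_vec dx" and y: "y \<in> carrier_vec dy" "y' \<in> carrier_vec dy"
    and gx: "grad_x dx f x y \<in> carrier_vec dx" and gy: "grad_y dy f x y \<in> carrier_vec dy"
  shows "f x' y - f x y' \<ge> ((x' @\<^sub>v y') - (x @\<^sub>v y)) \<bullet> saddle_op dx dy f (x @\<^sub>v y)
    + \<mu> / 2 * (vnorm ((x' @\<^sub>v y') - (x @\<^sub>v y)))\<^sup>2"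
proof -
  have "(x' @\<^sub>v y') - (x @\<^sub>v y) = (x' - x) @\<^sub>v (y' - y)"
    using x y by (intro append_vec_minus_distrib)
  moreover have "((x' - x) @\<^sub>v (y' - y)) \<bullet> (grad_x dx f x y @\<^sub>v - grad_y dy f x y) =
      (x' - x) \<bullet> grad_x dx f x y - (y' - y) \<bullet> grad_y dy f x y"
    using x y gx gy by (subst scalar_prod_append[of _ dx _ dy]) auto
  moreover have "saddle_op dx dy f (x @\<^sub>v y) = grad_x dx f x y @\<^sub>v - grad_y dy f x y"
    using x y by (simp add: saddle_op_def)
  moreover have "(vnorm ((x' - x) @\<^sub>v (y' - y)))\<^sup>2 = (vnorm (x - x'))\<^sup>2 + (vnorm (y - y'))\<^sup>2"
    using x y vnorm_minus_commute[of x dx x'] vnorm_minus_commute[of y dy y']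
    by (subst vnorm_append_sq[of _ dx _ dy]) auto
  moreover have "f x' y \<ge> f x y + (x' - x) \<bullet> grad_x dx f x y + \<mu> / 2 * (vnorm (x - x'))\<^sup>2"
    "f x y' \<le> f x y + (y' - y) \<bullet> grad_y dy f x y - \<mu> / 2 * (vnorm (y - y'))\<^sup>2"
    using sc x y unfolding sc_sc_def by blast+
  ultimately show ?thesis
    by (simp add: algebra_simps)
qed

lemma saddle_op_strongly_monotone_root:
  assumes d: "d = dx + dy" and \<rho>: "0 < \<rho>" and \<mu>: "0 < \<mu>"
    and tcd: "twice_cont_diff d (joint dx dy f)" and lip: "lipschitz_hessian d \<rho> (joint dx dy f)"
    and sc: "sc_sc dx dy \<mu> f" and sp: "saddle_point dx dy f zs"
  shows "strongly_monotone_root d (saddle_op dx dy f) \<rho> \<mu> zs"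
proof -
  define F where "F = saddle_op dx dy f"
  define G where "G = gradient d (joint dx dy f)"
  define H where "H = hessian d (joint dx dy f)"
  have G: "has_gradient d (joint dx dy f) z (G z)" if "z \<in> carrier_vec d" for z
    using tcd that gradient_eqI unfolding twice_cont_diff_def G_def by metis
  have cG: "G z \<in> carrier_vec d" if "z \<in> carrier_vec d" for z
    using G[OF that] unfolding has_gradient_def by (rule conjunct1)
  have H: "has_jacobian d G z (H z)" if z: "z \<in> carrier_vec d" for z
  proof -
    have "\<forall>z\<in>carrier_vec d. \<exists>A. has_jacobian d G z A"
      using tcd unfolding twice_cont_diff_def G_def by (elim conjE)
    then obtain A where A: "has_jacobian d G z A"
      using z by auto
    have "H z = A"
      unfolding H_def hessian_def G_def[symmetric] by (rule jacobian_eqI[OF A z cG])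
    with A show ?thesis
      by simp
  qed
  have cH: "H z \<in> carrier_mat d d" if "z \<in> carrier_vec d" for z
    using H[OF that] unfolding has_jacobian_def by (rule conjunct1)
  have grad: "has_gradient dx (\<lambda>u. f u y) x (vec_first (G (x @\<^sub>v y)) dx)"
    "has_gradient dy (\<lambda>u. f x u) y (vec_last (G (x @\<^sub>v y)) dy)"
    if "x \<in> carrier_vec dx" "y \<in> carrier_vec dy" for x y
    using G[of "x @\<^sub>v y"] that unfolding d by (auto intro: has_gradient_fst has_gradient_snd)
  have grad_eq: "grad_x dx f x y = vec_first (G (x @\<^sub>v y)) dx" "grad_y dy f x y = vec_last (G (x @\<^sub>v y)) dy"
    if "x \<in> carrier_vec dx" "y \<in> carrier_vec dy" for x y
    using grad[OF that] unfolding grad_x_def grad_y_def by (auto intro: gradient_eqI)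
  have split: "\<exists>x\<in>carrier_vec dx. \<exists>y\<in>carrier_vec dy. z = x @\<^sub>v y" if "z \<in> carrier_vec d" for z :: "real vec"
    using that vec_first_last_append[of z dx dy] unfolding d by (metis vec_first_carrier vec_last_carrier)
  have F_eq: "F z = flip_vec dx (G z)" if z: "z \<in> carrier_vec d" for z
  proof -
    obtain x y where xy: "x \<in> carrier_vec dx" "y \<in> carrier_vec dy" "z = x @\<^sub>v y"
      using split[OF z] by auto
    have "F z = vec_first (G z) dx @\<^sub>v - vec_last (G z) dy"
      using xy by (simp add: F_def saddle_op_def grad_eq)
    also have "\<dots> = flip_vec dx (G z)"
      using cG[OF z] unfolding d
      by (intro eq_vecI) (auto simp: flip_vec_def vec_first_def vec_last_def)
    finally show ?thesis .
  qed
  have cF: "F z \<in> carrier_vec d" if "z \<in> carrier_vec d" for z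
    using F_eq[OF that] cG[OF that] by simp
  have jacF: "has_jacobian d F z (flip_mat dx (H z))" if z: "z \<in> carrier_vec d" for z
  proof -
    have "vnorm (F (z + h) - F z - flip_mat dx (H z) *\<^sub>v h) = vnorm (G (z + h) - G z - H z *\<^sub>v h)"
      if h: "h \<in> carrier_vec d" for h
    proof -
      have "F (z + h) - F z - flip_mat dx (H z) *\<^sub>v h = flip_vec dx (G (z + h) - G z - H z *\<^sub>v h)"
        using z h cG[of "z + h"] cG[of z] cH[of z]
        by (simp add: F_eq flip_mat_mult_vec[of _ d] flip_vec_minus[of _ d])
      then show ?thesis
        by simp
    qed
    then show ?thesis
      using H[OF z] by (simp add: has_jacobian_def)
  qed
  have jac_eq: "jacobian d F z = flip_mat dx (H z)" if "z \<in> carrier_vec d" for z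
    using jacF that cF by (intro jacobian_eqI)
  have mono: "\<mu> * (vnorm (z - w))\<^sup>2 \<le> (z - w) \<bullet> (F z - F w)"
    if zw: "z \<in> carrier_vec d" "w \<in> carrier_vec d" for z w
  proof -
    obtain x y x' y' where xy: "x \<in> carrier_vec dx" "y \<in> carrier_vec dy" "z = x @\<^sub>v y"
      "x' \<in> carrier_vec dx" "y' \<in> carrier_vec dy" "w = x' @\<^sub>v y'"
      using split[OF zw(1)] split[OF zw(2)] by metis
    \<comment> \<open>The gaps seen from \<open>z\<close> and from \<open>w\<close> cancel on the
      left, and their two halves of \<mu> add up.\<close>
    have "f x' y - f x y' \<ge> (w - z) \<bullet> F z + \<mu> / 2 * (vnorm (w - z))\<^sup>2"
      unfolding F_def xy(3,6) using xy by (intro saddle_gap[OF sc]) (auto simp: grad_eq)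
    moreover have "f x y' - f x' y \<ge> (z - w) \<bullet> F w + \<mu> / 2 * (vnorm (z - w))\<^sup>2"
      unfolding F_def xy(3,6) using xy by (intro saddle_gap[OF sc]) (auto simp: grad_eq)
    moreover have "vnorm (w - z) = vnorm (z - w)"
      using zw by (rule vnorm_minus_commute[rotated])
    moreover have "(w - z) \<bullet> F z = - ((z - w) \<bullet> F z)"
      using zw cF[OF zw(1)] by (simp add: minus_scalar_prod_distrib[of _ d])
    moreover have "(z - w) \<bullet> (F z - F w) = (z - w) \<bullet> F z - (z - w) \<bullet> F w"
      using zw cF[OF zw(1)] cF[OF zw(2)] by (intro scalar_prod_minus_distrib[of _ d]) auto
    ultimately show ?thesis
      by simp
  qed
  have czs: "zs \<in> carrier_vec d"
    using sp by (simp add: saddle_point_def d)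
  then obtain xs ys where xs: "xs \<in> carrier_vec dx" and ys: "ys \<in> carrier_vec dy" and zs: "zs = xs @\<^sub>v ys"
    using split by blast
  have saddle: "f xs y \<le> f xs ys" "f xs ys \<le> f x ys" if "x \<in> carrier_vec dx" "y \<in> carrier_vec dy" for x y
    using sp that xs ys unfolding saddle_point_def zs by auto
  have "vec_first (G zs) dx = 0\<^sub>v dx"
    using grad(1)[OF xs ys] saddle(2)[of _ ys] xs ys unfolding zs by (intro gradient_at_minimum) auto
  \<comment> \<open>The saddle point is a maximum in y, so the first-order condition is applied to
    the negated function.\<close>
  moreover have "- vec_last (G zs) dy = 0\<^sub>v dy"
    using has_gradient_uminus[OF grad(2)[OF xs ys]] saddle(1)[OF xs] xs ys unfolding zs
    by (intro gradient_at_minimum) auto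
  ultimately have "F zs = 0\<^sub>v dx @\<^sub>v 0\<^sub>v dy"
    using xs ys by (simp add: F_def saddle_op_def grad_eq zs)
  then have root: "F zs = 0\<^sub>v d"
    unfolding d by (auto intro!: eq_vecI)
  have "strongly_monotone_root d F \<rho> \<mu> zs"
  proof
    fix z w h :: "real vec" assume z: "z \<in> carrier_vec d" and w: "w \<in> carrier_vec d" and h: "h \<in> carrier_vec d"
    \<comment> \<open>Flipping is an isometry and commutes with the matrix-vector product, so
      \<open>F\<close> inherits the Lipschitz constant of the Hessian.\<close>
    have "(jacobian d F z - jacobian d F w) *\<^sub>v h = flip_vec dx ((H z - H w) *\<^sub>v h)"
      using z w h cH by (simp add: jac_eq flip_mat_minus[of _ d, symmetric] flip_mat_mult_vec[of _ d] minus_carrier_mat)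
    then have "vnorm ((jacobian d F z - jacobian d F w) *\<^sub>v h) \<le> spec_norm (H z - H w) * vnorm h"
      using spec_norm_bound[of h "H z - H w"] cH[OF z] cH[OF w] h by simp
    also have "\<dots> \<le> \<rho> * vnorm (z - w) * vnorm h"
      using lip z w unfolding lipschitz_hessian_def H_def by (intro mult_right_mono) auto
    finally show "vnorm ((jacobian d F z - jacobian d F w) *\<^sub>v h) \<le> \<rho> * vnorm (z - w) * vnorm h" .
  qed (use \<rho> \<mu> czs cF jacF jac_eq mono root in auto)
  then show ?thesis
    by (simp add: F_def)
qed

section \<open>Taylor remainder of the operator and coercivity of its Jacobian\<close>

context strongly_monotone_root
begin

abbreviation J :: "real vec \<Rightarrow> real mat" where
  "J \<equiv> jacobian d F"

lemma J_carrier: "z \<in> carrier_vec d \<Longrightarrow> J z \<in> carrier_mat d d"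
  using has_jac by (simp add: has_jacobian_def)

text \<open>Pairing with a fixed \<open>u\<close> gives a real function of one variable, so the sign
  of a derivative can do the work of an integral form of the remainder.\<close>

lemma DERIV_along_line:
  assumes w: "w \<in> carrier_vec d" and h: "h \<in> carrier_vec d" and u: "u \<in> carrier_vec d"
  shows "((\<lambda>s. u \<bullet> F (w + s \<cdot>\<^sub>v h)) has_real_derivative u \<bullet> (J (w + s \<cdot>\<^sub>v h) *\<^sub>v h)) (at s)"
  unfolding DERIV_def
proof (rule LIM_I)
  fix r :: real assume r: "0 < r"
  \<comment> \<open>Chosen so that \<open>vnorm u * (e * vnorm h)\<close> stays below
    \<open>r\<close>; the 1 keeps the denominator positive when \<open>u\<close> or \<open>h\<close>
    vanishes.\<close>
  define e where "e = r / (vnorm u * vnorm h + 1)"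
  have uh: "0 < vnorm u * vnorm h + 1"
    by (simp add: add_nonneg_pos)
  have e: "0 < e" "vnorm u * (e * vnorm h) < r"
    using r uh by (simp_all add: e_def field_simps)
  let ?z = "w + s \<cdot>\<^sub>v h"
  have z: "?z \<in> carrier_vec d"
    using w h by simp
  obtain \<delta> where \<delta>: "\<delta> > 0"
    "\<forall>k\<in>carrier_vec d. vnorm k < \<delta> \<longrightarrow> vnorm (F (?z + k) - F ?z - J ?z *\<^sub>v k) \<le> e * vnorm k"
    using has_jac[OF z] e(1) unfolding has_jacobian_def by blast
  have "\<bar>(u \<bullet> F (w + (s + k) \<cdot>\<^sub>v h) - u \<bullet> F ?z) / k - u \<bullet> (J ?z *\<^sub>v h)\<bar> < r"
    if k: "k \<noteq> 0" "\<bar>k\<bar> < \<delta> / (vnorm h + 1)" for k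
  proof -
    let ?k = "k \<cdot>\<^sub>v h"
    have ck: "?k \<in> carrier_vec d"
      using h by simp
    have "\<bar>k\<bar> * (vnorm h + 1) < \<delta>"
      using k(2) by (simp add: pos_less_divide_eq add_nonneg_pos)
    then have "vnorm ?k < \<delta>"
      by (simp add: distrib_left)
    then have bound: "vnorm (F (?z + ?k) - F ?z - J ?z *\<^sub>v ?k) \<le> e * (\<bar>k\<bar> * vnorm h)"
      using \<delta>(2)[rule_format, OF ck] by simp
    have zk: "?z + ?k = w + (s + k) \<cdot>\<^sub>v h"
      using w h by (intro eq_vecI) (auto simp: algebra_simps)
    have cF: "F (?z + ?k) \<in> carrier_vec d" "F ?z \<in> carrier_vec d" "J ?z *\<^sub>v ?k \<in> carrier_vec d" "J ?z *\<^sub>v h \<in> carrier_vec d"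
      using F_carrier[of "?z + ?k"] F_carrier[OF z] z ck h J_carrier[OF z] by auto
    have "u \<bullet> F (w + (s + k) \<cdot>\<^sub>v h) - u \<bullet> F ?z - k * (u \<bullet> (J ?z *\<^sub>v h)) =
        u \<bullet> (F (?z + ?k) - F ?z - J ?z *\<^sub>v ?k)"
      using u cF mult_mat_vec[OF J_carrier[OF z] h, of k]
      by (simp add: zk scalar_prod_minus_distrib[of _ d])
    also have "\<bar>\<dots>\<bar> \<le> vnorm u * vnorm (F (?z + ?k) - F ?z - J ?z *\<^sub>v ?k)"
      using u cF by (intro scalar_prod_abs_le[of _ d]) auto
    also have "\<dots> \<le> vnorm u * (e * (\<bar>k\<bar> * vnorm h))"
      by (intro mult_left_mono bound) simp
    also have "\<dots> = \<bar>k\<bar> * (vnorm u * (e * vnorm h))"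
      by simp
    also have "\<dots> < \<bar>k\<bar> * r"
      using e(2) k(1) by (intro mult_strict_left_mono) auto
    finally have *: "\<bar>u \<bullet> F (w + (s + k) \<cdot>\<^sub>v h) - u \<bullet> F ?z - k * (u \<bullet> (J ?z *\<^sub>v h))\<bar> < \<bar>k\<bar> * r" .
    have "(u \<bullet> F (w + (s + k) \<cdot>\<^sub>v h) - u \<bullet> F ?z) / k - u \<bullet> (J ?z *\<^sub>v h) =
       (u \<bullet> F (w + (s + k) \<cdot>\<^sub>v h) - u \<bullet> F ?z - k * (u \<bullet> (J ?z *\<^sub>v h))) / k"
      using k(1) by (simp add: diff_divide_distrib)
    then show ?thesis
      using * k(1) by (simp add: abs_divide pos_divide_less_eq mult.commute)
  qed
  then show "\<exists>\<delta>>0. \<forall>k. k \<noteq> 0 \<and> norm (k - 0) < \<delta> \<longrightarrow>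
      norm ((u \<bullet> F (w + (s + k) \<cdot>\<^sub>v h) - u \<bullet> F ?z) / k - u \<bullet> (J ?z *\<^sub>v h)) < r"
    using \<delta>(1) by (intro exI[of _ "\<delta> / (vnorm h + 1)"]) (auto simp: add_nonneg_pos)
qed

text \<open>The test vector is the remainder \<open>u\<close> itself. Along the segment from
  \<open>w\<close> to \<open>z\<close>, subtracting the linear part and the quadratic bound from
  \<open>u \<bullet> F\<close> leaves a function whose derivative is nonpositive by the Lipschitz
  Jacobian. Comparing its ends bounds \<open>u \<bullet> u\<close> by a multiple of
  \<open>vnorm u\<close>.\<close>

lemma taylor_bound:
  assumes z: "z \<in> carrier_vec d" and w: "w \<in> carrier_vec d"
  shows "vnorm (F z - F w - J w *\<^sub>v (z - w)) \<le> \<rho> / 2 * (vnorm (z - w))\<^sup>2"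
proof -
  define h where "h = z - w"
  define u where "u = F z - F w - J w *\<^sub>v h"
  have h: "h \<in> carrier_vec d"
    using z w by (simp add: h_def)
  have cJ: "J w *\<^sub>v h \<in> carrier_vec d"
    using J_carrier[OF w] h by simp
  have u: "u \<in> carrier_vec d"
    using cJ F_carrier[OF z] F_carrier[OF w] by (simp add: u_def)
  let ?\<psi> = "\<lambda>s. u \<bullet> F (w + s \<cdot>\<^sub>v h) - s * (u \<bullet> (J w *\<^sub>v h)) - s\<^sup>2 * (\<rho> / 2 * (vnorm u * (vnorm h)\<^sup>2))"
  have "?\<psi> 1 \<le> ?\<psi> 0"
  proof (rule DERIV_nonpos_imp_nonincreasing[where f = ?\<psi> and a = 0 and b = 1])
    fix s :: real assume s: "0 \<le> s" "s \<le> 1"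
    let ?z = "w + s \<cdot>\<^sub>v h"
    have cz: "?z \<in> carrier_vec d"
      using w h by simp
    have D: "(?\<psi> has_real_derivative u \<bullet> (J ?z *\<^sub>v h) - u \<bullet> (J w *\<^sub>v h) -
        2 * s * (\<rho> / 2 * (vnorm u * (vnorm h)\<^sup>2))) (at s)"
      by (rule derivative_eq_intros DERIV_along_line[OF w h u] refl | simp)+
    have "u \<bullet> (J ?z *\<^sub>v h) - u \<bullet> (J w *\<^sub>v h) \<le> 2 * s * (\<rho> / 2 * (vnorm u * (vnorm h)\<^sup>2))"
    proof -
      have "?z - w = s \<cdot>\<^sub>v h"
        using w h by (intro eq_vecI) auto
      then have zw: "vnorm (?z - w) = s * vnorm h"
        using s by simp
      have "u \<bullet> (J ?z *\<^sub>v h) - u \<bullet> (J w *\<^sub>v h) = u \<bullet> ((J ?z - J w) *\<^sub>v h)"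
        using u cJ h J_carrier[OF cz] J_carrier[OF w]
        by (simp add: minus_mult_distrib_mat_vec[of _ d d] scalar_prod_minus_distrib[of _ d])
      also have "\<dots> \<le> vnorm u * vnorm ((J ?z - J w) *\<^sub>v h)"
        using scalar_prod_abs_le[OF u mult_mat_vec_carrier[OF minus_carrier_mat[OF J_carrier[OF w]] h]]
        by (simp add: abs_le_iff)
      also have "\<dots> \<le> vnorm u * (\<rho> * (s * vnorm h) * vnorm h)"
        using jac_lipschitz[OF cz w h] by (intro mult_left_mono) (auto simp: zw)
      finally show ?thesis
        by (simp add: power2_eq_square mult_ac)
    qed
    then show "\<exists>y. (?\<psi> has_real_derivative y) (at s) \<and> y \<le> 0"
      by - (rule exI, rule conjI, rule D, simp)
  qed simp
  moreover have "w + 1 \<cdot>\<^sub>v h = z" "w + 0 \<cdot>\<^sub>v h = w"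
    using w z by (auto simp: h_def)
  ultimately have "u \<bullet> F z - u \<bullet> F w - u \<bullet> (J w *\<^sub>v h) \<le> \<rho> / 2 * (vnorm h)\<^sup>2 * vnorm u"
    by (simp add: mult_ac)
  moreover have "u \<bullet> u = u \<bullet> F z - u \<bullet> F w - u \<bullet> (J w *\<^sub>v h)"
    using u cJ F_carrier[OF z] F_carrier[OF w] scalar_prod_minus_distrib[of u d "F z - F w" "J w *\<^sub>v h"]
      scalar_prod_minus_distrib[of u d "F z" "F w"] by (simp add: u_def[symmetric])
  ultimately have "vnorm u \<le> \<rho> / 2 * (vnorm h)\<^sup>2"
    using u rho_pos by (intro vnorm_le_by_inner) auto
  then show ?thesis
    by (simp add: u_def h_def)
qed

text \<open>Strong monotonicity between \<open>z\<close> and a point at \<open>s * h\<close> from it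
  is an inequality of order \<open>s^2\<close>, up to the error of the linearization; dividing by
  \<open>s^2\<close> leaves only that error.\<close>

lemma J_coercive:
  assumes z: "z \<in> carrier_vec d"
  shows "coercive d \<mu> (J z)"
  unfolding coercive_def
proof (intro conjI ballI)
  show cJ: "J z \<in> carrier_mat d d"
    by (rule J_carrier[OF z])
  fix h :: "real vec" assume h: "h \<in> carrier_vec d"
  have "\<mu> * (vnorm h)\<^sup>2 - h \<bullet> (J z *\<^sub>v h) \<le> 0"
  proof (rule le_of_all_mult_le)
    fix e :: real assume "0 < e"
    then obtain \<delta> where \<delta>: "\<delta> > 0"
      "\<forall>k\<in>carrier_vec d. vnorm k < \<delta> \<longrightarrow> vnorm (F (z + k) - F z - J z *\<^sub>v k) \<le> e * vnorm k"
      using has_jac[OF z] unfolding has_jacobian_def by blast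
    obtain s where s: "0 < s" "s * vnorm h < \<delta>"
      using small_multiple[OF \<delta>(1)] by auto
    let ?k = "s \<cdot>\<^sub>v h"
    have k: "?k \<in> carrier_vec d" "vnorm ?k < \<delta>" "vnorm ?k = s * vnorm h"
      using h s by auto
    have Jk: "J z *\<^sub>v ?k = s \<cdot>\<^sub>v (J z *\<^sub>v h)"
      by (rule mult_mat_vec[OF cJ h])
    have cF: "F (z + ?k) \<in> carrier_vec d" "F z \<in> carrier_vec d" "J z *\<^sub>v h \<in> carrier_vec d"
      using F_carrier[of "z + ?k"] F_carrier[OF z] z k h cJ by auto
    have "z + ?k - z = ?k"
      using z k by auto
    then have "\<mu> * (s * vnorm h)\<^sup>2 \<le> ?k \<bullet> (F (z + ?k) - F z)"
      using strong_mono[of "z + ?k" z] z k(1) by (simp only: k(3) add_carrier_vec)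
    also have "\<dots> = ?k \<bullet> (F (z + ?k) - F z - J z *\<^sub>v ?k) + ?k \<bullet> (J z *\<^sub>v ?k)"
      using cF k by (simp add: scalar_prod_minus_distrib[of _ d] Jk del: smult_scalar_prod_distrib)
    also have "?k \<bullet> (F (z + ?k) - F z - J z *\<^sub>v ?k) \<le> vnorm ?k * vnorm (F (z + ?k) - F z - J z *\<^sub>v ?k)"
      using scalar_prod_abs_le[of ?k d "F (z + ?k) - F z - J z *\<^sub>v ?k"] cF k by (simp add: Jk)
    also have "\<dots> \<le> vnorm ?k * (e * vnorm ?k)"
      by (intro mult_left_mono \<delta>(2)[rule_format, OF k(1,2)] vnorm_nonneg)
    also have "?k \<bullet> (J z *\<^sub>v ?k) = s\<^sup>2 * (h \<bullet> (J z *\<^sub>v h))"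
      using cF h by (simp add: Jk power2_eq_square)
    finally have "s\<^sup>2 * (\<mu> * (vnorm h)\<^sup>2 - h \<bullet> (J z *\<^sub>v h)) \<le> s\<^sup>2 * (e * (vnorm h)\<^sup>2)"
      using s by (simp add: power2_eq_square algebra_simps)
    then show "\<mu> * (vnorm h)\<^sup>2 - h \<bullet> (J z *\<^sub>v h) \<le> e * (vnorm h)\<^sup>2"
      using s by simp
  qed simp
  then show "\<mu> * (vnorm h)\<^sup>2 \<le> h \<bullet> (J z *\<^sub>v h)"
    by simp
qed

text \<open>With \<open>u = z - zs\<close> and \<open>v\<close> the Newton direction,
  \<open>J w\<close> maps \<open>v - u\<close> to the sum of two vectors: the Taylor remainder at
  \<open>z\<close>, at most \<open>\<rho> / 2 * R^2\<close>, and the effect of the outdated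
  Jacobian, at most \<open>2 * \<rho> * R^2\<close> because \<open>z\<close> and \<open>w\<close>
  are at most \<open>2 * R\<close> apart. The factor 3 rounds up the sum, and coercivity divides it
  by \<mu>.\<close>

lemma lazy_newton_bound:
  assumes z: "z \<in> carrier_vec d" and w: "w \<in> carrier_vec d"
    and R: "vnorm (z - zs) \<le> R" "vnorm (w - zs) \<le> R"
  shows "vnorm (resolvent (J w) 0 (F z)) \<le> R + 3 * (\<rho> / \<mu>) * R\<^sup>2"
proof -
  define u where "u = z - zs"
  define v where "v = resolvent (J w) 0 (F z)"
  have u: "u \<in> carrier_vec d"
    using z zs_carrier by (simp add: u_def)
  have R0: "0 \<le> R"
    using R(1) vnorm_nonneg order_trans by blast
  have uR: "vnorm u \<le> R"
    using R by (simp add: u_def)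
  note Jw = J_carrier[OF w] and Jz = J_carrier[OF z] and cF = F_carrier[OF z]
  have v: "v \<in> carrier_vec d" "J w *\<^sub>v v + 0 \<cdot>\<^sub>v v = F z"
    unfolding v_def using resolvent_props(1)[OF J_coercive[OF w] mu_pos cF]
      resolvent_eq[OF J_coercive[OF w] mu_pos cF] by auto
  have "J w *\<^sub>v v = J w *\<^sub>v v + 0 \<cdot>\<^sub>v v"
    using v(1) Jw by (intro eq_vecI) auto
  then have Jv: "J w *\<^sub>v v = F z"
    using v(2) by simp
  have zsz: "zs - z = - u"
    using z zs_carrier by (auto simp: u_def)
  have Jneg: "J z *\<^sub>v (- u) = - (J z *\<^sub>v u)"
    using Jz u by (intro eq_vecI) auto
  have E1: "vnorm (F z - J z *\<^sub>v u) \<le> \<rho> / 2 * R\<^sup>2"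
  proof -
    have "F zs - F z - J z *\<^sub>v (zs - z) = - (F z - J z *\<^sub>v u)"
      unfolding zsz Jneg F_root using cF Jz u by (intro eq_vecI) auto
    then have "vnorm (F z - J z *\<^sub>v u) = vnorm (F zs - F z - J z *\<^sub>v (zs - z))"
      by simp
    also have "\<dots> \<le> \<rho> / 2 * (vnorm (zs - z))\<^sup>2"
      by (rule taylor_bound[OF zs_carrier z])
    also have "\<dots> \<le> \<rho> / 2 * R\<^sup>2"
      using rho_pos uR by (intro mult_left_mono power_mono) (auto simp: zsz)
    finally show ?thesis .
  qed
  have E2: "vnorm ((J z - J w) *\<^sub>v u) \<le> 2 * \<rho> * R\<^sup>2"
  proof -
    have "vnorm (z - w) \<le> vnorm (z - zs) + vnorm (zs - w)"
      by (rule vnorm_triangle_minus[OF z zs_carrier w])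
    also have "\<dots> \<le> 2 * R"
      using R vnorm_minus_commute[OF w zs_carrier] by simp
    finally have "\<rho> * vnorm (z - w) * vnorm u \<le> \<rho> * (2 * R) * R"
      using rho_pos uR R0 by (intro mult_mono) auto
    then show ?thesis
      using jac_lipschitz[OF z w u] by (simp add: power2_eq_square)
  qed
  have "J w *\<^sub>v (v - u) = (F z - J z *\<^sub>v u) + (J z - J w) *\<^sub>v u"
    using u v Jw Jz cF
    by (simp add: mult_minus_distrib_mat_vec[of _ d d] minus_mult_distrib_mat_vec[of _ d d] Jv) auto
  then have "vnorm (J w *\<^sub>v (v - u)) \<le> vnorm (F z - J z *\<^sub>v u) + vnorm ((J z - J w) *\<^sub>v u)"
    using vnorm_triangle[OF _ mult_mat_vec_carrier[OF minus_carrier_mat[OF Jw] u], of "F z - J z *\<^sub>v u" "J z"]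
      u Jz cF by simp
  then have "\<mu> * vnorm (v - u) \<le> 3 * \<rho> * R\<^sup>2"
    using E1 E2 coercive_lower[OF J_coercive[OF w] minus_carrier_vec[OF v(1) u]]
      mult_nonneg_nonneg[OF less_imp_le[OF rho_pos] zero_le_power2[of R]] by linarith
  then have "vnorm (v - u) \<le> 3 * (\<rho> / \<mu>) * R\<^sup>2"
    using mu_pos by (simp add: field_simps)
  moreover have "(v - u) + u = v"
    using u v by (intro eq_vecI) auto
  then have "vnorm v \<le> vnorm (v - u) + vnorm u"
    using vnorm_triangle[of "v - u" d u] u v by simp
  ultimately show ?thesis
    using uR by (simp add: v_def)
qed

end

section \<open>Convergence of LEN\<close>

lemma three_point_identity:
  assumes "a \<in> carrier_vec d" "b \<in> carrier_vec d" "c \<in> carrier_vec d" "z \<in> carrier_vec d"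
  shows "2 * ((a - b) \<bullet> (c - z)) =
    (vnorm (a - z))\<^sup>2 - (vnorm (b - z))\<^sup>2 - (vnorm (a - c))\<^sup>2 + (vnorm (b - c))\<^sup>2"
  using assms comm_scalar_prod[of a d b] comm_scalar_prod[of a d c] comm_scalar_prod[of a d z]
    comm_scalar_prod[of b d c] comm_scalar_prod[of b d z] comm_scalar_prod[of c d z]
  by (simp add: vnorm_sq minus_scalar_prod_distrib[of _ d] scalar_prod_minus_distrib[of _ d])

lemma sum_squared_le_card:
  fixes y :: "'a \<Rightarrow> real"
  shows "(\<Sum>i\<in>I. y i)\<^sup>2 \<le> (\<Sum>i\<in>I. (y i)\<^sup>2) * real (card I)"
proof -
  have "\<bar>\<Sum>i\<in>I. y i\<bar> \<le> (\<Sum>i\<in>I. \<bar>y i\<bar> * \<bar>1\<bar>)"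
    by (simp add: sum_abs)
  also have "\<dots> \<le> L2_set y I * L2_set (\<lambda>_. 1) I"
    by (rule L2_set_mult_ineq)
  finally have "\<bar>\<Sum>i\<in>I. y i\<bar>\<^sup>2 \<le> (L2_set y I * L2_set (\<lambda>_. 1) I)\<^sup>2"
    by (rule power_mono) simp
  then show ?thesis
    by (simp add: L2_set_def power_mult_distrib sum_nonneg)
qed

text \<open>
  Each index \<open>i\<close> lies in the windows \<open>[t - t mod m, t)\<close> of fewer than \<open>m\<close> indices \<open>t\<close>.
\<close>

lemma sum_lazy_windows:
  fixes a :: "nat \<Rightarrow> real"
  assumes m: "0 < m" and a: "\<And>i. 0 \<le> a i"
  shows "(\<Sum>t<n. \<Sum>i\<in>{t - t mod m..<t}. a i) \<le> real m * (\<Sum>i<n. a i)"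
proof -
  have "(\<Sum>t<n. \<Sum>i\<in>{t - t mod m..<t}. a i) = (\<Sum>t<n. \<Sum>i<n. if t - t mod m \<le> i \<and> i < t then a i else 0)"
  proof (rule sum.cong[OF refl])
    fix t assume "t \<in> {..<n}"
    then have "{t - t mod m..<t} = {..<n} \<inter> {i. t - t mod m \<le> i \<and> i < t}"
      by auto
    then show "(\<Sum>i\<in>{t - t mod m..<t}. a i) = (\<Sum>i<n. if t - t mod m \<le> i \<and> i < t then a i else 0)"
      by (simp add: sum.inter_restrict)
  qed
  also have "\<dots> = (\<Sum>i<n. \<Sum>t<n. if t - t mod m \<le> i \<and> i < t then a i else 0)"
    by (rule sum.swap)
  also have "\<dots> \<le> (\<Sum>i<n. real m * a i)"
  proof (rule sum_mono)
    fix i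
    have "{t. t < n \<and> t - t mod m \<le> i \<and> i < t} \<subseteq> {i<..i + m}"
    proof
      fix t assume "t \<in> {t. t < n \<and> t - t mod m \<le> i \<and> i < t}"
      moreover have "t mod m < m"
        using m by simp
      ultimately show "t \<in> {i<..i + m}"
        by auto
    qed
    from card_mono[OF _ this] have "card {t. t < n \<and> t - t mod m \<le> i \<and> i < t} \<le> m"
      by simp
    then have "real (card {t. t < n \<and> t - t mod m \<le> i \<and> i < t}) * a i \<le> real m * a i"
      using a by (intro mult_right_mono) auto
    moreover have "(\<Sum>t<n. if t - t mod m \<le> i \<and> i < t then a i else 0) =
        real (card {t. t < n \<and> t - t mod m \<le> i \<and> i < t}) * a i"
      by (simp add: sum.If_cases Int_def)
    ultimately show "(\<Sum>t<n. if t - t mod m \<le> i \<and> i < t then a i else 0) \<le> real m * a i"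
      by simp
  qed
  finally show ?thesis
    by (simp add: sum_distrib_left)
qed

text \<open>Cauchy-Schwarz on windows of length at most \<open>m\<close> bounds the sum of
  \<open>s^2\<close> by \<open>m^2\<close> times the sum of \<open>2 * (r^2 + e^2)\<close>, and the
  factors 1 / m in the bound on \<open>e\<close> cancel this \<open>m^2\<close>. For the sums E of
  \<open>e^2\<close> and R of \<open>r^2\<close> there remains E \<le> R / 18 + 4 / 9 * (R + E), and
  solving for E gives 9 / 10.\<close>

lemma lazy_error_sum:
  fixes r e s :: "nat \<Rightarrow> real"
  assumes m: "0 < m"
    and nonneg: "\<And>t. 0 \<le> r t" "\<And>t. 0 \<le> e t" "\<And>t. 0 \<le> s t"
    and e: "\<And>t. t < n \<Longrightarrow> e t \<le> r t / (6 * real m) + s t / (3 * real m)"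
    and s: "\<And>t. t < n \<Longrightarrow> s t \<le> (\<Sum>i\<in>{t - t mod m..<t}. r i + e i)"
  shows "(\<Sum>t<n. (e t)\<^sup>2) \<le> 9 / 10 * (\<Sum>t<n. (r t)\<^sup>2)"
proof -
  have m1: "1 \<le> real m"
    using m by simp
  have sq2: "(x + y)\<^sup>2 \<le> 2 * (x\<^sup>2 + y\<^sup>2)" for x y :: real
    using zero_le_power2[of "x - y"] by (simp add: power2_diff power2_sum)
  define a where "a i = 2 * ((r i)\<^sup>2 + (e i)\<^sup>2)" for i
  have s2: "(s t)\<^sup>2 \<le> real m * (\<Sum>i\<in>{t - t mod m..<t}. a i)" if t: "t < n" for t
  proof -
    have "(s t)\<^sup>2 \<le> (\<Sum>i\<in>{t - t mod m..<t}. r i + e i)\<^sup>2"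
      using s[OF t] nonneg by (intro power_mono) auto
    also have "\<dots> \<le> (\<Sum>i\<in>{t - t mod m..<t}. (r i + e i)\<^sup>2) * real (card {t - t mod m..<t})"
      by (rule sum_squared_le_card)
    also have "\<dots> \<le> (\<Sum>i\<in>{t - t mod m..<t}. (r i + e i)\<^sup>2) * real m"
      using m by (intro mult_left_mono sum_nonneg) (auto intro: less_imp_le)
    also have "\<dots> \<le> (\<Sum>i\<in>{t - t mod m..<t}. a i) * real m"
      unfolding a_def by (intro mult_right_mono sum_mono sq2) auto
    finally show ?thesis
      by (simp add: mult.commute)
  qed
  have "(\<Sum>t<n. (s t)\<^sup>2) \<le> (\<Sum>t<n. real m * (\<Sum>i\<in>{t - t mod m..<t}. a i))"
    by (intro sum_mono s2) simp
  also have "\<dots> = real m * (\<Sum>t<n. \<Sum>i\<in>{t - t mod m..<t}. a i)"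
    by (simp add: sum_distrib_left)
  also have "\<dots> \<le> real m * (real m * (\<Sum>i<n. a i))"
    by (intro mult_left_mono sum_lazy_windows[OF m]) (auto simp: a_def)
  finally have S: "(\<Sum>t<n. (s t)\<^sup>2) / (real m)\<^sup>2 \<le> (\<Sum>i<n. a i)"
    using m1 by (simp add: divide_le_eq power2_eq_square mult_ac)
  have e2: "(e t)\<^sup>2 \<le> (r t)\<^sup>2 / 18 + 2 / 9 * ((s t)\<^sup>2 / (real m)\<^sup>2)" if t: "t < n" for t
  proof -
    have "(e t)\<^sup>2 \<le> (r t / (6 * real m) + s t / (3 * real m))\<^sup>2"
      using e[OF t] nonneg by (intro power_mono) auto
    also have "\<dots> \<le> 2 * ((r t / (6 * real m))\<^sup>2 + (s t / (3 * real m))\<^sup>2)"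
      by (rule sq2)
    also have "\<dots> = (r t)\<^sup>2 / (real m)\<^sup>2 / 18 + 2 / 9 * ((s t)\<^sup>2 / (real m)\<^sup>2)"
      by (simp add: power_divide power_mult_distrib)
    also have "(r t)\<^sup>2 / (real m)\<^sup>2 \<le> (r t)\<^sup>2 / 1"
      using m1 by (intro divide_left_mono one_le_power) auto
    finally show ?thesis
      by simp
  qed
  have "(\<Sum>t<n. (e t)\<^sup>2) \<le> (\<Sum>t<n. (r t)\<^sup>2 / 18 + 2 / 9 * ((s t)\<^sup>2 / (real m)\<^sup>2))"
    by (intro sum_mono e2) simp
  also have "\<dots> = (\<Sum>t<n. (r t)\<^sup>2) / 18 + 2 / 9 * ((\<Sum>t<n. (s t)\<^sup>2) / (real m)\<^sup>2)"
    by (simp add: sum.distrib sum_divide_distrib sum_distrib_left)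
  also have "\<dots> \<le> (\<Sum>t<n. (r t)\<^sup>2) / 18 + 2 / 9 * (\<Sum>i<n. a i)"
    using S by simp
  also have "(\<Sum>i<n. a i) = 2 * ((\<Sum>t<n. (r t)\<^sup>2) + (\<Sum>t<n. (e t)\<^sup>2))"
    by (simp add: a_def sum.distrib sum_distrib_left)
  finally show ?thesis
    by argo
qed

text \<open>A case of Hoelder's inequality, obtained from a tangent: the square of \<open>g\<close>
  is a convex function of \<open>1 / g\<close>, and the tangent is taken at the harmonic mean
  \<open>h\<close>.\<close>

lemma harmonic_sum_bound:
  fixes g :: "nat \<Rightarrow> real"
  assumes g: "\<And>t. t < T \<Longrightarrow> 0 < g t" and T: "0 < T"
  shows "real T ^ 3 \<le> (\<Sum>t<T. 1 / g t)\<^sup>2 * (\<Sum>t<T. (g t)\<^sup>2)"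
proof -
  define G where "G = (\<Sum>t<T. 1 / g t)"
  have G: "0 < G"
    unfolding G_def using g T by (intro sum_pos) auto
  define h where "h = real T / G"
  have h: "0 < h"
    using T G by (simp add: h_def)
  \<comment> \<open>Multiplied by \<open>x\<close>, the difference of the two sides is
    \<open>(x - h)^2 * (x + 2 * h)\<close>.\<close>
  have tangent: "3 * h\<^sup>2 - 2 * h ^ 3 * (1 / x) \<le> x\<^sup>2" if "0 < x" for x
  proof -
    have "0 \<le> (x - h)\<^sup>2 * (x + 2 * h)"
      using that h by simp
    also have "\<dots> = x ^ 3 - 3 * h\<^sup>2 * x + 2 * h ^ 3"
      by (simp add: power2_eq_square power3_eq_cube algebra_simps)
    finally show ?thesis
      using that by (simp add: field_simps power2_eq_square power3_eq_cube)
  qed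
  have "(\<Sum>t<T. 3 * h\<^sup>2 - 2 * h ^ 3 * (1 / g t)) \<le> (\<Sum>t<T. (g t)\<^sup>2)"
    using g by (intro sum_mono tangent) auto
  also have "(\<Sum>t<T. 3 * h\<^sup>2 - 2 * h ^ 3 * (1 / g t)) = 3 * h\<^sup>2 * real T - 2 * h ^ 3 * G"
    by (simp add: sum_subtractf G_def sum_distrib_left)
  also have "\<dots> = real T ^ 3 / G\<^sup>2"
    using G by (simp add: h_def power2_eq_square power3_eq_cube)
  finally show ?thesis
    using G by (simp add: G_def[symmetric] divide_le_eq mult.commute)
qed

text \<open>Jensen's inequality for the squared norm. Linearizing at the mean deviation
  \<open>u\<close> replaces each term by \<open>2 * ((x t - z) \<bullet> u) - (vnorm u)^2\<close>,
  whose weighted mean is exactly \<open>(vnorm u)^2\<close>.\<close>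

lemma vnorm_weighted_average:
  fixes w :: "nat \<Rightarrow> real"
  assumes w: "\<And>t. t < T \<Longrightarrow> 0 < w t" and T: "0 < T"
    and x: "\<And>t. t < T \<Longrightarrow> x t \<in> carrier_vec d" and z: "z \<in> carrier_vec d"
  shows "(\<Sum>t<T. w t) * (vnorm ((1 / (\<Sum>t<T. w t)) \<cdot>\<^sub>v vec d (\<lambda>i. \<Sum>t<T. w t * x t $ i) - z))\<^sup>2
    \<le> (\<Sum>t<T. w t * (vnorm (x t - z))\<^sup>2)"
proof -
  define W where "W = (\<Sum>t<T. w t)"
  have W: "0 < W"
    unfolding W_def using w T by (intro sum_pos) auto
  define u where "u = (1 / W) \<cdot>\<^sub>v vec d (\<lambda>i. \<Sum>t<T. w t * x t $ i) - z"
  have u: "u \<in> carrier_vec d"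
    using z by (simp add: u_def)
  have "W * (vnorm u)\<^sup>2 = (\<Sum>t<T. w t * (2 * ((x t - z) \<bullet> u) - (vnorm u)\<^sup>2))"
  proof -
    have comp: "(\<Sum>t<T. w t * (x t $ i - z $ i)) = W * u $ i" if "i < d" for i
      using that z W
      by (simp add: u_def right_diff_distrib sum_subtractf sum_distrib_right[symmetric] W_def[symmetric])
    have "(\<Sum>t<T. w t * ((x t - z) \<bullet> u)) = (\<Sum>t<T. \<Sum>i\<in>{0..<d}. w t * (x t $ i - z $ i) * u $ i)"
      using x z u by (intro sum.cong) (auto simp: scalar_prod_def sum_distrib_left mult.assoc)
    also have "\<dots> = (\<Sum>i\<in>{0..<d}. (\<Sum>t<T. w t * (x t $ i - z $ i)) * u $ i)"
      by (subst sum.swap) (simp add: sum_distrib_right)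
    also have "\<dots> = (\<Sum>i\<in>{0..<d}. W * (u $ i * u $ i))"
      using comp by (intro sum.cong) auto
    also have "\<dots> = W * (vnorm u)\<^sup>2"
      using u by (simp add: vnorm_sq scalar_prod_def sum_distrib_left)
    finally have *: "(\<Sum>t<T. w t * ((x t - z) \<bullet> u)) = W * (vnorm u)\<^sup>2" .
    have "(\<Sum>t<T. w t * (2 * ((x t - z) \<bullet> u) - (vnorm u)\<^sup>2)) =
        2 * (\<Sum>t<T. w t * ((x t - z) \<bullet> u)) - W * (vnorm u)\<^sup>2"
      by (simp add: right_diff_distrib sum_subtractf sum_distrib_left sum_distrib_right W_def mult.left_commute)
    then show ?thesis
      using * by simp
  qed
  also have "\<dots> \<le> (\<Sum>t<T. w t * (vnorm (x t - z))\<^sup>2)"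
  proof (intro sum_mono mult_left_mono)
    fix t assume t: "t \<in> {..<T}"
    then have xt: "x t - z \<in> carrier_vec d"
      using z x by simp
    have "2 * ((x t - z) \<bullet> u) \<le> 2 * (vnorm (x t - z) * vnorm u)"
      using scalar_prod_abs_le[OF xt u] by simp
    also have "\<dots> \<le> (vnorm (x t - z))\<^sup>2 + (vnorm u)\<^sup>2"
      using sum_squares_bound[of "vnorm (x t - z)" "vnorm u"] by simp
    finally show "2 * ((x t - z) \<bullet> u) - (vnorm u)\<^sup>2 \<le> (vnorm (x t - z))\<^sup>2"
      by simp
    show "0 \<le> w t"
      using w t by (simp add: less_imp_le)
  qed
  finally show ?thesis
    by (simp add: W_def u_def)
qed

lemma schur_solve_carrier:
  assumes "schur_decomp d A QU"
  shows "schur_solve QU \<gamma> v \<in> carrier_vec d"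
proof -
  obtain Q U where QU: "QU = (Q, U)"
    by (cases QU)
  have "Q \<in> carrier_mat d d"
    using assms unfolding schur_decomp_def QU prod.case by (elim conjE)
  then show ?thesis
    unfolding schur_solve_def QU prod.case by (intro carrier_vecI) simp
qed

section \<open>The iterates of a run and their energy\<close>

context strongly_monotone_root
begin

lemma root_unique:
  assumes "z \<in> carrier_vec d" "F z = 0\<^sub>v d"
  shows "z = zs"
proof -
  have "\<mu> * (vnorm (z - zs))\<^sup>2 \<le> 0"
    using strong_mono[OF assms(1) zs_carrier] assms zs_carrier by (simp add: F_root)
  then have "vnorm (z - zs) = 0"
    using mu_pos by (simp add: mult_le_0_iff)
  then show ?thesis
    by (rule vnorm_minus_eq_0[OF assms(1) zs_carrier])
qed

end

text \<open>The rule for \<gamma> stays abstract, so that one argument serves both the exact root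
  and the bisection. The bound \<open>b\<close> will be chosen to cover the brackets in all
  restarts.\<close>

locale len_run = strongly_monotone_root +
  fixes schur :: "real mat \<Rightarrow> complex mat \<times> complex mat" and rt :: root_rule
    and m :: nat and M b :: real
  assumes schur: "\<forall>A\<in>carrier_mat d d. schur_decomp d A (schur A)"
    and m_pos: "0 < m" and M_eq: "M = 3 * \<rho> * real m"
    and rule: "good_rule d \<mu> M (1 / 100) b rt"
begin

abbreviation "iter \<equiv> len_z d F schur rt m"
abbreviation "gam \<equiv> len_gamma d F schur rt m"
abbreviation "half \<equiv> len_half d F schur rt m"
abbreviation "anchor z0 t \<equiv> iter z0 (t - t mod m)"

lemma M_pos: "0 < M"
  using rho_pos m_pos by (simp add: M_eq)

lemma iter_Suc: "iter z0 (Suc t) = iter z0 t - (1 / gam z0 t) \<cdot>\<^sub>v F (half z0 t)"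
  by (simp add: len_half_def len_gamma_def len_jac_def Let_def)

text \<open>Complete induction, because a step also uses the Jacobian at an earlier anchor.\<close>

lemma iter_carrier: "z0 \<in> carrier_vec d \<Longrightarrow> iter z0 t \<in> carrier_vec d"
proof (induction t rule: less_induct)
  case (less t)
  show ?case
  proof (cases t)
    case (Suc k)
    have "len_jac d F schur rt m z0 k \<in> carrier_mat d d"
      unfolding len_jac_def using less Suc by (intro J_carrier) auto
    then have "half z0 k \<in> carrier_vec d"
      unfolding len_half_def using schur less Suc by (intro minus_carrier_vec schur_solve_carrier) auto
    then show ?thesis
      unfolding Suc iter_Suc using less Suc by (intro minus_carrier_vec smult_carrier_vec[THEN iffD2] F_carrier) auto
  qed (use less in simp)
qed

context
  fixes z0 :: "real vec" and t :: nat
  assumes z0: "z0 \<in> carrier_vec d" and nz: "F (iter z0 t) \<noteq> 0\<^sub>v d"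
begin

lemma len_jac_coercive: "coercive d \<mu> (len_jac d F schur rt m z0 t)"
  unfolding len_jac_def by (rule J_coercive[OF iter_carrier[OF z0]])

lemma gam_pos: "0 < gam z0 t"
  unfolding len_gamma_def
  using rule len_jac_coercive F_carrier[OF iter_carrier[OF z0]] nz by (simp add: good_rule_def)

lemma half_eq:
  "half z0 t = iter z0 t - resolvent (J (anchor z0 t)) (gam z0 t) (F (iter z0 t))"
proof -
  have "schur_solve (schur (len_jac d F schur rt m z0 t)) (gam z0 t) (F (iter z0 t)) =
      resolvent (len_jac d F schur rt m z0 t) (gam z0 t) (F (iter z0 t))"
    using schur len_jac_coercive gam_pos
    by (intro schur_solve_eq_resolvent[OF len_jac_coercive mu_pos _ F_carrier[OF iter_carrier[OF z0]]])
       (auto simp: coercive_def)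
  then show ?thesis
    by (simp add: len_half_def len_jac_def)
qed

lemma step_resolvent:
  "resolvent (J (anchor z0 t)) (gam z0 t) (F (iter z0 t)) \<in> carrier_vec d"
  "J (anchor z0 t) *\<^sub>v resolvent (J (anchor z0 t)) (gam z0 t) (F (iter z0 t)) +
     gam z0 t \<cdot>\<^sub>v resolvent (J (anchor z0 t)) (gam z0 t) (F (iter z0 t)) = F (iter z0 t)"
  using resolvent_props(1)[OF J_coercive[OF iter_carrier[OF z0]] mu_pos F_carrier[OF iter_carrier[OF z0]] less_imp_le[OF gam_pos]]
    resolvent_eq[OF J_coercive[OF iter_carrier[OF z0]] mu_pos F_carrier[OF iter_carrier[OF z0]] less_imp_le[OF gam_pos]]
  by auto

lemma half_carrier: "half z0 t \<in> carrier_vec d"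
  unfolding half_eq using step_resolvent(1) by (rule minus_carrier_vec[OF iter_carrier[OF z0]])

lemma half_minus_iter:
  "half z0 t - iter z0 t = - resolvent (J (anchor z0 t)) (gam z0 t) (F (iter z0 t))"
  unfolding half_eq using step_resolvent(1) iter_carrier[OF z0, of t] by (intro eq_vecI) auto

lemma gam_bounds:
  shows "M * vnorm (half z0 t - iter z0 t) \<le> gam z0 t"
    and "M * vnorm (resolvent (J (anchor z0 t)) 0 (F (iter z0 t))) \<le> b \<Longrightarrow>
      gam z0 t \<le> 101 / 100 * (M * vnorm (half z0 t - iter z0 t)) + \<mu> / 100"
proof -
  have *: "M * vnorm (resolvent A (rt A v) v) \<le> rt A v"
    "M * vnorm (resolvent A 0 v) \<le> b \<Longrightarrow>
      rt A v \<le> (1 + 1 / 100) * (M * vnorm (resolvent A (rt A v) v)) + 1 / 100 * \<mu>"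
    if "coercive d \<mu> A" "v \<in> carrier_vec d" "v \<noteq> 0\<^sub>v d" for A v
    using rule that unfolding good_rule_def by auto
  note b = *[OF len_jac_coercive F_carrier[OF iter_carrier[OF z0]] nz,
      folded len_gamma_def, unfolded len_jac_def]
  show "M * vnorm (half z0 t - iter z0 t) \<le> gam z0 t"
    unfolding half_minus_iter using b(1) by simp
  show "M * vnorm (resolvent (J (anchor z0 t)) 0 (F (iter z0 t))) \<le> b \<Longrightarrow>
      gam z0 t \<le> 101 / 100 * (M * vnorm (half z0 t - iter z0 t)) + \<mu> / 100"
    unfolding half_minus_iter using b(2) by simp
qed

text \<open>By the equation for the resolvent \<open>w\<close>, the vector
  \<open>F h - \<gamma> w\<close> is the error at \<open>h\<close> of the linear model with value
  \<open>F z\<close> and Jacobian \<open>J a\<close>; divided by \<open>- \<gamma>\<close> it is the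
  vector to be bounded. It splits into the Taylor remainder at \<open>z\<close> and the effect of
  replacing \<open>J z\<close> by \<open>J a\<close>. The choice of \<open>M\<close> makes
  \<open>\<rho> * r\<close> at most \<open>\<gamma> / (3 * m)\<close>.\<close>

lemma extragradient_error:
  "vnorm (iter z0 (Suc t) - half z0 t) \<le>
     vnorm (half z0 t - iter z0 t) / (6 * real m) + vnorm (iter z0 t - anchor z0 t) / (3 * real m)"
proof -
  define z a h \<gamma> w where "z = iter z0 t" and "a = anchor z0 t" and "h = half z0 t"
    and "\<gamma> = gam z0 t" and "w = resolvent (J a) \<gamma> (F z)"
  define r s where "r = vnorm (h - z)" and "s = vnorm (z - a)"
  have c: "z \<in> carrier_vec d" "a \<in> carrier_vec d" "h \<in> carrier_vec d" "w \<in> carrier_vec d"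
    using iter_carrier[OF z0] half_carrier step_resolvent(1) by (auto simp: z_def a_def h_def \<gamma>_def w_def)
  have \<gamma>: "0 < \<gamma>" "M * r \<le> \<gamma>"
    using gam_pos gam_bounds(1) by (simp_all add: \<gamma>_def r_def h_def z_def)
  have hz: "h - z = - w"
    using half_minus_iter by (simp add: h_def z_def w_def a_def \<gamma>_def)
  have eq: "J a *\<^sub>v w + \<gamma> \<cdot>\<^sub>v w = F z"
    using step_resolvent(2) by (simp add: z_def a_def \<gamma>_def w_def)
  note cJ = J_carrier[OF c(1)] J_carrier[OF c(2)] and cF = F_carrier[OF c(1)] F_carrier[OF c(3)]
  have hw: "h = z - w"
    using half_eq by (simp add: h_def z_def w_def a_def \<gamma>_def)
  have nw: "h - z \<in> carrier_vec d"
    using c by simp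
  let ?E1 = "F h - F z - J z *\<^sub>v (h - z)" and ?E2 = "(J z - J a) *\<^sub>v (h - z)"
  have cE: "?E1 \<in> carrier_vec d" "?E2 \<in> carrier_vec d"
    using cF cJ nw mult_mat_vec_carrier[OF minus_carrier_mat[OF cJ(2)] nw] by auto
  have Jn: "J a *\<^sub>v (h - z) = - (J a *\<^sub>v w)"
    unfolding hz using cJ c by (intro eq_vecI) auto
  have E2: "?E2 = J z *\<^sub>v (h - z) - J a *\<^sub>v (h - z)"
    by (rule minus_mult_distrib_mat_vec[OF cJ nw])
  define X where "X = ?E1 + ?E2"
  have cX: "X \<in> carrier_vec d"
    unfolding X_def by (rule add_carrier_vec[OF cE])
  have Xi: "X $ i = F h $ i - \<gamma> * w $ i" if i: "i < d" for i
  proof -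
    have "(J a *\<^sub>v w + \<gamma> \<cdot>\<^sub>v w) $ i = F z $ i"
      by (simp add: eq)
    then have "(J a *\<^sub>v w) $ i = F z $ i - \<gamma> * w $ i"
      using i c cJ by simp
    moreover have "X $ i = F h $ i - F z $ i + (J a *\<^sub>v w) $ i"
      unfolding X_def E2 Jn using i c cJ cF by simp
    ultimately show ?thesis
      by simp
  qed
  have "iter z0 (Suc t) - h = - ((1 / \<gamma>) \<cdot>\<^sub>v X)"
  proof
    fix i assume "i < dim_vec (- ((1 / \<gamma>) \<cdot>\<^sub>v X))"
    then have i: "i < d"
      using cX by simp
    have "(iter z0 (Suc t) - h) $ i = w $ i - F h $ i / \<gamma>"
      unfolding iter_Suc using i c cF
      by (simp add: h_def[symmetric] z_def[symmetric] \<gamma>_def[symmetric]) (simp add: hw)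
    also have "\<dots> = - (1 / \<gamma> * X $ i)"
      using \<gamma>(1) by (simp add: Xi[OF i] field_simps)
    finally show "(iter z0 (Suc t) - h) $ i = (- ((1 / \<gamma>) \<cdot>\<^sub>v X)) $ i"
      using i cX by simp
  qed (use c cX in simp)
  then have "\<gamma> * vnorm (iter z0 (Suc t) - h) = vnorm X"
    using \<gamma>(1) by simp
  also have "vnorm X \<le> vnorm ?E1 + vnorm ?E2"
    unfolding X_def by (rule vnorm_triangle[OF cE])
  also have "\<dots> \<le> \<rho> / 2 * r\<^sup>2 + \<rho> * s * r"
    using taylor_bound[OF c(3,1)] jac_lipschitz[OF c(1,2) nw] by (simp add: r_def s_def)
  also have "\<dots> = (\<rho> * r) * (r / 2 + s)"
    by (simp add: power2_eq_square algebra_simps)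
  also have "\<dots> \<le> (\<gamma> / (3 * real m)) * (r / 2 + s)"
    using \<gamma>(2) m_pos by (intro mult_right_mono) (auto simp: M_eq field_simps r_def s_def)
  also have "\<dots> = \<gamma> * (r / (6 * real m) + s / (3 * real m))"
    using m_pos by (simp add: field_simps)
  finally show ?thesis
    using \<gamma>(1) by (simp add: h_def[symmetric] z_def[symmetric] a_def[symmetric] r_def s_def)
qed

text \<open>The three-point identity for consecutive iterates with the half step in between. Strong
  monotonicity between the half step and the root supplies the term with \<mu>.\<close>

lemma energy_step:
  "(vnorm (iter z0 (Suc t) - zs))\<^sup>2 + (vnorm (half z0 t - iter z0 t))\<^sup>2
     + 2 * \<mu> * (1 / gam z0 t * (vnorm (half z0 t - zs))\<^sup>2)
   \<le> (vnorm (iter z0 t - zs))\<^sup>2 + (vnorm (iter z0 (Suc t) - half z0 t))\<^sup>2"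
proof -
  note c = iter_carrier[OF z0, of t] iter_carrier[OF z0, of "Suc t"] half_carrier
  have "iter z0 t - iter z0 (Suc t) = (1 / gam z0 t) \<cdot>\<^sub>v F (half z0 t)"
    unfolding iter_Suc using c F_carrier[OF c(3)] by (intro eq_vecI) auto
  then have "2 * (1 / gam z0 t * (F (half z0 t) \<bullet> (half z0 t - zs))) =
      2 * ((iter z0 t - iter z0 (Suc t)) \<bullet> (half z0 t - zs))"
    using c F_carrier[OF c(3)] zs_carrier by simp
  also have "\<dots> = (vnorm (iter z0 t - zs))\<^sup>2 - (vnorm (iter z0 (Suc t) - zs))\<^sup>2
      - (vnorm (iter z0 t - half z0 t))\<^sup>2 + (vnorm (iter z0 (Suc t) - half z0 t))\<^sup>2"
    by (rule three_point_identity[OF c zs_carrier])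
  finally have *: "2 * (1 / gam z0 t * (F (half z0 t) \<bullet> (half z0 t - zs))) = \<dots>" .
  have "\<mu> * (vnorm (half z0 t - zs))\<^sup>2 \<le> (half z0 t - zs) \<bullet> F (half z0 t)"
    using strong_mono[OF c(3) zs_carrier] F_carrier[OF c(3)] by (simp add: F_root)
  also have "\<dots> = F (half z0 t) \<bullet> (half z0 t - zs)"
    using c F_carrier[OF c(3)] zs_carrier by (intro comm_scalar_prod) auto
  finally have "1 / gam z0 t * (\<mu> * (vnorm (half z0 t - zs))\<^sup>2) \<le>
      1 / gam z0 t * (F (half z0 t) \<bullet> (half z0 t - zs))"
    using gam_pos by (intro mult_left_mono) auto
  then have "2 * (1 / gam z0 t * (\<mu> * (vnorm (half z0 t - zs))\<^sup>2)) \<le>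
      2 * (1 / gam z0 t * (F (half z0 t) \<bullet> (half z0 t - zs)))"
    by (rule mult_left_mono) simp
  moreover have "2 * \<mu> * (1 / gam z0 t * (vnorm (half z0 t - zs))\<^sup>2) =
      2 * (1 / gam z0 t * (\<mu> * (vnorm (half z0 t - zs))\<^sup>2))"
    by simp
  ultimately show ?thesis
    using * unfolding vnorm_minus_commute[OF c(1,3)] by argo
qed

end

lemma iter_diff_le:
  assumes z0: "z0 \<in> carrier_vec d" and kt: "k \<le> t" and nz: "\<forall>i<t. F (iter z0 i) \<noteq> 0\<^sub>v d"
  shows "vnorm (iter z0 t - iter z0 k) \<le>
    (\<Sum>i\<in>{k..<t}. vnorm (half z0 i - iter z0 i) + vnorm (iter z0 (Suc i) - half z0 i))"
  using kt nz
proof (induction t rule: dec_induct)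
  case base
  have "iter z0 k - iter z0 k = 0\<^sub>v d"
    using iter_carrier[OF z0, of k] by simp
  then show ?case
    by simp
next
  case (step t)
  note c = iter_carrier[OF z0, of "Suc t"] iter_carrier[OF z0, of t] iter_carrier[OF z0, of k]
  have h: "half z0 t \<in> carrier_vec d"
    using step.prems by (intro half_carrier[OF z0]) simp
  have "vnorm (iter z0 (Suc t) - iter z0 k) \<le> vnorm (iter z0 (Suc t) - iter z0 t) + vnorm (iter z0 t - iter z0 k)"
    by (rule vnorm_triangle_minus[OF c])
  moreover have "vnorm (iter z0 (Suc t) - iter z0 t) \<le> vnorm (iter z0 (Suc t) - half z0 t) + vnorm (half z0 t - iter z0 t)"
    by (rule vnorm_triangle_minus[OF c(1) h c(2)])
  moreover have "vnorm (iter z0 t - iter z0 k) \<le>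
    (\<Sum>i\<in>{k..<t}. vnorm (half z0 i - iter z0 i) + vnorm (iter z0 (Suc i) - half z0 i))"
    using step.IH step.prems by simp
  ultimately show ?case
    using step.hyps by (simp del: len_z.simps)
qed

lemma energy_sum:
  assumes z0: "z0 \<in> carrier_vec d" and nz: "\<forall>i<n. F (iter z0 i) \<noteq> 0\<^sub>v d"
  shows "(vnorm (iter z0 n - zs))\<^sup>2 + 1 / 10 * (\<Sum>t<n. (vnorm (half z0 t - iter z0 t))\<^sup>2)
      + 2 * \<mu> * (\<Sum>t<n. 1 / gam z0 t * (vnorm (half z0 t - zs))\<^sup>2) \<le> (vnorm (z0 - zs))\<^sup>2"
proof -
  let ?r = "\<lambda>t. vnorm (half z0 t - iter z0 t)" and ?e = "\<lambda>t. vnorm (iter z0 (Suc t) - half z0 t)"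
  let ?h = "\<lambda>t. 1 / gam z0 t * (vnorm (half z0 t - zs))\<^sup>2"
  have tel: "(vnorm (iter z0 k - zs))\<^sup>2 + (\<Sum>t<k. (?r t)\<^sup>2) + 2 * \<mu> * (\<Sum>t<k. ?h t)
      \<le> (vnorm (z0 - zs))\<^sup>2 + (\<Sum>t<k. (?e t)\<^sup>2)" if "k \<le> n" for k
    using that
  proof (induction k)
    case (Suc k)
    have "(vnorm (iter z0 (Suc k) - zs))\<^sup>2 + (?r k)\<^sup>2 + 2 * \<mu> * ?h k \<le> (vnorm (iter z0 k - zs))\<^sup>2 + (?e k)\<^sup>2"
      using Suc.prems by (intro energy_step[OF z0 nz[rule_format]]) simp
    moreover have "2 * \<mu> * (\<Sum>t<Suc k. ?h t) = 2 * \<mu> * (\<Sum>t<k. ?h t) + 2 * \<mu> * ?h k"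
      by (simp only: sum.lessThan_Suc distrib_left)
    ultimately show ?case
      using Suc.IH Suc.prems unfolding sum.lessThan_Suc[of "\<lambda>t. (?r t)\<^sup>2"] sum.lessThan_Suc[of "\<lambda>t. (?e t)\<^sup>2"]
      by linarith
  qed simp
  \<comment> \<open>The extragradient errors use up nine tenths of the step lengths; the tenth that
    remains later bounds the sum of the squares of \<gamma>.\<close>
  have "(\<Sum>t<n. (?e t)\<^sup>2) \<le> 9 / 10 * (\<Sum>t<n. (?r t)\<^sup>2)"
  proof (rule lazy_error_sum[OF m_pos, where s = "\<lambda>t. vnorm (iter z0 t - anchor z0 t)"])
    fix t assume t: "t < n"
    show "?e t \<le> ?r t / (6 * real m) + vnorm (iter z0 t - anchor z0 t) / (3 * real m)"
      by (rule extragradient_error[OF z0 nz[rule_format, OF t]])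
    show "vnorm (iter z0 t - anchor z0 t) \<le> (\<Sum>i\<in>{t - t mod m..<t}. ?r i + ?e i)"
      using nz t by (intro iter_diff_le[OF z0]) auto
  qed auto
  with tel[OF order_refl] show ?thesis
    by argo
qed

text \<open>Rests only on the unconditional half of \<open>gam_bounds\<close>, and can therefore be
  used to meet the condition involving \<open>b\<close> in the other half.\<close>

lemma iter_dist_le:
  assumes z0: "z0 \<in> carrier_vec d" and nz: "\<forall>i<n. F (iter z0 i) \<noteq> 0\<^sub>v d"
  shows "vnorm (iter z0 n - zs) \<le> vnorm (z0 - zs)"
proof -
  have "0 \<le> (\<Sum>t<n. (vnorm (half z0 t - iter z0 t))\<^sup>2)"
    by (intro sum_nonneg) simp
  moreover have "0 \<le> 2 * \<mu> * (\<Sum>t<n. 1 / gam z0 t * (vnorm (half z0 t - zs))\<^sup>2)"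
    using gam_pos[OF z0 nz[rule_format]] mu_pos by (intro mult_nonneg_nonneg sum_nonneg) (auto intro: less_imp_le)
  ultimately have "(vnorm (iter z0 n - zs))\<^sup>2 \<le> (vnorm (z0 - zs))\<^sup>2"
    using energy_sum[OF z0 nz] by argo
  then show ?thesis
    by (rule power2_le_imp_le) simp
qed

text \<open>One value of \<gamma> of at most 9/100 of \<mu> already makes the sum large enough.
  Otherwise the additive error is absorbed and every \<gamma> is a bounded multiple of
  \<open>M * ?r t\<close>; the energy bound then controls the sum of squares, and
  \<open>harmonic_sum_bound\<close> turns the size of \<open>T\<close> into a bound on the sum of
  reciprocals.\<close>

lemma weight_sum_lower_bound:
  assumes z0: "z0 \<in> carrier_vec d" and nz: "\<forall>i<T. F (iter z0 i) \<noteq> 0\<^sub>v d" and T: "0 < T"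
    and b: "M * (vnorm (z0 - zs) + 3 * (\<rho> / \<mu>) * (vnorm (z0 - zs))\<^sup>2) \<le> b"
    and T3: "(2 * M * vnorm (z0 - zs) / \<mu>)\<^sup>2 \<le> real T ^ 3"
  shows "10 / 19 \<le> \<mu> * (\<Sum>t<T. 1 / gam z0 t)"
proof (cases "\<exists>t<T. gam z0 t \<le> 9 / 100 * \<mu>")
  case True
  then obtain t where t: "t < T" "gam z0 t \<le> 9 / 100 * \<mu>"
    by auto
  have g: "0 < gam z0 t"
    by (rule gam_pos[OF z0 nz[rule_format, OF t(1)]])
  have "10 / 19 \<le> \<mu> * (1 / gam z0 t)"
    using t(2) g mu_pos by (simp add: field_simps)
  also have "1 / gam z0 t \<le> (\<Sum>t<T. 1 / gam z0 t)"
    using t gam_pos[OF z0 nz[rule_format]] by (intro member_le_sum) (auto intro: less_imp_le)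
  finally show ?thesis
    using mu_pos by simp
next
  case False
  let ?r = "\<lambda>t. vnorm (half z0 t - iter z0 t)"
  define R where "R = vnorm (z0 - zs)"
  define G where "G = (\<Sum>t<T. 1 / gam z0 t)"
  have "F z0 \<noteq> 0\<^sub>v d"
    using nz[rule_format, OF T] by simp
  then have "z0 \<noteq> zs"
    using F_root by auto
  then have R: "0 < R"
    using vnorm_minus_eq_0[OF z0 zs_carrier] vnorm_nonneg[of "z0 - zs"] unfolding R_def order_less_le by metis
  have G: "0 < G"
    unfolding G_def using gam_pos[OF z0 nz[rule_format]] T by (intro sum_pos) auto
  have g: "(gam z0 t)\<^sup>2 \<le> 13 / 10 * (M\<^sup>2 * (?r t)\<^sup>2)" if t: "t < T" for t
  proof -
    have "vnorm (iter z0 t - zs) \<le> R" "vnorm (anchor z0 t - zs) \<le> R"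
      unfolding R_def using t nz by (auto intro!: iter_dist_le[OF z0])
    then have "vnorm (resolvent (J (anchor z0 t)) 0 (F (iter z0 t))) \<le> R + 3 * (\<rho> / \<mu>) * R\<^sup>2"
      by (intro lazy_newton_bound iter_carrier[OF z0])
    then have "M * vnorm (resolvent (J (anchor z0 t)) 0 (F (iter z0 t))) \<le> M * (R + 3 * (\<rho> / \<mu>) * R\<^sup>2)"
      using M_pos by (intro mult_left_mono) auto
    also have "\<dots> \<le> b"
      using b by (simp add: R_def)
    finally have "gam z0 t \<le> 101 / 100 * (M * ?r t) + \<mu> / 100"
      by (rule gam_bounds(2)[OF z0 nz[rule_format, OF t]])
    moreover have "9 / 100 * \<mu> < gam z0 t"
      using False t by (auto simp: not_le)
    moreover have "0 \<le> M * ?r t"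
      using M_pos by simp
    \<comment> \<open>Here \<mu> / 100 is below \<gamma> / 9, which moves to the left side; 9/8
      times 101/100 is less than 114/100.\<close>
    ultimately have "gam z0 t \<le> 114 / 100 * (M * ?r t)"
      by argo
    then have "(gam z0 t)\<^sup>2 \<le> (114 / 100 * (M * ?r t))\<^sup>2"
      using gam_pos[OF z0 nz[rule_format, OF t]] by (intro power_mono) auto
    also have "\<dots> = (114 / 100)\<^sup>2 * (M\<^sup>2 * (?r t)\<^sup>2)"
      by (simp only: power_mult_distrib)
    also have "\<dots> \<le> 13 / 10 * (M\<^sup>2 * (?r t)\<^sup>2)"
      by (intro mult_right_mono) (auto simp: power2_eq_square)
    finally show ?thesis .
  qed
  have "(\<Sum>t<T. (?r t)\<^sup>2) \<le> 10 * R\<^sup>2"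
  proof -
    have "0 \<le> 2 * \<mu> * (\<Sum>t<T. 1 / gam z0 t * (vnorm (half z0 t - zs))\<^sup>2)"
      using gam_pos[OF z0 nz[rule_format]] mu_pos by (intro mult_nonneg_nonneg sum_nonneg) (auto intro: less_imp_le)
    then show ?thesis
      using energy_sum[OF z0 nz] zero_le_power2[of "vnorm (iter z0 T - zs)"] unfolding R_def by argo
  qed
  then have "13 / 10 * M\<^sup>2 * (\<Sum>t<T. (?r t)\<^sup>2) \<le> 13 / 10 * M\<^sup>2 * (10 * R\<^sup>2)"
    by (intro mult_left_mono) auto
  moreover have "(\<Sum>t<T. (gam z0 t)\<^sup>2) \<le> (\<Sum>t<T. 13 / 10 * (M\<^sup>2 * (?r t)\<^sup>2))"
    by (intro sum_mono g) simp
  ultimately have g2: "(\<Sum>t<T. (gam z0 t)\<^sup>2) \<le> 13 * (M\<^sup>2 * R\<^sup>2)"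
    by (simp add: sum_distrib_left mult.assoc)
  have "4 * (M\<^sup>2 * R\<^sup>2) / \<mu>\<^sup>2 = (2 * M * R / \<mu>)\<^sup>2"
    by (simp add: power_mult_distrib power_divide)
  also have "\<dots> \<le> real T ^ 3"
    using T3 by (simp add: R_def)
  also have "\<dots> \<le> G\<^sup>2 * (\<Sum>t<T. (gam z0 t)\<^sup>2)"
    unfolding G_def by (rule harmonic_sum_bound[OF gam_pos[OF z0 nz[rule_format]] T])
  also have "\<dots> \<le> G\<^sup>2 * (13 * (M\<^sup>2 * R\<^sup>2))"
    using g2 by (intro mult_left_mono) auto
  finally have "4 / \<mu>\<^sup>2 * (M\<^sup>2 * R\<^sup>2) \<le> 13 * G\<^sup>2 * (M\<^sup>2 * R\<^sup>2)"
    by (simp add: mult_ac)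
  then have "4 / \<mu>\<^sup>2 \<le> 13 * G\<^sup>2"
    by (rule mult_right_le_imp_le) (use M_pos R in simp)
  then have "4 / 13 \<le> (\<mu> * G)\<^sup>2"
    using mu_pos by (simp add: field_simps power_mult_distrib)
  \<comment> \<open>The fraction 10/19 lies below the square root of 4/13 and is chosen so that half
    its reciprocal is the contraction factor 19/20.\<close>
  then have "(10 / 19)\<^sup>2 \<le> (\<mu> * G)\<^sup>2"
    by (simp add: power2_eq_square)
  then show ?thesis
    unfolding G_def[symmetric] by (rule power2_le_imp_le) (use mu_pos G in simp)
qed

section \<open>Contraction by one run and by restarts\<close>

lemma len_stop_props:
  assumes "n = len_stop d F schur rt m z0 T"
  shows "n \<le> T" and "\<forall>t<n. F (iter z0 t) \<noteq> 0\<^sub>v d"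
    and "n < T \<Longrightarrow> F (iter z0 n) = 0\<^sub>v d"
proof -
  let ?P = "\<lambda>t. t = T \<or> F (iter z0 t) = 0\<^sub>v d"
  have n: "n = (LEAST t. ?P t)"
    using assms by (simp add: len_stop_def)
  show "n \<le> T"
    unfolding n by (rule Least_le) simp
  have "?P n"
    unfolding n by (rule LeastI[of ?P T]) simp
  then show "n < T \<Longrightarrow> F (iter z0 n) = 0\<^sub>v d"
    by auto
  show "\<forall>t<n. F (iter z0 t) \<noteq> 0\<^sub>v d"
    using not_less_Least[of _ ?P] unfolding n[symmetric] by blast
qed

lemma LEN_contraction:
  assumes z0: "z0 \<in> carrier_vec d"
    and b: "M * (vnorm (z0 - zs) + 3 * (\<rho> / \<mu>) * (vnorm (z0 - zs))\<^sup>2) \<le> b"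
    and T3: "(2 * M * vnorm (z0 - zs) / \<mu>)\<^sup>2 \<le> real T ^ 3"
  shows "LEN d F schur rt m T z0 \<in> carrier_vec d"
    and "(vnorm (LEN d F schur rt m T z0 - zs))\<^sup>2 \<le> 19 / 20 * (vnorm (z0 - zs))\<^sup>2"
proof -
  define n where "n = len_stop d F schur rt m z0 T"
  note stop = len_stop_props[OF n_def]
  have "LEN d F schur rt m T z0 \<in> carrier_vec d \<and>
    (vnorm (LEN d F schur rt m T z0 - zs))\<^sup>2 \<le> 19 / 20 * (vnorm (z0 - zs))\<^sup>2"
  proof (cases "n < T \<or> T = 0")
    case True
    then have L: "LEN d F schur rt m T z0 = iter z0 n"
      by (simp add: LEN_def n_def[symmetric])
    \<comment> \<open>An early stop occurs only at a zero of \<open>F\<close>, and the zero is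
      unique. If \<open>T = 0\<close>, the hypothesis \<open>T3\<close> forces the initial distance
      to vanish, so \<open>z0\<close> is already the solution.\<close>
    have "iter z0 n = zs"
    proof (cases "T = 0")
      case False
      then show ?thesis
        using True stop(3) root_unique[OF iter_carrier[OF z0]] by simp
    next
      case T0: True
      then have "vnorm (z0 - zs) = 0"
        using T3 M_pos mu_pos by simp
      then have "z0 = zs"
        by (rule vnorm_minus_eq_0[OF z0 zs_carrier])
      then show ?thesis
        using T0 stop(1) by simp
    qed
    moreover have "zs - zs = 0\<^sub>v d"
      using zs_carrier by simp
    ultimately show ?thesis
      using zs_carrier L by simp
  next
    case False
    then have n: "n = T" and T: "0 < T"
      using stop(1) by auto
    note nz = stop(2)[unfolded n]
    define G where "G = (\<Sum>t<T. 1 / gam z0 t)"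
    define L where "L = LEN d F schur rt m T z0"
    have L: "L = (1 / G) \<cdot>\<^sub>v vec d (\<lambda>i. \<Sum>t<T. 1 / gam z0 t * half z0 t $ i)"
      using False by (simp add: L_def LEN_def n_def[symmetric] G_def)
    have "G * (vnorm (L - zs))\<^sup>2 \<le> (\<Sum>t<T. 1 / gam z0 t * (vnorm (half z0 t - zs))\<^sup>2)"
      unfolding L G_def
      using gam_pos[OF z0 nz[rule_format]] half_carrier[OF z0 nz[rule_format]] by (intro vnorm_weighted_average T zs_carrier) auto
    then have "2 * \<mu> * (G * (vnorm (L - zs))\<^sup>2) \<le>
        2 * \<mu> * (\<Sum>t<T. 1 / gam z0 t * (vnorm (half z0 t - zs))\<^sup>2)"
      using mu_pos by (intro mult_left_mono) auto
    also have "\<dots> \<le> (vnorm (z0 - zs))\<^sup>2"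
    proof -
      have "0 \<le> (\<Sum>t<T. (vnorm (half z0 t - iter z0 t))\<^sup>2)"
        by (intro sum_nonneg) simp
      then show ?thesis
        using energy_sum[OF z0 nz] zero_le_power2[of "vnorm (iter z0 T - zs)"] by argo
    qed
    finally have upper: "2 * ((\<mu> * G) * (vnorm (L - zs))\<^sup>2) \<le> (vnorm (z0 - zs))\<^sup>2"
      by (simp add: mult_ac)
    have "10 / 19 \<le> \<mu> * G"
      unfolding G_def by (rule weight_sum_lower_bound[OF z0 nz T b T3])
    then have "10 / 19 * (vnorm (L - zs))\<^sup>2 \<le> (\<mu> * G) * (vnorm (L - zs))\<^sup>2"
      by (rule mult_right_mono) simp
    then have "(vnorm (L - zs))\<^sup>2 \<le> 19 / 20 * (vnorm (z0 - zs))\<^sup>2"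
      using upper by argo
    moreover have "L \<in> carrier_vec d"
      unfolding L by simp
    ultimately show ?thesis
      by (simp add: L_def)
  qed
  then show "LEN d F schur rt m T z0 \<in> carrier_vec d"
    "(vnorm (LEN d F schur rt m T z0 - zs))\<^sup>2 \<le> 19 / 20 * (vnorm (z0 - zs))\<^sup>2"
    by auto
qed

text \<open>Both hypotheses are monotone in the distance to \<open>zs\<close>, which never grows, so
  the \<open>T\<close> and \<open>b\<close> fixed for the first run serve every restart.\<close>

lemma LEN_restart_bound:
  assumes z0: "z0 \<in> carrier_vec d"
    and b: "M * (vnorm (z0 - zs) + 3 * (\<rho> / \<mu>) * (vnorm (z0 - zs))\<^sup>2) \<le> b"
    and T3: "(2 * M * vnorm (z0 - zs) / \<mu>)\<^sup>2 \<le> real T ^ 3"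
  shows "LEN_restart d F schur rt m T z0 s \<in> carrier_vec d \<and>
    (vnorm (LEN_restart d F schur rt m T z0 s - zs))\<^sup>2 \<le> (19 / 20) ^ s * (vnorm (z0 - zs))\<^sup>2"
proof (induction s)
  case (Suc s)
  let ?w = "LEN_restart d F schur rt m T z0 s"
  have "(19 / 20 :: real) ^ s * (vnorm (z0 - zs))\<^sup>2 \<le> 1 * (vnorm (z0 - zs))\<^sup>2"
    by (intro mult_right_mono power_le_one) auto
  then have "(vnorm (?w - zs))\<^sup>2 \<le> (vnorm (z0 - zs))\<^sup>2"
    using Suc by argo
  then have le: "vnorm (?w - zs) \<le> vnorm (z0 - zs)"
    by (rule power2_le_imp_le) simp
  have "M * (vnorm (?w - zs) + 3 * (\<rho> / \<mu>) * (vnorm (?w - zs))\<^sup>2) \<le>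
      M * (vnorm (z0 - zs) + 3 * (\<rho> / \<mu>) * (vnorm (z0 - zs))\<^sup>2)"
    using le M_pos rho_pos mu_pos by (intro mult_left_mono add_mono power_mono) auto
  then have b': "M * (vnorm (?w - zs) + 3 * (\<rho> / \<mu>) * (vnorm (?w - zs))\<^sup>2) \<le> b"
    using b by (rule order_trans)
  have "(2 * M * vnorm (?w - zs) / \<mu>)\<^sup>2 \<le> (2 * M * vnorm (z0 - zs) / \<mu>)\<^sup>2"
    using le M_pos mu_pos by (intro power_mono divide_right_mono mult_left_mono) auto
  then have T3': "(2 * M * vnorm (?w - zs) / \<mu>)\<^sup>2 \<le> real T ^ 3"
    using T3 by (rule order_trans)
  have "?w \<in> carrier_vec d"
    using Suc by simp
  note con = LEN_contraction[OF this b' T3']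
  have "(vnorm (LEN d F schur rt m T ?w - zs))\<^sup>2 \<le> 19 / 20 * ((19 / 20) ^ s * (vnorm (z0 - zs))\<^sup>2)"
    using con(2) Suc by argo
  then show ?case
    using con(1) by simp
qed (use z0 in simp)

end

section \<open>Complexity\<close>

lemma sum_multiples_le:
  fixes X :: real
  assumes m: "0 < m" and X: "0 \<le> X"
  shows "(\<Sum>t<T. if t mod m = 0 then X else 0) \<le> (real T / real m + 1) * X"
proof -
  \<comment> \<open>The quotient \<open>T div m\<close> is included because its multiple lies below
    \<open>T\<close> when \<open>m\<close> does not divide \<open>T\<close>; this is the origin of
    the added 1.\<close>
  have "{t. t < T \<and> t mod m = 0} \<subseteq> (\<lambda>k. k * m) ` {..T div m}"
  proof
    fix t assume t: "t \<in> {t. t < T \<and> t mod m = 0}"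
    then have "t = (t div m) * m" "t div m \<le> T div m"
      by (auto simp: div_le_mono)
    then show "t \<in> (\<lambda>k. k * m) ` {..T div m}"
      by blast
  qed
  then have "card {t. t < T \<and> t mod m = 0} \<le> card {..T div m}"
    by (rule surj_card_le[rotated]) simp
  then have "real (card {t. t < T \<and> t mod m = 0}) \<le> real (T div m) + 1"
    by simp
  also have "\<dots> \<le> real T / real m + 1"
    using of_nat_div_le_of_nat[of T m] by simp
  finally have "real (card {t. t < T \<and> t mod m = 0}) * X \<le> (real T / real m + 1) * X"
    using X by (rule mult_right_mono)
  moreover have "(\<Sum>t<T. if t mod m = 0 then X else 0) = real (card {t. t < T \<and> t mod m = 0}) * X"
    by (simp add: sum.If_cases Int_def)
  ultimately show ?thesis
    by simp
qed

text \<open>An early stop only shortens a sum of nonnegative costs, so all \<open>T\<close>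
  iterations can be charged.\<close>

lemma LEN_cost_le:
  assumes "0 \<le> N" "0 \<le> c" and m: "0 < m"
  shows "LEN_cost N c d F schur K M m T z0 \<le>
    (real T / real m + 1) * (N * real d + c * real d ^ 3) +
    real T * (2 * N + real (K + 2) * solve_cost c d + 2 * c * real d) + N + c * real d"
proof -
  let ?n = "len_stop d F schur (bisect_root schur K M) m z0 T"
  let ?X = "N * real d + c * real d ^ 3"
  let ?Y = "2 * N + real (K + 2) * solve_cost c d + 2 * c * real d"
  have X: "0 \<le> ?X" and Y: "0 \<le> ?Y"
    using assms by (auto simp: solve_cost_def)
  have it: "iter_cost N c d m K t = (if t mod m = 0 then ?X else 0) + ?Y" for t
    unfolding iter_cost_def by simp
  have "?n \<le> T"
    unfolding len_stop_def by (rule Least_le) simp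
  then have "(\<Sum>t<?n. iter_cost N c d m K t) \<le> (\<Sum>t<T. iter_cost N c d m K t)"
    using X Y by (intro sum_mono2) (auto simp: it)
  also have "\<dots> = (\<Sum>t<T. if t mod m = 0 then ?X else 0) + real T * ?Y"
    by (simp only: it sum.distrib sum_constant card_lessThan distrib_left)
  also have "\<dots> \<le> (real T / real m + 1) * ?X + real T * ?Y"
    using sum_multiples_le[OF m X] by (rule add_right_mono)
  finally show ?thesis
    unfolding LEN_cost_def by argo
qed

text \<open>\<open>P\<close> stands for the last factor of the final bound. As \<open>m\<close> is
  at least \<open>c1 * d\<close>, the \<open>T / m\<close> refreshes of the Jacobian cost
  \<open>T * (N + d^2)\<close> up to constants; the one extra refresh costs
  \<open>d * (N + d^2)\<close> and is covered by \<open>real d \<le> P\<close>. In the constant,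
  \<open>2 * (1 + c)\<close> pays for that refresh and for the closing evaluation, and
  \<open>6 * c\<close> for the solves and vector operations of an iteration.\<close>

lemma LEN_cost_bound:
  fixes a P :: real
  assumes N: "0 \<le> N" and c: "0 \<le> c" and c1: "0 < c1" and d: "0 < d"
    and m: "c1 * real d \<le> real m" and a: "0 \<le> a" and P: "real d \<le> P" and T: "real T \<le> a * P"
  shows "LEN_cost N c d F schur K M m T z0 \<le>
    (a * (1 + c) / c1 + 2 * (1 + c) + a * (2 + 6 * c)) * real (K + 2) * ((N + real d ^ 2) * P)"
proof -
  define W where "W = N + real d ^ 2"
  define k where "k = real (K + 2)"
  have d1: "1 \<le> real d"
    using d by simp
  have W: "0 \<le> W" "N \<le> W" "real d ^ 2 \<le> W"
    using N by (auto simp: W_def)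
  have dW: "real d \<le> W"
    by (rule order_trans[OF self_le_power[OF d1] W(3)]) simp
  have k1: "1 \<le> k"
    by (simp add: k_def)
  have P1: "1 \<le> P"
    using d1 P by (rule order_trans)
  have cW: "c * real d ^ 2 \<le> c * W" "c * real d \<le> c * W"
    using c W dW by (auto intro: mult_left_mono)
  have m0: "0 < real m"
    using m mult_pos_pos[OF c1, of "real d"] d by simp
  have X: "N * real d + c * real d ^ 3 \<le> (1 + c) * (real d * W)"
  proof -
    have "N * real d + c * real d ^ 3 = real d * (N + c * real d ^ 2)"
      by (simp add: power2_eq_square power3_eq_cube algebra_simps)
    also have "\<dots> \<le> real d * (W + c * W)"
      by (rule mult_left_mono[OF add_mono[OF W(2) cW(1)]]) simp
    finally show ?thesis
      by (simp add: algebra_simps)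
  qed
  have "real T / real m * (N * real d + c * real d ^ 3) \<le> real T / (c1 * real d) * ((1 + c) * (real d * W))"
  proof (rule mult_mono[OF _ X])
    show "real T / real m \<le> real T / (c1 * real d)"
      using m m0 c1 d by (intro divide_left_mono mult_pos_pos) auto
    show "0 \<le> real T / (c1 * real d)" "0 \<le> N * real d + c * real d ^ 3"
      using c1 N c by auto
  qed
  also have "\<dots> = real T * ((1 + c) / c1 * W)"
    using d by simp
  also have "\<dots> \<le> (a * P) * ((1 + c) / c1 * W)"
    using T c c1 W by (intro mult_right_mono) auto
  finally have 1: "real T / real m * (N * real d + c * real d ^ 3) \<le> a * (1 + c) / c1 * (W * P)"
    by (simp add: mult_ac)
  have "(1 + c) * (real d * W) \<le> (1 + c) * (P * W)"
    using P W c by (intro mult_left_mono mult_right_mono) auto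
  then have 2: "N * real d + c * real d ^ 3 \<le> (1 + c) * (W * P)"
    using X by (simp add: mult_ac)
  have "N + c * real d \<le> (1 + c) * W"
    using W cW by (simp add: algebra_simps)
  also have "\<dots> \<le> (1 + c) * (W * P)"
    using W c P1 by (intro mult_left_mono) (auto simp: mult_le_cancel_left1)
  finally have 3: "N + c * real d \<le> (1 + c) * (W * P)" .
  have "solve_cost c d \<le> 4 * c * W"
    using cW unfolding solve_cost_def by simp
  then have "k * solve_cost c d \<le> k * (4 * c * W)"
    using k1 by (intro mult_left_mono) auto
  moreover have "2 * N \<le> k * (2 * W)"
    using mult_mono[OF k1, of "2 * N" "2 * W"] W N k1 by simp
  moreover have "2 * c * real d \<le> k * (2 * c * W)"
    using mult_mono[OF k1, of "2 * c * real d" "2 * c * W"] cW c k1 by simp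
  ultimately have "2 * N + k * solve_cost c d + 2 * c * real d \<le> k * ((2 + 6 * c) * W)"
    by (simp add: algebra_simps)
  then have "real T * (2 * N + k * solve_cost c d + 2 * c * real d) \<le> (a * P) * (k * ((2 + 6 * c) * W))"
    using T a P1 N c by (intro mult_mono) (auto simp: solve_cost_def k_def)
  then have 4: "real T * (2 * N + k * solve_cost c d + 2 * c * real d) \<le> a * (2 + 6 * c) * k * (W * P)"
    by (simp add: mult_ac)
  let ?A = "a * (1 + c) / c1 + 2 * (1 + c)"
  have "?A * (W * P) \<le> ?A * (W * P) * k"
  proof -
    have "0 \<le> ?A * (W * P)"
      using a c c1 W P1 by (intro mult_nonneg_nonneg add_nonneg_nonneg divide_nonneg_pos) auto
    then show ?thesis
      using mult_left_mono[OF k1] by fastforce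
  qed
  then have 5: "a * (1 + c) / c1 * (W * P) + (1 + c) * (W * P) + (1 + c) * (W * P) \<le> ?A * k * (W * P)"
    by (simp add: algebra_simps)
  have "LEN_cost N c d F schur K M m T z0 \<le>
    (real T / real m + 1) * (N * real d + c * real d ^ 3) +
    real T * (2 * N + k * solve_cost c d + 2 * c * real d) + N + c * real d"
    unfolding k_def using m0 by (intro LEN_cost_le N c) simp
  also have "\<dots> \<le> (?A + a * (2 + 6 * c)) * k * (W * P)"
    using 1 2 3 4 5 by (simp only: distrib_right mult_1_left)
  finally show ?thesis
    by (simp add: W_def k_def)
qed

section \<open>Numbers of iterations, restarts and bisections\<close>

lemma iteration_count:
  fixes x :: real
  assumes x: "0 \<le> x" and T: "T = nat \<lceil>x powr (2 / 3)\<rceil>"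
  shows "x\<^sup>2 \<le> real T ^ 3" and "real T \<le> x powr (2 / 3) + 1"
proof -
  have ge: "x powr (2 / 3) \<le> real T"
    unfolding T by linarith
  have "(x powr (2 / 3)) ^ 3 = x\<^sup>2"
  proof (cases "x = 0")
    case False
    then have "(x powr (2 / 3)) ^ 3 = x powr (2 / 3 * 3)"
      by (simp add: powr_power)
    also have "\<dots> = x\<^sup>2"
      using x False by simp
    finally show ?thesis .
  qed simp
  then show "x\<^sup>2 \<le> real T ^ 3"
    using power_mono[OF ge, of 3] by simp
  have "0 \<le> x powr (2 / 3)"
    by simp
  then show "real T \<le> x powr (2 / 3) + 1"
    unfolding T by linarith
qed

text \<open>Follows from 19/20 \<le> exp (- 1/20). The factor 40 is twice 20 because squared
  distances contract, whereas \<open>y\<close> is a ratio of distances.\<close>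

lemma restart_count:
  fixes y :: real
  assumes y: "1 \<le> y" and S: "S = nat \<lceil>40 * ln y\<rceil>"
  shows "(19 / 20 :: real) ^ S * y\<^sup>2 \<le> 1"
proof -
  have "(19 / 20 :: real) ^ S \<le> exp (- 1 / 20) ^ S"
    using exp_ge_add_one_self[of "- 1 / 20"] by (intro power_mono) auto
  also have "\<dots> = exp (- (real S / 20))"
    by (simp flip: exp_of_nat_mult)
  also have "\<dots> \<le> exp (- (2 * ln y))"
  proof -
    have "40 * ln y \<le> real S"
      unfolding S by linarith
    then show ?thesis
      by simp
  qed
  also have "\<dots> = 1 / y\<^sup>2"
  proof -
    have "exp (2 * ln y) = y\<^sup>2"
      using y exp_of_nat_mult[of 2 "ln y"] by simp
    then show ?thesis
      by (simp add: exp_minus inverse_eq_divide)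
  qed
  finally show ?thesis
    using y by (simp add: pos_le_divide_eq)
qed

text \<open>The factor 2 pays for using the natural instead of the binary logarithm, since
  \<open>exp (1 / 2) \<le> 2\<close>.\<close>

lemma bisection_count:
  fixes Y :: real
  assumes Y: "1 \<le> Y" and K: "K = nat \<lceil>2 * ln Y\<rceil>"
  shows "Y \<le> 2 ^ K"
proof -
  have "Y = exp (ln Y)"
    using Y by simp
  also have "\<dots> \<le> exp (real K * (1 / 2))"
  proof -
    have "2 * ln Y \<le> real K"
      unfolding K by linarith
    then show ?thesis
      by simp
  qed
  also have "\<dots> = exp (1 / 2) ^ K"
    by (rule exp_of_nat_mult)
  also have "\<dots> \<le> 2 ^ K"
  proof (intro power_mono)
    have "exp (1 / 2 :: real) ^ 2 = exp 1"
      using exp_of_nat_mult[of 2 "1 / 2 :: real"] by simp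
    then have "exp (1 / 2 :: real) ^ 2 \<le> 2 ^ 2"
      using exp_le by simp
    then show "exp (1 / 2 :: real) \<le> 2"
      by (rule power2_le_imp_le) simp
  qed simp
  finally show ?thesis .
qed

lemma ceiling_count_le:
  fixes x :: real
  assumes "0 \<le> x"
  shows "real (nat \<lceil>x\<rceil>) \<le> x + 1"
  using assms by linarith

text \<open>\<open>C\<close> and \<open>p\<close> come from \<open>c1\<close>, \<open>c2\<close>,
  \<open>c\<close> and the bound \<open>D\<close> on the initial distance alone, hence are uniform
  in the dimension. \<open>S\<close> and \<open>K\<close> are fixed before the function, the
  decomposition routine and the starting point, so they can be computed from the parameters.
  Accuracy is claimed for the exact root and for the bisection; the cost is that of the
  bisection.\<close>

theorem corollary4p1:
  fixes c1 c2 c D :: real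
  assumes "0 < c1" and "c1 \<le> c2" and "0 \<le> c" and "0 \<le> D"
  shows "\<exists>(C :: real) (p :: nat).
    \<forall>(dx :: nat) (dy :: nat) (m :: nat) (\<rho> :: real) (\<mu> :: real) (N :: real) (\<epsilon> :: real)
      d \<kappa> M.
      d = dx + dy \<longrightarrow> 0 < \<rho> \<longrightarrow> 0 < \<mu> \<longrightarrow> 0 \<le> N \<longrightarrow> 0 < \<epsilon> \<longrightarrow>
      0 < m \<longrightarrow> c1 * real d \<le> real m \<longrightarrow> real m \<le> c2 * real d \<longrightarrow>
      \<kappa> = \<rho> / \<mu> \<longrightarrow> M = 3 * \<rho> * real m \<longrightarrow>
      (\<exists>(S :: nat) (K :: nat).
        \<forall>(f :: real vec \<Rightarrow> real vec \<Rightarrow> real)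
         (schur :: real mat \<Rightarrow> complex mat \<times> complex mat)
         (z0 :: real vec) (zs :: real vec) F T.
          twice_cont_diff d (joint dx dy f) \<longrightarrow>
          lipschitz_hessian d \<rho> (joint dx dy f) \<longrightarrow>
          sc_sc dx dy \<mu> f \<longrightarrow>
          saddle_point dx dy f zs \<longrightarrow>
          (\<forall>A\<in>carrier_mat d d. schur_decomp d A (schur A)) \<longrightarrow>
          z0 \<in> carrier_vec d \<longrightarrow> vnorm (z0 - zs) \<le> D \<longrightarrow>
          F = saddle_op dx dy f \<longrightarrow>
          T = nat \<lceil>(2 * M * vnorm (z0 - zs) / \<mu>) powr (2 / 3)\<rceil> \<longrightarrow>
          vnorm (LEN_restart d F schur (exact_root M) m T z0 S - zs) \<le> \<epsilon> \<and>
          vnorm (LEN_restart d F schur (bisect_root schur K M) m T z0 S - zs) \<le> \<epsilon> \<and>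
          LEN_restart_cost N c d F schur K M m T z0 S
            \<le> C * ln (3 + real d + \<kappa> + 1 / \<epsilon>) ^ p *
              ((N + real d ^ 2) * (real d + real d powr (2 / 3) * \<kappa> powr (2 / 3))))"
proof -
  \<comment> \<open>Makes \<open>T\<close> at most \<open>a * P\<close>: the 6 is the 2 in
    \<open>T\<close> times the 3 in \<open>M\<close>, and the 1 pays for rounding up.\<close>
  define a where "a = (6 * c2 * D) powr (2 / 3) + 1"
  define C1 where "C1 = a * (1 + c) / c1 + 2 * (1 + c) + a * (2 + 6 * c)"
  \<comment> \<open>Chosen so that \<open>Y \<le> E * X ^ 3\<close>; the factors \<kappa>,
    \<open>m\<close> and \<open>1 + \<kappa>\<close> contribute one \<open>X\<close> each.\<close>
  define E where "E = 1 + 300 * c2 * (D + 3 * D\<^sup>2)"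
  \<comment> \<open>In \<open>CS\<close> and \<open>CK\<close>, the numbers 41 and 9 collect the
    coefficient of \<open>L\<close> and the constants left by rounding, by \<open>1 \<le> L\<close>:
    40 + 1 for the restarts and 6 + 3 for \<open>K + 2\<close>.\<close>
  define CS where "CS = 40 * ln (1 + D) + 41"
  define CK where "CK = 2 * ln E + 9"
  have c2: "0 < c2"
    using assms by simp
  have a: "0 \<le> a"
    by (simp add: a_def add_nonneg_nonneg)
  have C1: "0 \<le> C1"
    using a assms by (auto simp: C1_def intro!: add_nonneg_nonneg mult_nonneg_nonneg divide_nonneg_pos)
  have E: "1 \<le> E"
    using c2 assms by (simp add: E_def)
  have CS: "0 \<le> CS" and CK: "0 \<le> CK"
    using assms E by (auto simp: CS_def CK_def intro!: add_nonneg_nonneg)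
  show ?thesis
  \<comment> \<open>The exponent is 2: one logarithm counts the restarts, the other the
    bisections.\<close>
  proof (rule exI[of _ "CS * (C1 * CK)"], rule exI[of _ 2], intro allI impI)
    fix dx dy m :: nat and \<rho> \<mu> N \<epsilon> :: real and d :: nat and \<kappa> M :: real
    assume d: "d = dx + dy" and \<rho>: "0 < \<rho>" and \<mu>: "0 < \<mu>" and N: "0 \<le> N" and \<epsilon>: "0 < \<epsilon>"
      and m: "0 < m" and m1: "c1 * real d \<le> real m" and m2: "real m \<le> c2 * real d"
      and \<kappa>_def: "\<kappa> = \<rho> / \<mu>" and M: "M = 3 * \<rho> * real m"
    \<comment> \<open>The 3 makes \<open>ln X\<close> at least 1, so that constants can be absorbed
      into multiples of \<open>L\<close>.\<close>
    define X where "X = 3 + real d + \<kappa> + 1 / \<epsilon>"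
    define L where "L = ln X"
    \<comment> \<open>\<open>\<epsilon> * y\<close> is \<open>\<epsilon> + D\<close> and bounds the
      initial distance, and \<open>1 \<le> y\<close> keeps the logarithm nonnegative even for large
      \<epsilon>.\<close>
    define y where "y = 1 + D / \<epsilon>"
    \<comment> \<open>Determined by \<open>b = \<mu> / 100 * (Y - 1)\<close>; the 300 is the 3 in
      \<open>M\<close> times the inverse of the precision 1 / 100.\<close>
    define Y where "Y = 1 + 300 * \<kappa> * real m * (D + 3 * \<kappa> * D\<^sup>2)"
    define S where "S = nat \<lceil>40 * ln y\<rceil>"
    define K where "K = nat \<lceil>2 * ln Y\<rceil>"
    define P where "P = real d + real d powr (2 / 3) * \<kappa> powr (2 / 3)"
    \<comment> \<open>\<open>M\<close> times the bound of \<open>lazy_newton_bound\<close> at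
      distance \<open>D\<close>, hence a bound on all initial brackets.\<close>
    define b where "b = M * (D + 3 * \<kappa> * D\<^sup>2)"
    have \<kappa>: "0 < \<kappa>"
      using \<rho> \<mu> by (simp add: \<kappa>_def)
    have M0: "0 < M"
      using \<rho> m by (simp add: M)
    \<comment> \<open>The upper bound on the positive \<open>m\<close> excludes dimension 0.\<close>
    have d0: "0 < d"
      using m m2 by (cases d) auto
    have X: "3 \<le> X" "\<kappa> \<le> X" "1 + \<kappa> \<le> X" "real d \<le> X" "1 + 1 / \<epsilon> \<le> X"
      using \<kappa> \<epsilon> by (auto simp: X_def)
    have L: "1 \<le> L"
    proof -
      have "exp 1 \<le> X"
        using exp_le X(1) by simp
      then have "ln (exp 1) \<le> ln X"
        using X(1) by (subst ln_le_cancel_iff) auto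
      then show ?thesis
        by (simp add: L_def)
    qed
    have y: "1 \<le> y"
      using assms \<epsilon> by (simp add: y_def)
    have Y: "1 \<le> Y"
      using \<kappa> assms by (simp add: Y_def)
    have S_le: "real S \<le> CS * L"
    proof -
      have "y \<le> (1 + D) * (1 + 1 / \<epsilon>)"
        using assms \<epsilon> by (simp add: y_def distrib_left distrib_right add_divide_distrib)
      also have "\<dots> \<le> (1 + D) * X"
        using X(5) assms by (intro mult_left_mono) auto
      finally have "ln y \<le> ln ((1 + D) * X)"
        using y by (intro ln_mono) auto
      also have "\<dots> = ln (1 + D) + L"
        using assms X(1) by (simp add: L_def ln_mult_pos)
      finally have "ln y \<le> ln (1 + D) + L" .
      moreover have "real S \<le> 40 * ln y + 1"
        unfolding S_def using y by (intro ceiling_count_le) simp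
      ultimately have "real S \<le> 40 * ln (1 + D) + (40 * L + 1)"
        by argo
      also have "\<dots> \<le> 40 * ln (1 + D) * L + (40 * L + L)"
        using L assms mult_left_mono[OF L, of "40 * ln (1 + D)"] by (intro add_mono) auto
      finally show ?thesis
        by (simp add: CS_def algebra_simps)
    qed
    have K_le: "real (K + 2) \<le> CK * L"
    proof -
      have X3: "1 \<le> X ^ 3"
        using X(1) by (intro one_le_power) simp
      have "D + 3 * \<kappa> * D\<^sup>2 \<le> (D + 3 * D\<^sup>2) * (1 + \<kappa>)"
        using \<kappa> assms by (simp add: algebra_simps)
      also have "\<dots> \<le> (D + 3 * D\<^sup>2) * X"
        using X(3) assms by (intro mult_left_mono) auto
      finally have Db: "D + 3 * \<kappa> * D\<^sup>2 \<le> (D + 3 * D\<^sup>2) * X" .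
      have "real m \<le> c2 * X"
        using m2 mult_left_mono[OF X(4), of c2] c2 by linarith
      then have "\<kappa> * real m \<le> X * (c2 * X)"
        using X \<kappa> by (intro mult_mono) auto
      from mult_mono[OF this Db] have "(\<kappa> * real m) * (D + 3 * \<kappa> * D\<^sup>2) \<le> (X * (c2 * X)) * ((D + 3 * D\<^sup>2) * X)"
        using X \<kappa> c2 assms by simp
      then have "Y \<le> 1 + 300 * c2 * (D + 3 * D\<^sup>2) * X ^ 3"
        by (simp add: Y_def power3_eq_cube algebra_simps)
      also have "\<dots> \<le> E * X ^ 3"
        using X3 by (simp add: E_def algebra_simps)
      finally have "ln Y \<le> ln (E * X ^ 3)"
        using Y by (intro ln_mono) auto
      also have "\<dots> = ln E + 3 * L"
        using E X(1) by (simp add: L_def ln_mult_pos ln_realpow)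
      finally have "ln Y \<le> ln E + 3 * L" .
      moreover have "real K \<le> 2 * ln Y + 1"
        unfolding K_def using Y by (intro ceiling_count_le) simp
      ultimately have "real (K + 2) \<le> 2 * ln E + (6 * L + 3)"
        by simp
      also have "\<dots> \<le> 2 * ln E * L + (6 * L + 3 * L)"
        using L E mult_left_mono[OF L, of "2 * ln E"] by (intro add_mono) auto
      finally show ?thesis
        by (simp add: CK_def algebra_simps)
    qed
    have b_le: "b \<le> 1 / 100 * \<mu> * 2 ^ K"
    proof -
      have "b = \<mu> * (1 / 100 * (Y - 1))"
        using \<mu> by (simp add: b_def M Y_def \<kappa>_def)
      also have "\<dots> \<le> \<mu> * (1 / 100 * 2 ^ K)"
        using bisection_count[OF Y K_def] \<mu> by (intro mult_left_mono) auto
      finally show ?thesis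
        by simp
    qed
    show "\<exists>S K. \<forall>f schur z0 zs F T.
          twice_cont_diff d (joint dx dy f) \<longrightarrow>
          lipschitz_hessian d \<rho> (joint dx dy f) \<longrightarrow>
          sc_sc dx dy \<mu> f \<longrightarrow>
          saddle_point dx dy f zs \<longrightarrow>
          (\<forall>A\<in>carrier_mat d d. schur_decomp d A (schur A)) \<longrightarrow>
          z0 \<in> carrier_vec d \<longrightarrow> vnorm (z0 - zs) \<le> D \<longrightarrow>
          F = saddle_op dx dy f \<longrightarrow>
          T = nat \<lceil>(2 * M * vnorm (z0 - zs) / \<mu>) powr (2 / 3)\<rceil> \<longrightarrow>
          vnorm (LEN_restart d F schur (exact_root M) m T z0 S - zs) \<le> \<epsilon> \<and>
          vnorm (LEN_restart d F schur (bisect_root schur K M) m T z0 S - zs) \<le> \<epsilon> \<and>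
          LEN_restart_cost N c d F schur K M m T z0 S
            \<le> CS * (C1 * CK) * ln (3 + real d + \<kappa> + 1 / \<epsilon>) ^ 2 *
              ((N + real d ^ 2) * (real d + real d powr (2 / 3) * \<kappa> powr (2 / 3)))"
    proof (rule exI[of _ S], rule exI[of _ K], intro allI impI)
      fix f schur z0 zs F T
      assume f: "twice_cont_diff d (joint dx dy f)" "lipschitz_hessian d \<rho> (joint dx dy f)"
          "sc_sc dx dy \<mu> f" "saddle_point dx dy f zs"
        and schur: "\<forall>A\<in>carrier_mat d d. schur_decomp d A (schur A)"
        and z0: "z0 \<in> carrier_vec d" and D: "vnorm (z0 - zs) \<le> D"
        and F: "F = saddle_op dx dy f"
        and T: "T = nat \<lceil>(2 * M * vnorm (z0 - zs) / \<mu>) powr (2 / 3)\<rceil>"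
      interpret strongly_monotone_root d F \<rho> \<mu> zs
        unfolding F by (rule saddle_op_strongly_monotone_root[OF d \<rho> \<mu> f])
      let ?x = "2 * M * vnorm (z0 - zs) / \<mu>"
      have x: "0 \<le> ?x"
        using M0 \<mu> by simp
      note T3 = iteration_count(1)[OF x T]
      have dist: "vnorm (LEN_restart d F schur rt m T z0 S - zs) \<le> \<epsilon>"
        if rt: "good_rule d \<mu> M (1 / 100) b rt" for rt
      proof -
        interpret len_run d F \<rho> \<mu> zs schur rt m M b
          by unfold_locales (use schur m M rt in auto)
        have "M * (vnorm (z0 - zs) + 3 * (\<rho> / \<mu>) * (vnorm (z0 - zs))\<^sup>2) \<le> b"
          unfolding b_def \<kappa>_def using D M0 \<rho> \<mu> by (intro mult_left_mono add_mono power_mono) auto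
        from LEN_restart_bound[OF z0 this T3]
        have "(vnorm (LEN_restart d F schur rt m T z0 S - zs))\<^sup>2 \<le> (19 / 20) ^ S * (vnorm (z0 - zs))\<^sup>2"
          by blast
        also have "\<dots> \<le> (19 / 20) ^ S * (\<epsilon> * y)\<^sup>2"
        proof -
          have "D \<le> \<epsilon> * y"
            using \<epsilon> by (simp add: y_def field_simps)
          then show ?thesis
            using D by (intro mult_left_mono power_mono) auto
        qed
        also have "\<dots> = \<epsilon>\<^sup>2 * ((19 / 20) ^ S * y\<^sup>2)"
          by (simp add: power_mult_distrib)
        also have "\<dots> \<le> \<epsilon>\<^sup>2 * 1"
          using restart_count[OF y S_def] by (intro mult_left_mono) auto
        finally show ?thesis
          unfolding mult_1_right by (rule power2_le_imp_le) (use \<epsilon> in simp)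
      qed
      have exact: "vnorm (LEN_restart d F schur (exact_root M) m T z0 S - zs) \<le> \<epsilon>"
        by (rule dist[OF good_rule_exact[OF \<mu> M0]]) simp
      have bisect: "vnorm (LEN_restart d F schur (bisect_root schur K M) m T z0 S - zs) \<le> \<epsilon>"
        by (rule dist[OF good_rule_bisect[OF \<mu> M0 schur b_le]])
      have "?x \<le> (6 * c2 * D) * (real d * \<kappa>)"
      proof -
        have "?x = 6 * \<kappa> * (real m * vnorm (z0 - zs))"
          by (simp add: M \<kappa>_def)
        also have "\<dots> \<le> 6 * \<kappa> * ((c2 * real d) * D)"
          using m2 D \<kappa> c2 by (intro mult_left_mono mult_mono) auto
        finally show ?thesis
          by (simp add: mult_ac)
      qed
      then have "?x powr (2 / 3) \<le> ((6 * c2 * D) * (real d * \<kappa>)) powr (2 / 3)"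
        using x by (intro powr_mono2) auto
      also have "\<dots> = (6 * c2 * D) powr (2 / 3) * (real d powr (2 / 3) * \<kappa> powr (2 / 3))"
        using c2 assms \<kappa> by (simp add: powr_mult)
      also have "\<dots> \<le> (6 * c2 * D) powr (2 / 3) * P"
        by (intro mult_left_mono) (auto simp: P_def)
      finally have "real T \<le> (6 * c2 * D) powr (2 / 3) * P + 1"
        using iteration_count(2)[OF x T] by linarith
      also have "1 \<le> P"
        using d0 by (simp add: P_def add_increasing2)
      finally have TP: "real T \<le> a * P"
        by (simp add: a_def algebra_simps)
      have P: "real d \<le> P"
        by (simp add: P_def)
      let ?W = "(N + real d ^ 2) * P"
      have P0: "0 \<le> P"
        by (simp add: P_def)
      have "LEN_restart_cost N c d F schur K M m T z0 S \<le> (\<Sum>s<S. C1 * real (K + 2) * ?W)"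
        unfolding LEN_restart_cost_def C1_def
        by (intro sum_mono LEN_cost_bound[OF N assms(3,1) d0 m1 a P TP])
      also have "\<dots> = real S * (C1 * real (K + 2) * ?W)"
        by simp
      also have "\<dots> \<le> (CS * L) * (C1 * (CK * L) * ?W)"
        using S_le K_le C1 N P0 CS CK L by (intro mult_mono mult_nonneg_nonneg order_refl) auto
      also have "\<dots> = CS * (C1 * CK) * L ^ 2 * ?W"
        by (simp add: power2_eq_square mult_ac)
      finally have "LEN_restart_cost N c d F schur K M m T z0 S \<le> CS * (C1 * CK) * L ^ 2 * ?W" .
      then show "vnorm (LEN_restart d F schur (exact_root M) m T z0 S - zs) \<le> \<epsilon> \<and>
          vnorm (LEN_restart d F schur (bisect_root schur K M) m T z0 S - zs) \<le> \<epsilon> \<and>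
          LEN_restart_cost N c d F schur K M m T z0 S
            \<le> CS * (C1 * CK) * ln (3 + real d + \<kappa> + 1 / \<epsilon>) ^ 2 *
              ((N + real d ^ 2) * (real d + real d powr (2 / 3) * \<kappa> powr (2 / 3)))"
        using exact bisect by (simp add: L_def X_def P_def)
    qed
  qed
qed

end
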